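(* Let $\mathbb{X}$ be an isonormal Gaussian process over a real separable Hilbert space $\mathfrak{H}$. Assume that $u\in\mathrm{Dom}\,\delta$, $F=\delta(u)\in\mathbb{D}^{3,2}$ and $\mathbb{E}(F^2)=1$. Let $Z$ be a standard normal random variable. Then $$d_{\rm TV}(F,Z)\le(8+\sqrt{32\pi})\,\mathbb{E}\big(\|D(D_uF)\|_{\mathfrak{H}}^2\big)+\sqrt{2\pi}\,|\mathbb{E}(F^3)|+\sqrt{32\pi}\,\mathbb{E}(|D_u^2F|^2)+4\pi\,\mathbb{E}(|D_u^3F|).$$
   Context: The isonormal Gaussian process $\mathbb{X}=\{\mathbb{X}(\phi):\phi\in\mathfrak{H}\}$ is a centered Gaussian family on a probability space $(\Omega,\mathcal{F},P)$ with $\mathbb{E}(\mathbb{X}(\phi)\mathbb{X}(\psi))=\langle\phi,\psi\rangle_{\mathfrak{H}}$, and $\mathcal{F}$ is generated by $\mathbb{X}$. $D$ is the Malliavin derivative: $DF=\sum_i\partial_if(\mathbb{X}(\varphi_1),\dots,\mathbb{X}(\varphi_n))\varphi_i$ for $F=f(\mathbb{X}(\varphi_1),\dots,\mathbb{X}(\varphi_n))$, $\varphi_i\in\mathfrak{H}$, $f\in C_b^\infty(\mathbb{R}^n)$, and $D^k$ is its $k$-th iterate; $\mathbb{D}^{k,p}$ is the closure of such random variables under $\|F\|_{k,p}^p=\mathbb{E}(|F|^p)+\sum_{i=1}^k\mathbb{E}(\|D^iF\|^p_{\mathfrak{H}^{\otimes i}})$. The divergence $\delta$ is the adjoint of $D$: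 $u\in L^2(\Omega;\mathfrak{H})$ is in $\mathrm{Dom}\,\delta$ if there is a constant $c_u$ with $|\mathbb{E}\langle DG,u\rangle_{\mathfrak{H}}|\le c_u\|G\|_{L^2(\Omega)}$ for all $G\in\mathbb{D}^{1,2}$, and then $\delta(u)$ is defined by $\mathbb{E}(G\delta(u))=\mathbb{E}\langle DG,u\rangle_{\mathfrak{H}}$ for all $G\in\mathbb{D}^{1,2}$. Notation: $D_uF=\langle u,DF\rangle_{\mathfrak{H}}$ and $D_u^{i+1}F=\langle u,D(D_u^iF)\rangle_{\mathfrak{H}}$ for $i\ge1$ (with $D_u^1F=D_uF$). The total variation distance is $d_{\rm TV}(F,G)=\sup_B|P(F\in B)-P(G\in B)|$, the supremum running over all Borel sets $B\subset\mathbb{R}$.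
   Formalization: It is additionally assumed that D_uF and D_u²F belong to 𝔻^{1,2}, the domain of D as an operator on L²(Ω); the stated conditions on u and F do not guarantee this, and without it D(D_uF), D_u²F and D_u³F need not be defined. *)

theory Defs
  imports "HOL-Probability.Probability"
begin

section \<open>Isonormal Gaussian processes\<close>

definition centered_gaussian :: "'a measure \<Rightarrow> ('a \<Rightarrow> real) \<Rightarrow> bool" where
  "centered_gaussian M Y \<longleftrightarrow>
     (Y \<in> borel_measurable M \<and> (AE \<omega> in M. Y \<omega> = 0)) \<or>
     (\<exists>\<sigma>>0. distributed M lborel Y (\<lambda>x. ennreal (normal_density 0 \<sigma> x)))"

text \<open>
  The real separable Hilbert space is the type \<open>'h\<close>.  A centered Gaussian family is one all of whose
  finite linear combinations are centered Gaussian, the degenerate law being allowed.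
\<close>

locale isonormal_process = prob_space M
  for M :: "'a measure"
    and X :: "'h::{real_inner, complete_space, second_countable_topology} \<Rightarrow> 'a \<Rightarrow> real" +
  assumes gaussian: "finite I \<Longrightarrow> centered_gaussian M (\<lambda>\<omega>. \<Sum>\<phi>\<in>I. c \<phi> * X \<phi> \<omega>)"
    and covariance: "expectation (\<lambda>\<omega>. X \<phi> \<omega> * X \<psi> \<omega>) = \<phi> \<bullet> \<psi>"
    and generated: "sets M = sigma_sets (space M) {X \<phi> -` B \<inter> space M |\<phi> B. B \<in> sets borel}"


section \<open>Smooth cylindrical random variables and their iterated derivatives\<close>

text \<open>
  A function on \<open>\<real>\<^sup>n\<close>, with \<open>n\<close> a natural number, is a function of a sequence which depends only on
  the coordinates below \<open>n\<close>.
\<close>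

definition partial :: "nat \<Rightarrow> ((nat \<Rightarrow> real) \<Rightarrow> real) \<Rightarrow> (nat \<Rightarrow> real) \<Rightarrow> real" where
  "partial i f x = deriv (\<lambda>t. f (x(i := t))) (x i)"

definition Cb_infinity :: "nat \<Rightarrow> ((nat \<Rightarrow> real) \<Rightarrow> real) \<Rightarrow> bool" where
  "Cb_infinity n f \<longleftrightarrow>
     (\<forall>x y. (\<forall>i<n. x i = y i) \<longrightarrow> f x = f y) \<and>
     (\<forall>is. set is \<subseteq> {..<n} \<longrightarrow>
        (let g = foldr partial is f in
           continuous_on UNIV g \<and> bounded (range g) \<and>
           (\<forall>i<n. \<forall>x. (\<lambda>t. g (x(i := t))) differentiable (at (x i)))))"

text \<open>The triple \<open>(n, f, \<phi>)\<close> stands for the random variable \<open>f (X (\<phi> 0), \<dots>, X (\<phi> (n - 1)))\<close>.\<close>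

type_synonym 'h cylinder = "nat \<times> ((nat \<Rightarrow> real) \<Rightarrow> real) \<times> (nat \<Rightarrow> 'h)"

definition smooth_cylinder :: "'h cylinder \<Rightarrow> bool" where
  "smooth_cylinder = (\<lambda>(n, f, \<phi>). Cb_infinity n f)"

definition cyl_rv :: "('h \<Rightarrow> 'a \<Rightarrow> real) \<Rightarrow> 'h cylinder \<Rightarrow> 'a \<Rightarrow> real" where
  "cyl_rv X = (\<lambda>(n, f, \<phi>) \<omega>. f (\<lambda>i. X (\<phi> i) \<omega>))"

definition cyl_grad :: "('h::real_inner \<Rightarrow> 'a \<Rightarrow> real) \<Rightarrow> 'h cylinder \<Rightarrow> 'a \<Rightarrow> 'h" where
  "cyl_grad X = (\<lambda>(n, f, \<phi>) \<omega>. \<Sum>i<n. partial i f (\<lambda>j. X (\<phi> j) \<omega>) *\<^sub>R \<phi> i)"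

text \<open>
  An element of the Hilbert space tensor power \<open>H\<^sup>\<otimes>\<^sup>k\<close> is represented by its Hilbert--Schmidt \<open>k\<close>-linear
  form, evaluated at lists of length \<open>k\<close>; so \<open>\<phi>\<^sub>1 \<otimes> \<dots> \<otimes> \<phi>\<^sub>k\<close> maps \<open>[h\<^sub>1, \<dots>, h\<^sub>k]\<close> to the product of the
  \<open>\<phi>\<^sub>l \<bullet> h\<^sub>l\<close>.  On lists of length \<open>k\<close> the following function is the iterate \<open>D\<^sup>k F\<close> of the cylindrical
  variable \<open>F\<close>, by \<open>D\<^sup>k\<^sup>+\<^sup>1 F = (\<Sum>i<n. \<phi> i \<otimes> D\<^sup>k (\<partial>\<^sub>i f (X (\<phi> 0), \<dots>, X (\<phi> (n - 1)))))\<close>.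
\<close>

fun cyl_deriv ::
  "('h::real_inner \<Rightarrow> 'a \<Rightarrow> real) \<Rightarrow> 'h cylinder \<Rightarrow> 'a \<Rightarrow> 'h list \<Rightarrow> real" where
  "cyl_deriv X C \<omega> [] = cyl_rv X C \<omega>"
| "cyl_deriv X (n, f, \<phi>) \<omega> (h # hs) =
     (\<Sum>i<n. (\<phi> i \<bullet> h) * cyl_deriv X (n, partial i f, \<phi>) \<omega> hs)"

text \<open>
  The norm of \<open>H\<^sup>\<otimes>\<^sup>k\<close>: the square root of the sum of the squared coefficients in an orthonormal basis,
  written as a supremum over finite orthonormal sets (a real supremum, to be used for forms of finite
  norm such as differences of the \<open>cyl_deriv X C \<omega>\<close>).
\<close>

definition tensor_norm :: "nat \<Rightarrow> ('h::real_inner list \<Rightarrow> real) \<Rightarrow> real" where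
  "tensor_norm k T =
     sqrt (SUP B\<in>{B. finite B \<and> pairwise orthogonal B \<and> (\<forall>b\<in>B. norm b = 1)}.
             \<Sum>hs\<in>{hs. set hs \<subseteq> B \<and> length hs = k}. (T hs)\<^sup>2)"

lemma cyl_deriv_singleton: "cyl_deriv X C \<omega> [h] = cyl_grad X C \<omega> \<bullet> h"
  by (cases C) (simp add: cyl_grad_def cyl_rv_def inner_sum_left mult.commute)

lemma tensor_norm_1: "tensor_norm 1 (\<lambda>hs. v \<bullet> hd hs) = norm v"
proof -
  let ?ON = "{B :: 'a set. finite B \<and> pairwise orthogonal B \<and> (\<forall>b\<in>B. norm b = 1)}"
  have lists: "{hs. set hs \<subseteq> B \<and> length hs = 1} = (\<lambda>b. [b]) ` B" for B :: "'a set"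
    by (auto simp: length_Suc_conv)
  have S: "(\<Sum>hs\<in>{hs. set hs \<subseteq> B \<and> length hs = 1}. (v \<bullet> hd hs)\<^sup>2) = (\<Sum>b\<in>B. (v \<bullet> b)\<^sup>2)"
    for B :: "'a set"
    unfolding lists by (subst sum.reindex) (auto simp: inj_on_def)
  have le: "(\<Sum>b\<in>B. (v \<bullet> b)\<^sup>2) \<le> (norm v)\<^sup>2" if "B \<in> ?ON" for B
  proof -
    let ?w = "\<Sum>b\<in>B. (v \<bullet> b) *\<^sub>R b"
    have fin: "finite B" using that by simp
    have orth: "b \<bullet> b' = (if b = b' then 1 else 0)" if "b \<in> B" "b' \<in> B" for b b'
      using that \<open>B \<in> ?ON\<close> by (auto simp: pairwise_def orthogonal_def norm_eq_1)
    have vw: "v \<bullet> ?w = (\<Sum>b\<in>B. (v \<bullet> b)\<^sup>2)"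
      by (simp add: inner_sum_right power2_eq_square)
    have "?w \<bullet> ?w = (\<Sum>b\<in>B. \<Sum>b'\<in>B. (v \<bullet> b) * ((v \<bullet> b') * (b \<bullet> b')))"
      by (simp add: inner_sum_left inner_sum_right sum_distrib_left)
         (subst sum.swap, simp add: inner_commute mult.left_commute)
    also have "\<dots> = (\<Sum>b\<in>B. \<Sum>b'\<in>B. if b = b' then (v \<bullet> b)\<^sup>2 else 0)"
      by (intro sum.cong refl) (auto simp: orth power2_eq_square)
    also have "\<dots> = (\<Sum>b\<in>B. (v \<bullet> b)\<^sup>2)" using fin by simp
    finally have "(v - ?w) \<bullet> (v - ?w) = (norm v)\<^sup>2 - (\<Sum>b\<in>B. (v \<bullet> b)\<^sup>2)"
      using vw by (simp add: inner_diff_left inner_diff_right inner_commute power2_norm_eq_inner)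
    then show ?thesis using inner_ge_zero[of "v - ?w"] by linarith
  qed
  have "(SUP B\<in>?ON. \<Sum>b\<in>B. (v \<bullet> b)\<^sup>2) = (norm v)\<^sup>2"
  proof (rule cSup_eq_maximum)
    show "(norm v)\<^sup>2 \<in> (\<lambda>B. \<Sum>b\<in>B. (v \<bullet> b)\<^sup>2) ` ?ON"
    proof (cases "v = 0")
      case True
      then show ?thesis by (auto intro!: image_eqI[where x = "{}"])
    next
      case False
      then have "v \<bullet> (v /\<^sub>R norm v) = norm v"
        by (simp add: power2_norm_eq_inner[symmetric] power2_eq_square)
      then show ?thesis using False
        by (auto intro!: image_eqI[where x = "{v /\<^sub>R norm v}"] simp: pairwise_def)
    qed
  qed (use le in auto)
  then show ?thesis unfolding tensor_norm_def S by simp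
qed


section \<open>Sobolev spaces, Malliavin derivative, divergence\<close>

text \<open>\<open>\<parallel>F - G\<parallel>\<close> in the norm of \<open>\<bbbD>\<^sup>k\<^sup>,\<^sup>p\<close>, raised to the power \<open>p\<close>, for cylindrical \<open>F\<close>, \<open>G\<close>.\<close>

definition sobolev_dist_pow ::
  "'a measure \<Rightarrow> ('h::real_inner \<Rightarrow> 'a \<Rightarrow> real) \<Rightarrow> nat \<Rightarrow> real \<Rightarrow> 'h cylinder \<Rightarrow> 'h cylinder \<Rightarrow> ennreal"
where
  "sobolev_dist_pow M X k p C C' =
     (\<integral>\<^sup>+\<omega>. ennreal (\<bar>cyl_rv X C \<omega> - cyl_rv X C' \<omega>\<bar> powr p) \<partial>M) +
     (\<Sum>i=1..k. \<integral>\<^sup>+\<omega>. ennreal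
        (tensor_norm i (\<lambda>hs. cyl_deriv X C \<omega> hs - cyl_deriv X C' \<omega> hs) powr p) \<partial>M)"

text \<open>
  The closure \<open>\<bbbD>\<^sup>k\<^sup>,\<^sup>p\<close>, inside \<open>L\<^sup>p\<close> and for \<open>p \<ge> 1\<close>: the \<open>L\<^sup>p\<close>-limits of sequences of smooth
  cylindrical variables which are Cauchy in the Sobolev norm.
\<close>

definition sobolev_space ::
  "'a measure \<Rightarrow> ('h::real_inner \<Rightarrow> 'a \<Rightarrow> real) \<Rightarrow> nat \<Rightarrow> real \<Rightarrow> ('a \<Rightarrow> real) set" where
  "sobolev_space M X k p =
     {F \<in> borel_measurable M. \<exists>C :: nat \<Rightarrow> 'h cylinder.
        (\<forall>n. smooth_cylinder (C n)) \<and>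
        (\<forall>e>0. \<exists>N. \<forall>m\<ge>N. \<forall>n\<ge>N. sobolev_dist_pow M X k p (C m) (C n) < e) \<and>
        (\<lambda>n. \<integral>\<^sup>+\<omega>. ennreal (\<bar>cyl_rv X (C n) \<omega> - F \<omega>\<bar> powr p) \<partial>M) \<longlonglongrightarrow> 0}"

text \<open>
  The closed operator \<open>D : L\<^sup>2(\<Omega>) \<rightarrow> L\<^sup>2(\<Omega>; H)\<close> with domain \<open>\<bbbD>\<^sup>1\<^sup>,\<^sup>2\<close>.  Its values, like those of the
  divergence below, are determined up to almost sure equality, and a version is chosen.
\<close>

definition malliavin_D ::
  "'a measure \<Rightarrow> ('h::{real_inner, complete_space, second_countable_topology} \<Rightarrow> 'a \<Rightarrow> real) \<Rightarrow>
   ('a \<Rightarrow> real) \<Rightarrow> 'a \<Rightarrow> 'h" where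
  "malliavin_D M X F = (SOME Y. Y \<in> borel_measurable M \<and>
     (\<exists>C :: nat \<Rightarrow> 'h cylinder.
        (\<forall>n. smooth_cylinder (C n)) \<and>
        (\<lambda>n. \<integral>\<^sup>+\<omega>. ennreal ((cyl_rv X (C n) \<omega> - F \<omega>)\<^sup>2) \<partial>M) \<longlonglongrightarrow> 0 \<and>
        (\<lambda>n. \<integral>\<^sup>+\<omega>. ennreal ((norm (cyl_grad X (C n) \<omega> - Y \<omega>))\<^sup>2) \<partial>M) \<longlonglongrightarrow> 0))"

definition dom_divergence ::
  "'a measure \<Rightarrow> ('h::{real_inner, complete_space, second_countable_topology} \<Rightarrow> 'a \<Rightarrow> real) \<Rightarrow>
   ('a \<Rightarrow> 'h) set" where
  "dom_divergence M X =
     {u \<in> borel_measurable M. integrable M (\<lambda>\<omega>. (norm (u \<omega>))\<^sup>2) \<and>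
        (\<exists>c. \<forall>G\<in>sobolev_space M X 1 2.
           \<bar>\<integral>\<omega>. malliavin_D M X G \<omega> \<bullet> u \<omega> \<partial>M\<bar> \<le> c * sqrt (\<integral>\<omega>. (G \<omega>)\<^sup>2 \<partial>M))}"

definition divergence ::
  "'a measure \<Rightarrow> ('h::{real_inner, complete_space, second_countable_topology} \<Rightarrow> 'a \<Rightarrow> real) \<Rightarrow>
   ('a \<Rightarrow> 'h) \<Rightarrow> 'a \<Rightarrow> real" where
  "divergence M X u = (SOME V. V \<in> borel_measurable M \<and> integrable M (\<lambda>\<omega>. (V \<omega>)\<^sup>2) \<and>
     (\<forall>G\<in>sobolev_space M X 1 2.
        (\<integral>\<omega>. G \<omega> * V \<omega> \<partial>M) = (\<integral>\<omega>. malliavin_D M X G \<omega> \<bullet> u \<omega> \<partial>M)))"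

text \<open>\<open>D\<^sub>u F\<close>; the iterate \<open>D\<^sub>u\<^sup>i F\<close> is \<open>(directional_D M X u ^^ i) F\<close>.\<close>

definition directional_D ::
  "'a measure \<Rightarrow> ('h::{real_inner, complete_space, second_countable_topology} \<Rightarrow> 'a \<Rightarrow> real) \<Rightarrow>
   ('a \<Rightarrow> 'h) \<Rightarrow> ('a \<Rightarrow> real) \<Rightarrow> 'a \<Rightarrow> real" where
  "directional_D M X u F = (\<lambda>\<omega>. u \<omega> \<bullet> malliavin_D M X F \<omega>)"


section \<open>Total variation distance\<close>

definition tv_dist :: "'a measure \<Rightarrow> ('a \<Rightarrow> real) \<Rightarrow> 'b measure \<Rightarrow> ('b \<Rightarrow> real) \<Rightarrow> real" where
  "tv_dist M F N Z =
     (SUP B\<in>sets borel. \<bar>measure M (F -` B \<inter> space M) - measure N (Z -` B \<inter> space N)\<bar>)"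

end

theory Submission
  imports Defs
begin

text \<open>
Write \<open>T = D\<^sub>u F\<close>, \<open>S = D\<^sub>u T\<close> and \<open>R = D\<^sub>u S\<close>. For a \<open>C\<^sup>1\<close> function \<open>f\<close>, bounded with its derivative,
and \<open>G\<close> in \<open>\<bbbD>\<^sup>1\<^sup>,\<^sup>2\<close>, duality with \<open>F = \<delta>(u)\<close> and the chain rule give

  \<open>E(f(F) G F) = E(f'(F) G T) + E(f(F) D\<^sub>u G)\<close>

(\<open>duality_C1\<close>). It is used together with Stein's equation \<open>f'(x) - x f(x) = q(x) - E q(Z)\<close>, whose
solution satisfies \<open>\<bar>f\<bar> \<le> sqrt (\<pi>/2) \<beta>\<close> and \<open>\<bar>f'\<bar> \<le> 2 \<beta>\<close> if \<open>\<bar>q - E q(Z)\<bar> \<le> \<beta>\<close> (\<open>stein_solution\<close>).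

Solve it for a continuous \<open>h\<close> with values in \<open>[0, 1]\<close>, then with \<open>f'\<close> on the right, giving \<open>g\<close>,
then with \<open>g\<close> on the right, giving \<open>k\<close>. Since \<open>E T = E F\<^sup>2 = 1\<close>, constants drop out against \<open>1 - T\<close>, and

  \<open>E h(F) - E h(Z) = E f'(F)(1 - T) = E (g'(F) - F g(F))(1 - T) = E g'(F)(1 - T)\<^sup>2 + E g(F) S\<close>,

  \<open>E g(F) S = E g(Z) E S + E (k'(F) - F k(F)) S = E g(Z) E S + E k'(F) S (1 - T) - E k(F) R\<close>.

Here \<open>E S = E F T = E F\<^sup>3 / 2\<close>, and \<open>E (1 - T)\<^sup>2 = Var T \<le> E \<parallel>D T\<parallel>\<^sup>2\<close> by the Poincare inequality. The bounds
on \<open>g'\<close>, \<open>E g(Z)\<close>, \<open>k'\<close> and \<open>k\<close> give exactly the four constants (\<open>second_order_stein_bound\<close>). Borel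
sets are reached from continuous functions by regularity of the two laws.

The probabilistic input is Gaussian integration by parts and the Poincare inequality for smooth
cylindrical variables. For trigonometric polynomials both follow from the characteristic function:
the Poincare inequality becomes the statement that a power series with nonnegative coefficients
maps Gram matrices to positive semidefinite matrices (\<open>poincare_trig\<close>). Bernstein operators,
applied in one coordinate at a time and evaluated at a sine, show that trigonometric polynomials
are dense in the \<open>C\<^sup>1\<close> sense (\<open>Cb_infinity_imp_wave_closure\<close>), which transfers both to all cylinders.
Integration by parts makes the derivative closable (\<open>malliavin_closable_zero\<close>), so that \<open>D\<close> is well
defined, and the divergence exists by the Riesz representation theorem (\<open>divergence_exists\<close>).
\<close>

section \<open>Closure properties of smooth cylindrical functions\<close>

text \<open>
A relational form of \<open>partial\<close>: the rules below carry existence and value of a derivative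
together, while \<open>deriv\<close> has a value even where no derivative exists.
\<close>

definition has_partial :: "nat \<Rightarrow> ((nat \<Rightarrow> real) \<Rightarrow> real) \<Rightarrow> ((nat \<Rightarrow> real) \<Rightarrow> real) \<Rightarrow> bool" where
  "has_partial i f f' \<longleftrightarrow> (\<forall>x. ((\<lambda>t. f (x(i := t))) has_real_derivative f' x) (at (x i)))"

lemma has_partial_imp_partial: "has_partial i f f' \<Longrightarrow> partial i f = f'"
  by (auto simp: has_partial_def partial_def fun_eq_iff intro: DERIV_imp_deriv)

lemma has_partialD:
  assumes "has_partial i f f'"
  shows "((\<lambda>t. f (x(i := t))) has_real_derivative f' (x(i := s))) (at s)"
  using assms[unfolded has_partial_def, rule_format, of "x(i := s)"] by simp

lemma has_partial_const: "has_partial i (\<lambda>_. c) (\<lambda>_. 0)"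
  by (simp add: has_partial_def)

lemma has_partial_add:
  assumes "has_partial i f f'" "has_partial i g g'"
  shows "has_partial i (\<lambda>x. f x + g x) (\<lambda>x. f' x + g' x)"
  using assms unfolding has_partial_def by (auto intro!: DERIV_add)

lemma has_partial_mult:
  assumes "has_partial i f f'" "has_partial i g g'"
  shows "has_partial i (\<lambda>x. f x * g x) (\<lambda>x. f' x * g x + g' x * f x)"
  unfolding has_partial_def
proof
  fix x
  show "((\<lambda>t. f (x(i := t)) * g (x(i := t))) has_real_derivative f' x * g x + g' x * f x) (at (x i))"
    using DERIV_mult[OF assms(1)[unfolded has_partial_def, rule_format, of x]
        assms(2)[unfolded has_partial_def, rule_format, of x]] by simp
qed

lemma has_partial_chain:
  assumes "has_partial i f f'" "\<And>y. (a has_real_derivative a' y) (at y)"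
  shows "has_partial i (\<lambda>x. a (f x)) (\<lambda>x. a' (f x) * f' x)"
  unfolding has_partial_def
proof
  fix x
  show "((\<lambda>t. a (f (x(i := t)))) has_real_derivative a' (f x) * f' x) (at (x i))"
    using DERIV_chain2[OF assms(2) assms(1)[unfolded has_partial_def, rule_format, of x]] by simp
qed

lemma has_partial_cos:
  assumes "has_partial i f f'"
  shows "has_partial i (\<lambda>x. cos (c * f x)) (\<lambda>x. ((- c) * sin (c * f x)) * f' x)"
  by (rule has_partial_chain[OF assms]) (auto intro!: derivative_eq_intros)

lemma has_partial_sin:
  assumes "has_partial i f f'"
  shows "has_partial i (\<lambda>x. sin (c * f x)) (\<lambda>x. (c * cos (c * f x)) * f' x)"
  by (rule has_partial_chain[OF assms]) (auto intro!: derivative_eq_intros)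

lemma has_partial_linear:
  assumes "i < n"
  shows "has_partial i (\<lambda>x. (\<Sum>j<n. t j * x j) + b) (\<lambda>_. t i)"
proof -
  have "((\<lambda>s. (\<Sum>j<n. t j * (x(i := s)) j) + b) has_real_derivative t i) (at (x i))" for x
  proof -
    have "((\<lambda>s. (\<Sum>j<n. t j * (x(i := s)) j) + b) has_real_derivative
        (\<Sum>j<n. if j = i then t i else 0)) (at (x i))"
      by (intro DERIV_add[where E = 0, simplified] DERIV_sum DERIV_const) (auto intro!: derivative_eq_intros)
    then show ?thesis using assms by simp
  qed
  then show ?thesis by (simp add: has_partial_def)
qed

lemma has_partial_shift:
  assumes "has_partial i f f'"
  shows "has_partial (i + k) (\<lambda>x. f (\<lambda>j. x (j + k))) (\<lambda>x. f' (\<lambda>j. x (j + k)))"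
proof -
  have *: "(\<lambda>j. (x(i + k := t)) (j + k)) = (\<lambda>j. x (j + k))(i := t)" for x :: "nat \<Rightarrow> real" and t
    by auto
  show ?thesis
    using assms unfolding has_partial_def * by auto
qed

lemma has_partial_upd:
  assumes "has_partial j f f'" "j \<noteq> i"
  shows "has_partial j (\<lambda>x. f (x(i := a (x i)))) (\<lambda>x. f' (x(i := a (x i))))"
proof -
  have *: "(x(j := t))(i := a ((x(j := t)) i)) = (x(i := a (x i)))(j := t)"
    for x :: "nat \<Rightarrow> real" and t using assms(2) by (simp add: fun_upd_twist)
  show ?thesis unfolding has_partial_def *
    using assms(1)[unfolded has_partial_def] assms(2) by (metis fun_upd_other)
qed

lemma has_partial_upd_same:
  assumes "has_partial i f f'" "\<And>s. (a has_real_derivative a' s) (at s)"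
  shows "has_partial i (\<lambda>x. f (x(i := a (x i)))) (\<lambda>x. f' (x(i := a (x i))) * a' (x i))"
  unfolding has_partial_def
proof
  fix x
  have "((\<lambda>s. f (x(i := a s))) has_real_derivative f' (x(i := a (x i))) * a' (x i)) (at (x i))"
    by (rule DERIV_chain2[OF has_partialD[OF assms(1)] assms(2)])
  then show "((\<lambda>t. f ((x(i := t))(i := a ((x(i := t)) i)))) has_real_derivative
     f' (x(i := a (x i))) * a' (x i)) (at (x i))" by simp
qed

lemma has_partial_independent:
  assumes "\<And>x t. f (x(i := t)) = f x"
  shows "has_partial i f (\<lambda>_. 0)"
  by (simp add: has_partial_def assms)

lemma Cb_infinity_depends: "Cb_infinity n f \<Longrightarrow> (\<And>i. i < n \<Longrightarrow> x i = y i) \<Longrightarrow> f x = f y"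
  by (simp add: Cb_infinity_def)

lemma Cb_infinity_continuous: "Cb_infinity n f \<Longrightarrow> continuous_on UNIV f"
  unfolding Cb_infinity_def Let_def by (metis empty_subsetI foldr_Nil id_apply list.set(1))

lemma Cb_infinity_bounded: "Cb_infinity n f \<Longrightarrow> \<exists>B. \<forall>x. \<bar>f x\<bar> \<le> B"
proof -
  assume "Cb_infinity n f"
  then have "bounded (range f)"
    unfolding Cb_infinity_def Let_def by (metis empty_subsetI foldr_Nil id_apply list.set(1))
  then show ?thesis by (auto simp: bounded_iff)
qed

lemma Cb_infinity_has_partial:
  assumes "Cb_infinity n f" "i < n" shows "has_partial i f (partial i f)"
proof -
  have "(\<lambda>t. f (x(i := t))) differentiable (at (x i))" for x
    using assms unfolding Cb_infinity_def Let_def by (metis empty_subsetI foldr_Nil id_apply list.set(1))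
  then show ?thesis
    by (auto simp: has_partial_def partial_def DERIV_deriv_iff_real_differentiable)
qed

lemma partial_depends:
  assumes "\<And>x y. (\<forall>i<n. x i = y i) \<Longrightarrow> f x = f y" "i < n" "\<forall>i<n. x i = y i"
  shows "partial i f x = partial i f y"
proof -
  have "f (x(i := t)) = f (y(i := t))" for t
    by (rule assms(1)) (use assms(3) in auto)
  then show ?thesis using assms(2,3) by (simp add: partial_def)
qed

lemma Cb_infinity_partial:
  assumes "Cb_infinity n f" "i < n" shows "Cb_infinity n (partial i f)"
proof -
  have d: "\<And>x y. \<forall>i<n. x i = y i \<Longrightarrow> f x = f y"
    and s: "set is \<subseteq> {..<n} \<Longrightarrow> continuous_on UNIV (foldr partial is f) \<and>
       bounded (range (foldr partial is f)) \<and>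
       (\<forall>i<n. \<forall>x. (\<lambda>t. foldr partial is f (x(i := t))) differentiable (at (x i)))" for "is"
    using assms(1) unfolding Cb_infinity_def Let_def by auto
  have "set (is @ [i]) \<subseteq> {..<n}" if "set is \<subseteq> {..<n}" for "is"
    using that assms(2) by auto
  from s[OF this] show ?thesis
    unfolding Cb_infinity_def Let_def using partial_depends[OF d assms(2)] by simp
qed

text \<open>
An induction on the number of derivatives would have to treat all constructions at once, since
differentiating a product gives sums of products. Instead, the algebra generated by these
constructions is seen to be closed under partial derivatives; as its members are bounded and
continuous, it lies in \<open>Cb_infinity\<close>. The rule \<open>shift\<close> serves to put two cylinders over one family of
vectors, while \<open>freeze\<close> and \<open>fold\<close> are the two ways in which the density argument acts on a coordinate.
\<close>

inductive cyl_algebra :: "nat \<Rightarrow> ((nat \<Rightarrow> real) \<Rightarrow> real) \<Rightarrow> bool" for n where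
  shift: "Cb_infinity m f \<Longrightarrow> k + m \<le> n \<Longrightarrow> cyl_algebra n (\<lambda>x. f (\<lambda>i. x (i + k)))"
| const: "cyl_algebra n (\<lambda>_. c)"
| add: "cyl_algebra n f \<Longrightarrow> cyl_algebra n g \<Longrightarrow> cyl_algebra n (\<lambda>x. f x + g x)"
| mult: "cyl_algebra n f \<Longrightarrow> cyl_algebra n g \<Longrightarrow> cyl_algebra n (\<lambda>x. f x * g x)"
| sin: "cyl_algebra n f \<Longrightarrow> cyl_algebra n (\<lambda>x. sin (c * f x))"
| cos: "cyl_algebra n f \<Longrightarrow> cyl_algebra n (\<lambda>x. cos (c * f x))"
| plane_wave: "cyl_algebra n (\<lambda>x. cos ((\<Sum>j<n. t j * x j) + b))"
| freeze: "cyl_algebra n f \<Longrightarrow> cyl_algebra n (\<lambda>x. f (x(i := c)))"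
| fold: "cyl_algebra n f \<Longrightarrow> K > 0 \<Longrightarrow> i < n \<Longrightarrow> cyl_algebra n (\<lambda>x. f (x(i := K * sin (x i / K))))"

lemma cyl_algebra_depends:
  assumes "cyl_algebra n f" "\<And>i. i < n \<Longrightarrow> x i = y i"
  shows "f x = f y"
  using assms
proof (induction arbitrary: x y)
  case (shift m f k)
  show ?case by (rule Cb_infinity_depends[OF shift(1)]) (use shift in auto)
next
  case (add f g) then show ?case by metis
next
  case (mult f g) then show ?case by metis
next
  case (sin f c) then show ?case by metis
next
  case (cos f c) then show ?case by metis
next
  case (plane_wave t b)
  then have "(\<Sum>j<n. t j * x j) = (\<Sum>j<n. t j * y j)" by (intro sum.cong) auto
  then show ?case by simp
next
  case (freeze f i c)
  show ?case by (rule freeze.IH) (use freeze.prems in auto)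
next
  case (fold f K i)
  show ?case by (rule fold.IH) (use fold.prems fold.hyps in auto)
qed simp

lemma continuous_on_fun_upd:
  assumes "continuous_on UNIV f" "continuous_on UNIV (a :: real \<Rightarrow> real)"
  shows "continuous_on UNIV (\<lambda>x :: nat \<Rightarrow> real. (f (x(i := a (x i))) :: real))"
proof -
  have "continuous_on UNIV (\<lambda>x :: nat \<Rightarrow> real. x(i := a (x i)))"
  proof (rule continuous_on_coordinatewise_then_product)
    fix j
    have "continuous_on UNIV (\<lambda>x :: nat \<Rightarrow> real. a (x i))"
      by (rule continuous_on_compose2[OF assms(2)]) auto
    then show "continuous_on UNIV (\<lambda>x. (x(i := a (x i))) j)"
      by (cases "j = i") auto
  qed
  then show ?thesis by (rule continuous_on_compose2[OF assms(1)]) auto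
qed

lemma cyl_algebra_continuous: "cyl_algebra n f \<Longrightarrow> continuous_on UNIV f"
proof (induction rule: cyl_algebra.induct)
  case (shift m f k)
  have "continuous_on UNIV (\<lambda>x i. x (i + k) :: real)"
    by (rule continuous_on_coordinatewise_then_product) auto
  then show ?case
    by (rule continuous_on_compose2[OF Cb_infinity_continuous[OF shift(1)]]) auto
next
  case (freeze f i c)
  show ?case by (rule continuous_on_fun_upd[OF freeze.IH]) simp
next
  case (fold f K i)
  show ?case by (rule continuous_on_fun_upd[OF fold.IH]) (auto intro!: continuous_on_mult continuous_on_sin continuous_on_divide continuous_on_const continuous_on_id
        simp: less_imp_neq[OF fold.hyps(2)] fold.hyps(2)[THEN less_imp_neq, symmetric])
qed (auto intro!: continuous_intros)

lemma cyl_algebra_bounded: "cyl_algebra n f \<Longrightarrow> \<exists>B. \<forall>x. \<bar>f x\<bar> \<le> B"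
proof (induction rule: cyl_algebra.induct)
  case (shift m f k)
  then show ?case using Cb_infinity_bounded by blast
next
  case (add f g)
  then obtain A B where "\<And>x. \<bar>f x\<bar> \<le> A" "\<And>x. \<bar>g x\<bar> \<le> B" by blast
  then have "\<bar>f x + g x\<bar> \<le> A + B" for x
    by (intro order_trans[OF abs_triangle_ineq] add_mono)
  then show ?case by blast
next
  case (mult f g)
  then obtain A B where "\<And>x. \<bar>f x\<bar> \<le> A" "\<And>x. \<bar>g x\<bar> \<le> B" by blast
  then have "\<bar>f x * g x\<bar> \<le> A * B" for x
    unfolding abs_mult by (intro mult_mono) (auto intro: order_trans[OF abs_ge_zero])
  then show ?case by blast
qed (auto intro: exI[of _ 1])

text \<open>
Each generator differentiates into the algebra; a plane wave does so because its derivative is a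
multiple of the wave with the phase advanced by \<open>\<pi>/2\<close>.
\<close>

lemma cyl_algebra_partial:
  "cyl_algebra n f \<Longrightarrow> i < n \<Longrightarrow> \<exists>f'. cyl_algebra n f' \<and> has_partial i f f'"
proof (induction rule: cyl_algebra.induct)
  case (shift m f k)
  show ?case
  proof (cases "k \<le> i \<and> i < k + m")
    case True
    then have "i - k < m" "i = i - k + k" by auto
    then show ?thesis
      using cyl_algebra.shift[OF Cb_infinity_partial[OF shift(1) \<open>i - k < m\<close>] shift(2)]
        has_partial_shift[OF Cb_infinity_has_partial[OF shift(1) \<open>i - k < m\<close>], of k] by auto
  next
    case False
    have "f (\<lambda>j. (x(i := t)) (j + k)) = f (\<lambda>j. x (j + k))" for x t
      by (rule Cb_infinity_depends[OF shift(1)]) (use False in auto)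
    then show ?thesis
      using has_partial_independent[of "\<lambda>x. f (\<lambda>i. x (i + k))"] cyl_algebra.const by blast
  qed
next
  case (const c)
  then show ?case using has_partial_const cyl_algebra.const by blast
next
  case (add f g)
  then show ?case using has_partial_add cyl_algebra.add by blast
next
  case (mult f g)
  then obtain f' g' where *: "cyl_algebra n f'" "has_partial i f f'" "cyl_algebra n g'" "has_partial i g g'"
    by blast
  then show ?case
    using has_partial_mult[OF *(2,4)]
      cyl_algebra.add[OF cyl_algebra.mult[OF *(1) mult.hyps(2)] cyl_algebra.mult[OF *(3) mult.hyps(1)]]
    by blast
next
  case (sin f c)
  then obtain f' where *: "cyl_algebra n f'" "has_partial i f f'" by blast
  then show ?case
    using has_partial_sin[OF *(2), of c] cyl_algebra.mult[OF cyl_algebra.mult[OF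
        cyl_algebra.const[of n c] cyl_algebra.cos[OF sin.hyps, of c]] *(1)]
    by blast
next
  case (cos f c)
  then obtain f' where *: "cyl_algebra n f'" "has_partial i f f'" by blast
  then show ?case
    using has_partial_cos[OF *(2), of c] cyl_algebra.mult[OF cyl_algebra.mult[OF
        cyl_algebra.const[of n "- c"] cyl_algebra.sin[OF cos.hyps, of c]] *(1)]
    by blast
next
  case (plane_wave t b)
  have "has_partial i (\<lambda>x. cos ((\<Sum>j<n. t j * x j) + b)) (\<lambda>x. - sin ((\<Sum>j<n. t j * x j) + b) * t i)"
    by (rule has_partial_chain[OF has_partial_linear[OF plane_wave]]) (auto intro!: derivative_eq_intros)
  moreover have "(\<lambda>x :: nat \<Rightarrow> real. - sin ((\<Sum>j<n. t j * x j) + b) * t i) =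
      (\<lambda>x. cos ((\<Sum>j<n. t j * x j) + (b + pi / 2)) * t i)"
    by (simp add: fun_eq_iff cos_add sin_add add.assoc[symmetric])
  ultimately show ?case
    using cyl_algebra.mult[OF cyl_algebra.plane_wave[of n t "b + pi / 2"] cyl_algebra.const[of n "t i"]]
    by (intro exI conjI) auto
next
  case (freeze f j c)
  show ?case
  proof (cases "i = j")
    case True
    have "has_partial i (\<lambda>x. f (x(j := c))) (\<lambda>_. 0)"
      by (rule has_partial_independent) (simp add: True)
    then show ?thesis using cyl_algebra.const by blast
  next
    case False
    obtain f' where *: "cyl_algebra n f'" "has_partial i f f'" using freeze by blast
    show ?thesis
      using has_partial_upd[OF *(2) False, of "\<lambda>_. c"] cyl_algebra.freeze[OF *(1), of j c]
      by (intro exI conjI)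
  qed
next
  case (fold f K j)
  obtain f' where *: "cyl_algebra n f'" "has_partial i f f'" using fold by blast
  show ?case
  proof (cases "i = j")
    case True
    have "has_partial i (\<lambda>x. f (x(i := K * sin (x i / K)))) (\<lambda>x. f' (x(i := K * sin (x i / K))) * cos (x i / K))"
      by (rule has_partial_upd_same[OF *(2)]) (use fold in \<open>auto intro!: derivative_eq_intros\<close>)
    moreover have "cyl_algebra n (\<lambda>x. cos (x i / K))"
      using cyl_algebra.plane_wave[of n "\<lambda>j. if j = i then 1 / K else 0" 0] fold.prems
      by (simp add: if_distrib[of "\<lambda>u. u * _"] cong: if_cong)
    ultimately show ?thesis
      using cyl_algebra.mult[OF cyl_algebra.fold[OF *(1) fold.hyps(2,3)]] unfolding True
      by (intro exI conjI)
  next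
    case False
    show ?thesis
      using has_partial_upd[OF *(2) False, of "\<lambda>s. K * sin (s / K)"]
        cyl_algebra.fold[OF *(1) fold.hyps(2,3)] by (intro exI conjI)
  qed
qed

lemma cyl_algebra_iff_Cb_infinity: "cyl_algebra n f \<longleftrightarrow> Cb_infinity n f"
proof
  assume A: "cyl_algebra n f"
  have "cyl_algebra n (foldr partial is f)" if "set is \<subseteq> {..<n}" for "is"
    using that
  proof (induction "is")
    case (Cons i "is")
    then show ?case using cyl_algebra_partial[of n "foldr partial is f" i]
      by (auto simp: has_partial_imp_partial)
  qed (use A in simp)
  moreover have "continuous_on UNIV g \<and> bounded (range g) \<and>
      (\<forall>i<n. \<forall>x. (\<lambda>t. g (x(i := t))) differentiable (at (x i)))" if g: "cyl_algebra n g" for g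
  proof (intro conjI allI impI)
    show "continuous_on UNIV g" by (rule cyl_algebra_continuous[OF g])
    show "bounded (range g)" using cyl_algebra_bounded[OF g] by (auto simp: bounded_iff)
    fix i x assume "i < n"
    then obtain g' where "has_partial i g g'" using cyl_algebra_partial[OF g] by blast
    then show "(\<lambda>t. g (x(i := t))) differentiable (at (x i))"
      by (auto simp: has_partial_def real_differentiable_def)
  qed
  ultimately show "Cb_infinity n f"
    unfolding Cb_infinity_def Let_def by (intro conjI allI impI cyl_algebra_depends[OF A]) simp_all
next
  assume "Cb_infinity n f"
  then show "cyl_algebra n f" using cyl_algebra.shift[of n f 0 n] by simp
qed

lemmas Cb_infinity_shift = cyl_algebra.shift[unfolded cyl_algebra_iff_Cb_infinity]
lemmas Cb_infinity_const = cyl_algebra.const[unfolded cyl_algebra_iff_Cb_infinity]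
lemmas Cb_infinity_add = cyl_algebra.add[unfolded cyl_algebra_iff_Cb_infinity]
lemmas Cb_infinity_mult = cyl_algebra.mult[unfolded cyl_algebra_iff_Cb_infinity]
lemmas Cb_infinity_sin = cyl_algebra.sin[unfolded cyl_algebra_iff_Cb_infinity]
lemmas Cb_infinity_cos = cyl_algebra.cos[unfolded cyl_algebra_iff_Cb_infinity]
lemmas Cb_infinity_plane_wave = cyl_algebra.plane_wave[unfolded cyl_algebra_iff_Cb_infinity]
lemmas Cb_infinity_freeze = cyl_algebra.freeze[unfolded cyl_algebra_iff_Cb_infinity]
lemmas Cb_infinity_fold = cyl_algebra.fold[unfolded cyl_algebra_iff_Cb_infinity]

section \<open>Trigonometric polynomials and operations on cylinders\<close>

text \<open>
These functions are bounded with all their derivatives, so that they act on smooth cylinders by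
composition, and they are rich enough to approximate \<open>C\<^sup>1\<close> functions.
\<close>

inductive trig_fun :: "(real \<Rightarrow> real) \<Rightarrow> bool" where
  const: "trig_fun (\<lambda>_. c)"
| sin: "trig_fun (\<lambda>x. sin (c * x))"
| cos: "trig_fun (\<lambda>x. cos (c * x))"
| add: "trig_fun a \<Longrightarrow> trig_fun b \<Longrightarrow> trig_fun (\<lambda>x. a x + b x)"
| mult: "trig_fun a \<Longrightarrow> trig_fun b \<Longrightarrow> trig_fun (\<lambda>x. a x * b x)"

lemma trig_fun_bounded: "trig_fun a \<Longrightarrow> \<exists>B. \<forall>x. \<bar>a x\<bar> \<le> B"
proof (induction rule: trig_fun.induct)
  case (add f g)
  then obtain A B where "\<And>x. \<bar>f x\<bar> \<le> A" "\<And>x. \<bar>g x\<bar> \<le> B" by blast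
  then have "\<bar>f x + g x\<bar> \<le> A + B" for x
    by (intro order_trans[OF abs_triangle_ineq] add_mono)
  then show ?case by blast
next
  case (mult f g)
  then obtain A B where "\<And>x. \<bar>f x\<bar> \<le> A" "\<And>x. \<bar>g x\<bar> \<le> B" by blast
  then have "\<bar>f x * g x\<bar> \<le> A * B" for x
    unfolding abs_mult by (intro mult_mono) (auto intro: order_trans[OF abs_ge_zero])
  then show ?case by blast
qed (auto intro: exI[of _ 1])

lemma trig_fun_deriv:
  "trig_fun a \<Longrightarrow> \<exists>a'. trig_fun a' \<and> (\<forall>x. (a has_real_derivative a' x) (at x))"
proof (induction rule: trig_fun.induct)
  case (const c)
  then show ?case by (intro exI[of _ "\<lambda>_. 0"] conjI trig_fun.const) auto
next
  case (sin c)
  show ?case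
    by (intro exI[of _ "\<lambda>x. c * cos (c * x)"] conjI trig_fun.intros)
      (auto intro!: derivative_eq_intros)
next
  case (cos c)
  show ?case
    by (intro exI[of _ "\<lambda>x. (- c) * sin (c * x)"] conjI trig_fun.intros)
      (auto intro!: derivative_eq_intros)
next
  case (add a b)
  then obtain a' b' where *: "trig_fun a'" "trig_fun b'"
    "\<forall>x. (a has_real_derivative a' x) (at x)" "\<forall>x. (b has_real_derivative b' x) (at x)" by blast
  show ?case
    by (intro exI[of _ "\<lambda>x. a' x + b' x"] conjI trig_fun.intros *)
      (use * in \<open>auto intro!: DERIV_add\<close>)
next
  case (mult a b)
  then obtain a' b' where *: "trig_fun a'" "trig_fun b'"
    "\<forall>x. (a has_real_derivative a' x) (at x)" "\<forall>x. (b has_real_derivative b' x) (at x)" by blast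
  show ?case
    by (intro exI[of _ "\<lambda>x. a' x * b x + b' x * a x"] conjI trig_fun.intros * mult.hyps)
      (use * in \<open>auto intro!: DERIV_mult\<close>)
qed

lemma trig_fun_power: "trig_fun a \<Longrightarrow> trig_fun (\<lambda>x. a x ^ k)"
proof (induction k)
  case 0 then show ?case using trig_fun.const[of 1] by simp
next
  case (Suc k) then show ?case using trig_fun.mult[of a "\<lambda>x. a x ^ k"] by simp
qed

lemma trig_fun_sum: "(\<And>k. k \<in> I \<Longrightarrow> trig_fun (a k)) \<Longrightarrow> trig_fun (\<lambda>x. \<Sum>k\<in>I. a k x)"
proof (induction I rule: infinite_finite_induct)
  case (insert k I)
  then show ?case using trig_fun.add[of "a k" "\<lambda>x. \<Sum>k\<in>I. a k x"] by simp
qed (auto intro: trig_fun.const)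

lemma trig_fun_Bernstein: "trig_fun (\<lambda>x. Bernstein m k ((1 + sin (c * x)) / 2))"
proof -
  have "trig_fun (\<lambda>x. real (m choose k) * (1 / 2 * (1 + sin (c * x))) ^ k * (1 + (-1) * (1 / 2 * (1 + sin (c * x)))) ^ (m - k))"
    by (intro trig_fun.mult trig_fun_power trig_fun.add trig_fun.const trig_fun.sin)
  moreover have "1 / 2 * w = w / 2" "1 + (-1) * w = 1 - w" for w :: real by simp_all
  ultimately show ?thesis by (simp only: Bernstein_def)
qed

lemma Cb_infinity_trig_fun: "Cb_infinity n f \<Longrightarrow> trig_fun a \<Longrightarrow> Cb_infinity n (\<lambda>x. a (f x))"
  by (rotate_tac 1, induction a rule: trig_fun.induct) (simp_all add: Cb_infinity_const Cb_infinity_add Cb_infinity_mult Cb_infinity_sin Cb_infinity_cos)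

lemma cyl_grad_eq:
  assumes "\<And>i. i < n \<Longrightarrow> has_partial i h (\<lambda>x. \<alpha> x * partial i f x + \<beta> x * partial i g x)"
  shows "cyl_grad X (n, h, \<phi>) \<omega> =
    \<alpha> (\<lambda>j. X (\<phi> j) \<omega>) *\<^sub>R cyl_grad X (n, f, \<phi>) \<omega> + \<beta> (\<lambda>j. X (\<phi> j) \<omega>) *\<^sub>R cyl_grad X (n, g, \<phi>) \<omega>"
proof -
  have "partial i h x = \<alpha> x * partial i f x + \<beta> x * partial i g x" if "i < n" for i x
    using has_partial_imp_partial[OF assms[OF that]] by simp
  then show ?thesis
    by (simp add: cyl_grad_def scaleR_sum_right sum.distrib[symmetric] scaleR_add_left)
qed

text \<open>
The families of vectors are concatenated: \<open>f\<close> ignores the new coordinates and \<open>g\<close> is shifted past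
the old ones. Binary operations on cylinders thereby reduce to operations on functions.
\<close>

lemma common_frame:
  assumes "smooth_cylinder C" "smooth_cylinder C'"
  obtains n \<phi> f g where "Cb_infinity n f" "Cb_infinity n g"
    "cyl_rv X C = cyl_rv X (n, f, \<phi>)" "cyl_rv X C' = cyl_rv X (n, g, \<phi>)"
    "cyl_grad X C = cyl_grad X (n, f, \<phi>)" "cyl_grad X C' = cyl_grad X (n, g, \<phi>)"
proof -
  obtain n f \<phi> where C: "C = (n, f, \<phi>)" by (cases C)
  obtain m g \<psi> where C': "C' = (m, g, \<psi>)" by (cases C')
  have f: "Cb_infinity n f" and g: "Cb_infinity m g"
    using assms by (auto simp: C C' smooth_cylinder_def)
  define \<theta> where "\<theta> i = (if i < n then \<phi> i else \<psi> (i - n))" for i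
  let ?g = "\<lambda>x. g (\<lambda>i. x (i + n))"
  have sh: "(\<lambda>i. X (\<theta> (i + n)) \<omega>) = (\<lambda>i. X (\<psi> i) \<omega>)" for \<omega> by (simp add: \<theta>_def)
  have dep: "h (\<lambda>i. X (\<theta> i) \<omega>) = h (\<lambda>i. X (\<phi> i) \<omega>)" if "Cb_infinity n h" for h \<omega>
    by (rule Cb_infinity_depends[OF that]) (simp add: \<theta>_def)
  have pf: "partial i f = (\<lambda>_. 0)" if "i \<ge> n" for i
    by (rule has_partial_imp_partial, rule has_partial_independent,
        rule Cb_infinity_depends[OF f]) (use that in auto)
  have pg0: "partial i ?g = (\<lambda>_. 0)" if "i < n" for i
    by (rule has_partial_imp_partial, rule has_partial_independent,
        rule Cb_infinity_depends[OF g]) (use that in auto)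
  have pg: "partial (i + n) ?g = (\<lambda>x. partial i g (\<lambda>j. x (j + n)))" if "i < m" for i
    by (rule has_partial_imp_partial, rule has_partial_shift, rule Cb_infinity_has_partial[OF g that])
  have split: "(\<Sum>i<n + m. F i) = (\<Sum>i<n. F i) + (\<Sum>i<m. F (i + n))" for F :: "nat \<Rightarrow> 'a"
    by (induction m) (simp_all add: add_ac)
  show ?thesis
  proof (rule that[of "n + m" f ?g \<theta>])
    show "Cb_infinity (n + m) f" using Cb_infinity_shift[OF f, of 0 "n + m"] by simp
    show "Cb_infinity (n + m) ?g" using Cb_infinity_shift[OF g, of n "n + m"] by simp
    show "cyl_rv X C = cyl_rv X (n + m, f, \<theta>)"
      by (simp add: C cyl_rv_def fun_eq_iff dep[OF f])
    show "cyl_rv X C' = cyl_rv X (n + m, ?g, \<theta>)"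
      by (simp add: C' cyl_rv_def fun_eq_iff sh)
    show "cyl_grad X C = cyl_grad X (n + m, f, \<theta>)"
    proof
      fix \<omega>
      have "(\<Sum>i<n. partial i f (\<lambda>j. X (\<theta> j) \<omega>) *\<^sub>R \<theta> i) = (\<Sum>i<n. partial i f (\<lambda>j. X (\<phi> j) \<omega>) *\<^sub>R \<phi> i)"
        by (intro sum.cong refl) (simp add: dep[OF Cb_infinity_partial[OF f]], simp add: \<theta>_def)
      then show "cyl_grad X C \<omega> = cyl_grad X (n + m, f, \<theta>) \<omega>"
        by (simp add: C cyl_grad_def split pf)
    qed
    show "cyl_grad X C' = cyl_grad X (n + m, ?g, \<theta>)"
    proof
      fix \<omega>
      have "(\<Sum>i<m. partial (i + n) ?g (\<lambda>j. X (\<theta> j) \<omega>) *\<^sub>R \<theta> (i + n)) = (\<Sum>i<m. partial i g (\<lambda>j. X (\<psi> j) \<omega>) *\<^sub>R \<psi> i)"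
        by (intro sum.cong refl) (simp add: pg sh, simp add: \<theta>_def)
      then show "cyl_grad X C' \<omega> = cyl_grad X (n + m, ?g, \<theta>) \<omega>"
        by (simp add: C' cyl_grad_def split pg0)
    qed
  qed
qed

lemma smooth_cylinder_add:
  assumes "smooth_cylinder C" "smooth_cylinder C'"
  obtains C'' where "smooth_cylinder C''" "cyl_rv X C'' = (\<lambda>\<omega>. a * cyl_rv X C \<omega> + b * cyl_rv X C' \<omega>)"
    "cyl_grad X C'' = (\<lambda>\<omega>. a *\<^sub>R cyl_grad X C \<omega> + b *\<^sub>R cyl_grad X C' \<omega>)"
proof -
  obtain n \<phi> f g where *: "Cb_infinity n f" "Cb_infinity n g"
    "cyl_rv X C = cyl_rv X (n, f, \<phi>)" "cyl_rv X C' = cyl_rv X (n, g, \<phi>)"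
    "cyl_grad X C = cyl_grad X (n, f, \<phi>)" "cyl_grad X C' = cyl_grad X (n, g, \<phi>)"
    by (rule common_frame[OF assms, where X = X]) (rule that)
  let ?h = "\<lambda>x. a * f x + b * g x"
  have h: "Cb_infinity n ?h" by (intro Cb_infinity_const Cb_infinity_add Cb_infinity_mult *)
  have "has_partial i ?h (\<lambda>x. a * partial i f x + b * partial i g x)" if "i < n" for i
    using has_partial_add[OF has_partial_mult[OF has_partial_const[of i a] Cb_infinity_has_partial[OF *(1) that]]
        has_partial_mult[OF has_partial_const[of i b] Cb_infinity_has_partial[OF *(2) that]]]
    by (simp add: mult.commute)
  then have "cyl_grad X (n, ?h, \<phi>) \<omega> = a *\<^sub>R cyl_grad X (n, f, \<phi>) \<omega> + b *\<^sub>R cyl_grad X (n, g, \<phi>) \<omega>" for \<omega>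
    by (rule cyl_grad_eq)
  then show ?thesis
    by (intro that[of "(n, ?h, \<phi>)"]) (simp_all add: * smooth_cylinder_def h fun_eq_iff, simp_all add: cyl_rv_def)
qed

lemma smooth_cylinder_mult:
  assumes "smooth_cylinder C" "smooth_cylinder C'"
  obtains C'' where "smooth_cylinder C''" "cyl_rv X C'' = (\<lambda>\<omega>. cyl_rv X C \<omega> * cyl_rv X C' \<omega>)"
    "cyl_grad X C'' = (\<lambda>\<omega>. cyl_rv X C' \<omega> *\<^sub>R cyl_grad X C \<omega> + cyl_rv X C \<omega> *\<^sub>R cyl_grad X C' \<omega>)"
proof -
  obtain n \<phi> f g where *: "Cb_infinity n f" "Cb_infinity n g"
    "cyl_rv X C = cyl_rv X (n, f, \<phi>)" "cyl_rv X C' = cyl_rv X (n, g, \<phi>)"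
    "cyl_grad X C = cyl_grad X (n, f, \<phi>)" "cyl_grad X C' = cyl_grad X (n, g, \<phi>)"
    by (rule common_frame[OF assms, where X = X]) (rule that)
  let ?h = "\<lambda>x. f x * g x"
  have h: "Cb_infinity n ?h" by (rule Cb_infinity_mult[OF *(1,2)])
  have "has_partial i ?h (\<lambda>x. g x * partial i f x + f x * partial i g x)" if "i < n" for i
    using has_partial_mult[OF Cb_infinity_has_partial[OF *(1) that] Cb_infinity_has_partial[OF *(2) that]]
    by (simp add: mult.commute)
  then have "cyl_grad X (n, ?h, \<phi>) \<omega> =
      g (\<lambda>j. X (\<phi> j) \<omega>) *\<^sub>R cyl_grad X (n, f, \<phi>) \<omega> + f (\<lambda>j. X (\<phi> j) \<omega>) *\<^sub>R cyl_grad X (n, g, \<phi>) \<omega>" for \<omega>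
    by (rule cyl_grad_eq)
  then show ?thesis
    by (intro that[of "(n, ?h, \<phi>)"]; simp only: *(3-6)) (simp_all add: smooth_cylinder_def h fun_eq_iff cyl_rv_def)
qed

lemma smooth_cylinder_trig_product:
  assumes "smooth_cylinder C" "smooth_cylinder C'" "trig_fun a" "trig_fun b"
    "\<And>x. (a has_real_derivative a' x) (at x)" "\<And>x. (b has_real_derivative b' x) (at x)"
  obtains C'' where "smooth_cylinder C''" "cyl_rv X C'' = (\<lambda>\<omega>. a (cyl_rv X C \<omega>) * b (cyl_rv X C' \<omega>))"
    "cyl_grad X C'' = (\<lambda>\<omega>. (a' (cyl_rv X C \<omega>) * b (cyl_rv X C' \<omega>)) *\<^sub>R cyl_grad X C \<omega>
       + (a (cyl_rv X C \<omega>) * b' (cyl_rv X C' \<omega>)) *\<^sub>R cyl_grad X C' \<omega>)"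
proof -
  obtain n \<phi> f g where *: "Cb_infinity n f" "Cb_infinity n g"
    "cyl_rv X C = cyl_rv X (n, f, \<phi>)" "cyl_rv X C' = cyl_rv X (n, g, \<phi>)"
    "cyl_grad X C = cyl_grad X (n, f, \<phi>)" "cyl_grad X C' = cyl_grad X (n, g, \<phi>)"
    by (rule common_frame[OF assms(1,2), where X = X]) (rule that)
  let ?h = "\<lambda>x. a (f x) * b (g x)"
  have h: "Cb_infinity n ?h" 
    by (rule Cb_infinity_mult[OF Cb_infinity_trig_fun[OF *(1) assms(3)] Cb_infinity_trig_fun[OF *(2) assms(4)]])
  have "has_partial i ?h (\<lambda>x. (a' (f x) * b (g x)) * partial i f x + (a (f x) * b' (g x)) * partial i g x)"
    if "i < n" for i
    using has_partial_mult[OF has_partial_chain[OF Cb_infinity_has_partial[OF *(1) that] assms(5)]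
        has_partial_chain[OF Cb_infinity_has_partial[OF *(2) that] assms(6)]]
    by (simp add: mult_ac)
  from cyl_grad_eq[OF this, where X = X and \<phi> = \<phi>] show ?thesis
    by (intro that[of "(n, ?h, \<phi>)"]; simp only: *(3-6)) (simp_all add: smooth_cylinder_def h fun_eq_iff cyl_rv_def)
qed

section \<open>Bernstein polynomials evaluated at a sine\<close>

text \<open>
Summation by parts: the derivative of a basis polynomial of degree \<open>N + 1\<close> is \<open>N + 1\<close> times the
difference of two neighbours of degree \<open>N\<close>.
\<close>

lemma Bernstein_sum_has_derivative:
  "((\<lambda>y. \<Sum>k\<le>Suc N. c k * Bernstein (Suc N) k y) has_real_derivative
     (\<Sum>k\<le>N. real (Suc N) * (c (Suc k) - c k) * Bernstein N k y)) (at y)"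
proof -
  have b0: "((\<lambda>y. Bernstein (Suc N) 0 y) has_real_derivative - real (Suc N) * Bernstein N 0 y) (at y)"
  proof -
    have "((\<lambda>y. (1 - y) ^ Suc N) has_real_derivative real (Suc N) * (- 1 * (1 - y) ^ (Suc N - Suc 0))) (at y)"
      by (rule DERIV_power) (auto intro!: derivative_eq_intros)
    then show ?thesis by (simp add: Bernstein_def algebra_simps del: power_Suc)
  qed
  \<comment> \<open>The upper neighbour in degree \<open>N\<close>; at \<open>k = N + 1\<close> there is none and the value is \<open>0\<close>.\<close>
  define B where "B k = (if k \<le> N then Bernstein N k y else 0)" for k
  have bS: "((\<lambda>y. Bernstein (Suc N) (Suc k) y) has_real_derivative
       real (Suc N) * (Bernstein N k y - B (Suc k))) (at y)" if "k \<le> N" for k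
  proof -
    have 1: "real (Suc N choose Suc k) * real (Suc k) = real (Suc N) * real (N choose k)"
      by (metis Suc_times_binomial_eq mult.commute of_nat_mult)
    have 2: "real (Suc N choose Suc k) * real (N - k) = real (Suc N) * real (N choose Suc k)"
    proof -
      have "(Suc N choose Suc k) * (N - k) = Suc N * (N choose Suc k)"
        using binomial_absorb_comp[of "Suc N" "Suc k"] by (simp add: mult.commute)
      then show ?thesis by (metis of_nat_mult)
    qed
    have p1: "((\<lambda>y. y ^ Suc k) has_real_derivative real (Suc k) * (1 * y ^ (Suc k - Suc 0))) (at y)"
      by (rule DERIV_power) (rule DERIV_ident)
    have p2: "((\<lambda>y. (1 - y) ^ (N - k)) has_real_derivative real (N - k) * (- 1 * (1 - y) ^ (N - k - Suc 0))) (at y)"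
      by (rule DERIV_power) (auto intro!: derivative_eq_intros)
    have "((\<lambda>y. Bernstein (Suc N) (Suc k) y) has_real_derivative
        real (Suc N choose Suc k) * (real (Suc k) * y ^ k) * (1 - y) ^ (N - k)
        - real (Suc N choose Suc k) * y ^ Suc k * (real (N - k) * (1 - y) ^ (N - k - 1))) (at y)"
      using DERIV_mult[OF DERIV_cmult[OF p1, of "real (Suc N choose Suc k)"] p2]
      by (simp add: Bernstein_def algebra_simps del: binomial_Suc_Suc of_nat_Suc power_Suc)
    also have "real (Suc N choose Suc k) * (real (Suc k) * y ^ k) * (1 - y) ^ (N - k)
        = real (Suc N) * Bernstein N k y"
      unfolding Bernstein_def using 1 by (metis mult.assoc)
    also have "real (Suc N choose Suc k) * y ^ Suc k * (real (N - k) * (1 - y) ^ (N - k - 1))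
        = real (Suc N) * B (Suc k)"
    proof (cases "Suc k \<le> N")
      case True
      have "real (Suc N choose Suc k) * y ^ Suc k * (real (N - k) * (1 - y) ^ (N - k - 1))
        = (real (Suc N choose Suc k) * real (N - k)) * y ^ Suc k * (1 - y) ^ (N - k - 1)" by simp
      also have "\<dots> = real (Suc N) * B (Suc k)"
        unfolding 2 using True by (simp add: B_def Bernstein_def)
      finally show ?thesis .
    next
      case False
      then show ?thesis using that by (simp add: B_def)
    qed
    finally show ?thesis by (simp add: right_diff_distrib)
  qed
  have "((\<lambda>y. c 0 * Bernstein (Suc N) 0 y + (\<Sum>k\<le>N. c (Suc k) * Bernstein (Suc N) (Suc k) y))
      has_real_derivative c 0 * (- real (Suc N) * Bernstein N 0 y) +
        (\<Sum>k\<le>N. c (Suc k) * (real (Suc N) * (Bernstein N k y - B (Suc k))))) (at y)"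
    by (intro DERIV_add DERIV_sum DERIV_cmult b0 bS) auto
  moreover have "(\<Sum>k\<le>Suc N. c k * Bernstein (Suc N) k y) =
      c 0 * Bernstein (Suc N) 0 y + (\<Sum>k\<le>N. c (Suc k) * Bernstein (Suc N) (Suc k) y)" for y
    by (rule sum.atMost_Suc_shift)
  moreover have "c 0 * (- real (Suc N) * Bernstein N 0 y) +
        (\<Sum>k\<le>N. c (Suc k) * (real (Suc N) * (Bernstein N k y - B (Suc k)))) =
      (\<Sum>k\<le>N. real (Suc N) * (c (Suc k) - c k) * Bernstein N k y)"
  proof -
    have "(\<Sum>k\<le>N. c k * Bernstein N k y) = (\<Sum>k\<le>Suc N. c k * B k)"
      by (simp add: B_def)
    also have "\<dots> = c 0 * Bernstein N 0 y + (\<Sum>k\<le>N. c (Suc k) * B (Suc k))"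
      by (subst sum.atMost_Suc_shift) (simp add: B_def)
    finally have eq: "(\<Sum>k\<le>N. c k * Bernstein N k y) =
        c 0 * Bernstein N 0 y + (\<Sum>k\<le>N. c (Suc k) * B (Suc k))" .
    have "c 0 * (- real (Suc N) * Bernstein N 0 y) +
        (\<Sum>k\<le>N. c (Suc k) * (real (Suc N) * (Bernstein N k y - B (Suc k)))) =
        real (Suc N) * ((\<Sum>k\<le>N. c (Suc k) * Bernstein N k y)
          - (c 0 * Bernstein N 0 y + (\<Sum>k\<le>N. c (Suc k) * B (Suc k))))"
      by (simp add: sum_distrib_left sum_subtractf algebra_simps del: of_nat_Suc)
    also have "\<dots> = (\<Sum>k\<le>N. real (Suc N) * (c (Suc k) - c k) * Bernstein N k y)"
      unfolding eq[symmetric]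
      by (simp add: sum_distrib_left sum_subtractf algebra_simps del: of_nat_Suc)
    finally show ?thesis .
  qed
  ultimately show ?thesis by simp
qed

lemma Bernstein_convex_bound:
  assumes "0 \<le> y" "y \<le> 1" "\<And>k. k \<le> N \<Longrightarrow> \<bar>c k\<bar> \<le> B"
  shows "\<bar>\<Sum>k\<le>N. c k * Bernstein N k y\<bar> \<le> B"
proof -
  have "\<bar>\<Sum>k\<le>N. c k * Bernstein N k y\<bar> \<le> (\<Sum>k\<le>N. \<bar>c k * Bernstein N k y\<bar>)" by (rule sum_abs)
  also have "\<dots> \<le> (\<Sum>k\<le>N. B * Bernstein N k y)"
    using assms by (intro sum_mono) (auto simp: abs_mult Bernstein_nonneg intro!: mult_right_mono)
  also have "\<dots> = B" by (simp add: sum_distrib_left[symmetric])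
  finally show ?thesis .
qed

lemma Bernstein_tendsto:
  assumes "continuous_on {0..1} g" "0 \<le> y" "y \<le> (1::real)"
  shows "(\<lambda>N. \<Sum>k\<le>N. g (real k / real N) * Bernstein N k y) \<longlonglongrightarrow> g y"
proof (rule LIMSEQ_I)
  fix e :: real assume "0 < e"
  from Bernstein_Weierstrass[OF assms(1) this] obtain N where
    "\<forall>n x. N \<le> n \<and> x \<in> {0..1} \<longrightarrow> \<bar>g x - (\<Sum>k\<le>n. g (real k / real n) * Bernstein n k x)\<bar> < e" by blast
  then show "\<exists>no. \<forall>n\<ge>no. norm ((\<Sum>k\<le>n. g (real k / real n) * Bernstein n k y) - g y) < e"
    using assms(2,3) by (auto simp: abs_minus_commute intro!: exI[of _ N])
qed

lemma difference_quotient_MVT: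
  assumes "\<And>y. (g has_real_derivative G y) (at y)"
  obtains \<xi> where "real k / real (Suc N) < \<xi>" "\<xi> < real (Suc k) / real (Suc N)"
    "real (Suc N) * (g (real (Suc k) / real (Suc N)) - g (real k / real (Suc N))) = G \<xi>"
proof -
  have lt: "real k / real (Suc N) < real (Suc k) / real (Suc N)"
    by (simp add: divide_strict_right_mono)
  obtain \<xi> where "real k / real (Suc N) < \<xi>" "\<xi> < real (Suc k) / real (Suc N)"
    "g (real (Suc k) / real (Suc N)) - g (real k / real (Suc N)) =
      (real (Suc k) / real (Suc N) - real k / real (Suc N)) * G \<xi>"
    using MVT2[OF lt, of g G] assms by blast
  then show ?thesis by (intro that) (auto simp: field_simps)
qed

text \<open>
By the mean value theorem each difference quotient is a value of \<open>G\<close> between \<open>k/(N + 1)\<close> and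
\<open>(k + 1)/(N + 1)\<close>, an interval that contains \<open>k/N\<close>. So the sum differs from the Bernstein sum of \<open>G\<close>
by at most the modulus of continuity of \<open>G\<close> at \<open>1/(N + 1)\<close>.
\<close>

lemma Bernstein_deriv_tendsto:
  assumes g: "\<And>y. (g has_real_derivative G y) (at y)" and G: "continuous_on UNIV G"
    and y: "0 \<le> y" "y \<le> 1"
  shows "(\<lambda>N. \<Sum>k\<le>N. real (Suc N) * (g (real (Suc k) / real (Suc N)) - g (real k / real (Suc N)))
      * Bernstein N k y) \<longlonglongrightarrow> G y" (is "?D \<longlonglongrightarrow> _")
proof -
  let ?B = "\<lambda>N. \<Sum>k\<le>N. G (real k / real N) * Bernstein N k y"
  have B: "?B \<longlonglongrightarrow> G y"
    by (rule Bernstein_tendsto[OF continuous_on_subset[OF G] y]) simp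
  have uc: "uniformly_continuous_on {0..1} G"
    by (rule compact_uniformly_continuous[OF continuous_on_subset[OF G]]) auto
  have "(\<lambda>N. ?D N - ?B N) \<longlonglongrightarrow> 0"
  proof (rule LIMSEQ_I)
    fix e :: real assume e: "0 < e"
    obtain d where d: "d > 0" "\<And>a b. a \<in> {0..1} \<Longrightarrow> b \<in> {0..1} \<Longrightarrow> dist a b < d \<Longrightarrow> dist (G a) (G b) < e / 2"
      using uc e unfolding uniformly_continuous_on_def by (meson half_gt_zero)
    obtain N0 where N0: "1 / d < real N0" using reals_Archimedean2 by blast
    show "\<exists>no. \<forall>N\<ge>no. norm (?D N - ?B N - 0) < e"
    proof (intro exI[of _ "Suc N0"] allI impI)
      fix N assume N: "Suc N0 \<le> N"
      then have Np: "N > 0" "real N0 < real (Suc N)" by auto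
      have "1 / real (Suc N) < d"
      proof -
        have "1 / d < real (Suc N)" using N0 Np(2) by (rule less_trans)
        then show ?thesis using d(1) by (simp add: pos_divide_less_eq mult.commute del: of_nat_Suc)
      qed
      have "?D N - ?B N = (\<Sum>k\<le>N. (real (Suc N) * (g (real (Suc k) / real (Suc N)) - g (real k / real (Suc N)))
          - G (real k / real N)) * Bernstein N k y)"
        by (simp add: sum_subtractf left_diff_distrib)
      moreover have "\<bar>real (Suc N) * (g (real (Suc k) / real (Suc N)) - g (real k / real (Suc N)))
          - G (real k / real N)\<bar> \<le> e / 2" if k: "k \<le> N" for k
      proof -
        obtain \<xi> where \<xi>: "real k / real (Suc N) < \<xi>" "\<xi> < real (Suc k) / real (Suc N)"
          "real (Suc N) * (g (real (Suc k) / real (Suc N)) - g (real k / real (Suc N))) = G \<xi>"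
          by (rule difference_quotient_MVT[OF g, of k N]) (rule that)
        have 1: "real k / real (Suc N) \<le> real k / real N" "real k / real N \<le> real (Suc k) / real (Suc N)"
          using k Np by (simp_all add: field_simps)
        have 2: "real (Suc k) / real (Suc N) \<le> 1" "0 \<le> real k / real (Suc N)" using k by simp_all
        have 3: "real (Suc k) / real (Suc N) - real k / real (Suc N) = 1 / real (Suc N)"
          by (simp add: field_simps)
        have "dist \<xi> (real k / real N) < d"
          using \<xi> 1 3 \<open>1 / real (Suc N) < d\<close> unfolding dist_real_def by linarith
        then have "dist (G \<xi>) (G (real k / real N)) < e / 2"
        proof (intro d(2))
          show "\<xi> \<in> {0..1}" "real k / real N \<in> {0..1}"
            unfolding atLeastAtMost_iff using \<xi>(1,2) 1 2 by linarith+
        qed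
        then show ?thesis unfolding \<xi>(3) dist_real_def by simp
      qed
      ultimately have "\<bar>?D N - ?B N\<bar> \<le> e / 2"
        using Bernstein_convex_bound[OF y] by presburger
      then show "norm (?D N - ?B N - 0) < e" using e by simp
    qed
  qed
  from tendsto_add[OF this B] show ?thesis by simp
qed

text \<open>
The Bernstein polynomial of \<open>g\<close> on \<open>[-K, K]\<close>, taken at \<open>K sin (x/K)\<close>: a trigonometric polynomial that
depends linearly on finitely many values of \<open>g\<close> and obeys the bounds of \<open>g\<close> on the whole line.
\<close>

definition bernstein_sine :: "real \<Rightarrow> nat \<Rightarrow> (real \<Rightarrow> real) \<Rightarrow> real \<Rightarrow> real" where
  "bernstein_sine K N g x =
     (\<Sum>k\<le>Suc N. g (K * (2 * (real k / real (Suc N)) - 1)) * Bernstein (Suc N) k ((1 + sin (1 / K * x)) / 2))"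

definition bernstein_sine_deriv :: "real \<Rightarrow> nat \<Rightarrow> (real \<Rightarrow> real) \<Rightarrow> real \<Rightarrow> real" where
  "bernstein_sine_deriv K N g x =
     (\<Sum>k\<le>N. real (Suc N) * (g (K * (2 * (real (Suc k) / real (Suc N)) - 1)) - g (K * (2 * (real k / real (Suc N)) - 1)))
        * Bernstein N k ((1 + sin (1 / K * x)) / 2)) * (cos (1 / K * x) / (2 * K))"

lemma half_one_plus_sin: "0 \<le> (1 + sin z) / 2" "(1 + sin z) / 2 \<le> 1" "2 * ((1 + sin z) / 2) - 1 = sin z" for z :: real
  using sin_ge_minus_one[of z] sin_le_one[of z]
  by (auto simp: add_divide_distrib simp del: sin_ge_minus_one sin_le_one)

lemma trig_fun_bernstein_sine: "trig_fun (bernstein_sine K N g)"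
  unfolding bernstein_sine_def[abs_def]
  by (rule trig_fun_sum, rule trig_fun.mult[OF trig_fun.const trig_fun_Bernstein])

lemma bernstein_sine_has_derivative:
  assumes "K > 0"
  shows "(bernstein_sine K N g has_real_derivative bernstein_sine_deriv K N g x) (at x)"
proof -
  have dy: "((\<lambda>t. (1 + sin (1 / K * t)) / 2) has_real_derivative cos (1 / K * x) / (2 * K)) (at x)"
    using assms by (auto intro!: derivative_eq_intros simp: field_simps)
  show ?thesis
    unfolding bernstein_sine_def[abs_def] bernstein_sine_deriv_def
    by (rule DERIV_chain2[OF Bernstein_sum_has_derivative dy])
qed

lemma bernstein_sine_bound:
  assumes "\<And>x. \<bar>g x\<bar> \<le> B" shows "\<bar>bernstein_sine K N g x\<bar> \<le> B"
  unfolding bernstein_sine_def by (intro Bernstein_convex_bound half_one_plus_sin assms)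

lemma bernstein_sine_tendsto:
  assumes "continuous_on UNIV g"
  shows "(\<lambda>N. bernstein_sine K N g x) \<longlonglongrightarrow> g (K * sin (x / K))"
proof -
  have c: "continuous_on {0..1} (\<lambda>s. g (K * (2 * s - 1)))"
    by (rule continuous_on_compose2[OF assms]) (auto intro!: continuous_intros)
  show ?thesis
    using LIMSEQ_Suc[OF Bernstein_tendsto[OF c half_one_plus_sin(1,2)[of "1 / K * x"]]]
    unfolding bernstein_sine_def half_one_plus_sin(3) by simp
qed

lemma bernstein_sine_deriv:
  assumes g: "\<And>x. (g has_real_derivative g' x) (at x)" and K: "K > 0"
  shows bernstein_sine_deriv_bound: "(\<And>x. \<bar>g' x\<bar> \<le> B) \<Longrightarrow> \<bar>bernstein_sine_deriv K N g x\<bar> \<le> B"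
    and bernstein_sine_deriv_tendsto: "continuous_on UNIV g' \<Longrightarrow>
      (\<lambda>N. bernstein_sine_deriv K N g x) \<longlonglongrightarrow> g' (K * sin (x / K)) * cos (x / K)"
proof -
  let ?g = "\<lambda>s. g (K * (2 * s - 1))" and ?G = "\<lambda>s. 2 * K * g' (K * (2 * s - 1))"
  let ?y = "(1 + sin (1 / K * x)) / 2"
  let ?D = "\<lambda>N. \<Sum>k\<le>N. real (Suc N) * (?g (real (Suc k) / real (Suc N)) - ?g (real k / real (Suc N))) * Bernstein N k ?y"
  have dg: "(?g has_real_derivative ?G s) (at s)" for s
  proof -
    have a: "((\<lambda>s. K * (2 * s - 1)) has_real_derivative 2 * K) (at s)"
      by (auto intro!: derivative_eq_intros)
    show ?thesis using DERIV_chain2[OF g a] by (simp add: mult.commute)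
  qed
  show "\<bar>bernstein_sine_deriv K N g x\<bar> \<le> B" if B: "\<And>x. \<bar>g' x\<bar> \<le> B"
  proof -
    have B0: "0 \<le> B" using order_trans[OF abs_ge_zero B] .
    have "\<bar>?D N\<bar> \<le> 2 * K * B"
    proof (rule Bernstein_convex_bound[OF half_one_plus_sin(1,2)])
      fix k assume "k \<le> N"
      obtain \<xi> where "real (Suc N) * (?g (real (Suc k) / real (Suc N)) - ?g (real k / real (Suc N))) = ?G \<xi>"
        by (rule difference_quotient_MVT[OF dg, of k N]) (rule that)
      moreover have "\<bar>?G \<xi>\<bar> \<le> 2 * K * B" using K B by (simp add: abs_mult)
      ultimately show "\<bar>real (Suc N) * (?g (real (Suc k) / real (Suc N)) - ?g (real k / real (Suc N)))\<bar> \<le> 2 * K * B"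
        by (simp only:)
    qed
    then have "\<bar>?D N * (cos (1 / K * x) / (2 * K))\<bar> \<le> (2 * K * B) * (1 / (2 * K))"
      unfolding abs_mult by (rule mult_mono) (use K B0 in \<open>auto simp: abs_divide divide_right_mono\<close>)
    then show ?thesis using K unfolding bernstein_sine_deriv_def by simp
  qed
  show "(\<lambda>N. bernstein_sine_deriv K N g x) \<longlonglongrightarrow> g' (K * sin (x / K)) * cos (x / K)"
    if c: "continuous_on UNIV g'"
  proof -
    have cG: "continuous_on UNIV ?G"
      by (intro continuous_intros continuous_on_compose2[OF c]) auto
    have "?D \<longlonglongrightarrow> ?G ?y" by (rule Bernstein_deriv_tendsto[OF dg cG half_one_plus_sin(1,2)])
    from tendsto_mult_right[OF this, of "cos (1 / K * x) / (2 * K)"] show ?thesis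
      using K unfolding bernstein_sine_deriv_def half_one_plus_sin(3) by simp
  qed
qed

lemma scaled_sin_tendsto: "(\<lambda>m. real (Suc m) * sin (s / real (Suc m))) \<longlonglongrightarrow> s"
proof -
  have "((\<lambda>h. sin (h * s)) has_real_derivative s) (at 0)"
    by (auto intro!: derivative_eq_intros)
  then have "((\<lambda>h. sin (h * s) / h) \<longlongrightarrow> s) (at 0)" by (simp add: DERIV_def)
  moreover have "filterlim (\<lambda>m. 1 / real (Suc m)) (at 0) sequentially"
    using LIMSEQ_Suc[OF lim_1_over_n] by (auto simp: filterlim_at)
  ultimately have "(\<lambda>m. sin (1 / real (Suc m) * s) / (1 / real (Suc m))) \<longlonglongrightarrow> s"
    by (rule filterlim_compose)
  then show ?thesis by (simp add: mult.commute)
qed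

lemma scaled_cos_tendsto: "(\<lambda>m. cos (s / real (Suc m))) \<longlonglongrightarrow> 1"
proof -
  have "(\<lambda>m. s * (1 / real (Suc m))) \<longlonglongrightarrow> s * 0"
    by (intro tendsto_mult tendsto_const LIMSEQ_Suc[OF lim_1_over_n])
  from tendsto_cos[OF this] show ?thesis by simp
qed

lemma trig_fun_scaled_sin:
  fixes K :: real
  shows "trig_fun (\<lambda>x. K * sin (x / K))" "trig_fun (\<lambda>x. cos (x / K))"
  using trig_fun.mult[OF trig_fun.const[of K] trig_fun.sin[of "1 / K"]] trig_fun.cos[of "1 / K"] by simp_all

lemma DERIV_scaled_sin: "(K :: real) \<noteq> 0 \<Longrightarrow> ((\<lambda>x. K * sin (x / K)) has_real_derivative cos (x / K)) (at x)"
  by (auto intro!: derivative_eq_intros)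

lemma abs_scaled_sin_le: "(K :: real) > 0 \<Longrightarrow> \<bar>K * sin (x / K)\<bar> \<le> \<bar>x\<bar>"
  using abs_sin_x_le_abs_x[of "x / K"] by (simp add: abs_mult field_simps)

section \<open>Density of trigonometric polynomials\<close>

text \<open>
Dominated convergence turns this mode of convergence into convergence in \<open>\<bbbD>\<^sup>1\<^sup>,\<^sup>2\<close>, for every choice
of the vectors in the cylinder.
\<close>

definition C1_limit :: "nat \<Rightarrow> (nat \<Rightarrow> (nat \<Rightarrow> real) \<Rightarrow> real) \<Rightarrow> ((nat \<Rightarrow> real) \<Rightarrow> real) \<Rightarrow> bool" where
  "C1_limit n f g \<longleftrightarrow>
     (\<exists>B. \<forall>m x. \<bar>f m x\<bar> \<le> B \<and> (\<forall>i<n. \<bar>partial i (f m) x\<bar> \<le> B)) \<and>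
     (\<forall>x. (\<lambda>m. f m x) \<longlonglongrightarrow> g x) \<and>
     (\<forall>i<n. \<forall>x. (\<lambda>m. partial i (f m) x) \<longlonglongrightarrow> partial i g x)"

text \<open>
Limits may be iterated in this class, so that an approximation in two stages, first in the degree
and then in the truncation level, needs no diagonal sequence.
\<close>

inductive wave_closure :: "nat \<Rightarrow> ((nat \<Rightarrow> real) \<Rightarrow> real) \<Rightarrow> bool" for n where
  wave: "wave_closure n (\<lambda>x. c * cos ((\<Sum>j<n. t j * x j) + b))"
| add: "wave_closure n f \<Longrightarrow> wave_closure n g \<Longrightarrow> wave_closure n (\<lambda>x. f x + g x)"
| limit: "(\<And>m. wave_closure n (f m)) \<Longrightarrow> C1_limit n f g \<Longrightarrow> Cb_infinity n g \<Longrightarrow> wave_closure n g"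

lemma Cb_infinity_wave: "Cb_infinity n (\<lambda>x. c * cos ((\<Sum>j<n. t j * x j) + b))"
  by (rule Cb_infinity_mult[OF Cb_infinity_const Cb_infinity_plane_wave])

lemma wave_closure_Cb_infinity: "wave_closure n f \<Longrightarrow> Cb_infinity n f"
  by (induction rule: wave_closure.induct) (simp_all add: Cb_infinity_wave Cb_infinity_add)

lemma partial_add:
  "Cb_infinity n f \<Longrightarrow> Cb_infinity n g \<Longrightarrow> i < n \<Longrightarrow>
    partial i (\<lambda>x. f x + g x) x = partial i f x + partial i g x"
  by (subst has_partial_imp_partial[OF has_partial_add[OF Cb_infinity_has_partial Cb_infinity_has_partial]]) simp_all

lemma partial_mult:
  "Cb_infinity n f \<Longrightarrow> Cb_infinity n g \<Longrightarrow> i < n \<Longrightarrow>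
    partial i (\<lambda>x. f x * g x) x = partial i f x * g x + partial i g x * f x"
  by (subst has_partial_imp_partial[OF has_partial_mult[OF Cb_infinity_has_partial Cb_infinity_has_partial]]) simp_all

lemma Cb_infinity_bounds:
  assumes "Cb_infinity n f"
  obtains B where "B \<ge> 0" "\<And>x. \<bar>f x\<bar> \<le> B" "\<And>i x. i < n \<Longrightarrow> \<bar>partial i f x\<bar> \<le> B"
proof -
  obtain A where A: "\<And>x. \<bar>f x\<bar> \<le> A" using Cb_infinity_bounded[OF assms] by blast
  have "\<forall>i<n. \<exists>B. \<forall>x. \<bar>partial i f x\<bar> \<le> B"
    using Cb_infinity_bounded[OF Cb_infinity_partial[OF assms]] by blast
  then obtain C where C: "\<And>i x. i < n \<Longrightarrow> \<bar>partial i f x\<bar> \<le> C i" by metis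
  let ?B = "\<bar>A\<bar> + (\<Sum>i<n. \<bar>C i\<bar>)"
  have C_le: "\<bar>C i\<bar> \<le> (\<Sum>i<n. \<bar>C i\<bar>)" if "i < n" for i
    by (rule member_le_sum) (use that in auto)
  have nn: "0 \<le> (\<Sum>i<n. \<bar>C i\<bar>)" by (simp add: sum_nonneg)
  show ?thesis
  proof (rule that[of ?B])
    show "0 \<le> ?B" using nn by simp
    show "\<bar>f x\<bar> \<le> ?B" for x using A[of x] nn by linarith
    show "\<bar>partial i f x\<bar> \<le> ?B" if "i < n" for i x
      using C[OF that, of x] C_le[OF that] by linarith
  qed
qed

lemma C1_limit_mult:
  assumes "C1_limit n f g" "Cb_infinity n h" "\<And>m. Cb_infinity n (f m)" "Cb_infinity n g"
  shows "C1_limit n (\<lambda>m x. f m x * h x) (\<lambda>x. g x * h x)"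
proof -
  obtain B where B: "\<And>m x. \<bar>f m x\<bar> \<le> B" "\<And>m i x. i < n \<Longrightarrow> \<bar>partial i (f m) x\<bar> \<le> B"
    using assms(1) unfolding C1_limit_def by blast
  obtain C where C: "C \<ge> 0" "\<And>x. \<bar>h x\<bar> \<le> C" "\<And>i x. i < n \<Longrightarrow> \<bar>partial i h x\<bar> \<le> C"
    by (rule Cb_infinity_bounds[OF assms(2)]) (rule that)
  have B0: "0 \<le> B" using order_trans[OF abs_ge_zero B(1)] .
  have 1: "\<bar>f m x * h x\<bar> \<le> B * C" for m x
    unfolding abs_mult by (intro mult_mono B C B0) auto
  have 2: "\<bar>partial i (\<lambda>x. f m x * h x) x\<bar> \<le> B * C + C * B" if i: "i < n" for i m x
    unfolding partial_mult[OF assms(3,2) i]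
    by (rule order_trans[OF abs_triangle_ineq])
      (unfold abs_mult, intro add_mono mult_mono B C B0 i abs_ge_zero)
  have "0 \<le> B * C" using B0 C(1) by simp
  then show ?thesis
    unfolding C1_limit_def partial_mult[OF assms(3,2)]
  proof (intro conjI allI impI exI[of _ "B * C + C * B"])
    fix m x show "\<bar>f m x * h x\<bar> \<le> B * C + C * B"
      using 1[of m x] \<open>0 \<le> B * C\<close> by (simp add: mult.commute)
  next
    fix m x i assume "i < n" then show "\<bar>partial i (\<lambda>x. f m x * h x) x\<bar> \<le> B * C + C * B" by (rule 2)
  next
    fix x show "(\<lambda>m. f m x * h x) \<longlonglongrightarrow> g x * h x"
      using assms(1) unfolding C1_limit_def by (intro tendsto_mult tendsto_const) blast
  next
    fix i x assume i: "i < n"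
    have "(\<lambda>m. f m x) \<longlonglongrightarrow> g x" "(\<lambda>m. partial i (f m) x) \<longlonglongrightarrow> partial i g x"
      using assms(1) i unfolding C1_limit_def by blast+
    then show "(\<lambda>m. partial i (\<lambda>x. f m x * h x) x) \<longlonglongrightarrow> partial i (\<lambda>x. g x * h x) x"
      unfolding partial_mult[OF assms(3,2) i] partial_mult[OF assms(4,2) i]
      by (intro tendsto_add tendsto_mult tendsto_const)
  qed
qed

lemma wave_closure_mult_wave:
  "wave_closure n f \<Longrightarrow> wave_closure n (\<lambda>x. f x * (c * cos ((\<Sum>j<n. t j * x j) + b)))"
proof (induction rule: wave_closure.induct)
  case (wave d s a)
  have "wave_closure n (\<lambda>x. c * d / 2 * cos ((\<Sum>j<n. (s j - t j) * x j) + (a - b))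
      + c * d / 2 * cos ((\<Sum>j<n. (s j + t j) * x j) + (a + b)))"
    by (intro wave_closure.add wave_closure.wave)
  moreover have "(c * d / 2 * cos ((\<Sum>j<n. (s j - t j) * x j) + (a - b))
      + c * d / 2 * cos ((\<Sum>j<n. (s j + t j) * x j) + (a + b))) =
      d * cos ((\<Sum>j<n. s j * x j) + a) * (c * cos ((\<Sum>j<n. t j * x j) + b))" for x :: "nat \<Rightarrow> real"
  proof -
    let ?u = "(\<Sum>j<n. s j * x j) + a" and ?v = "(\<Sum>j<n. t j * x j) + b"
    have 1: "(\<Sum>j<n. (s j - t j) * x j) + (a - b) = ?u - ?v"
      "(\<Sum>j<n. (s j + t j) * x j) + (a + b) = ?u + ?v"
      by (simp_all add: left_diff_distrib distrib_right sum_subtractf sum.distrib)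
    have "d * cos ?u * (c * cos ?v) = c * d * (cos ?u * cos ?v)" by simp
    also have "\<dots> = c * d / 2 * cos (?u - ?v) + c * d / 2 * cos (?u + ?v)"
      unfolding cos_times_cos by (simp add: algebra_simps)
    finally show ?thesis unfolding 1 by simp
  qed
  ultimately show ?case by (simp only:)
next
  case (add f g)
  then show ?case by (simp add: distrib_right wave_closure.add)
next
  case (limit f g)
  show ?case
    by (rule wave_closure.limit[OF limit.IH C1_limit_mult[OF limit.hyps(2) Cb_infinity_wave
          wave_closure_Cb_infinity[OF limit.hyps(1)] limit.hyps(3)]])
      (rule Cb_infinity_mult[OF limit.hyps(3) Cb_infinity_wave])
qed

text \<open>
Multiplication by a function of a single coordinate is what a Bernstein sum requires, because its
coefficients are functions of the remaining coordinates.
\<close>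

lemma wave_closure_mult_trig:
  assumes "trig_fun a" "i < n"
  shows "wave_closure n f \<Longrightarrow> wave_closure n (\<lambda>x. f x * a (x i))"
  using assms(1)
proof (induction arbitrary: f)
  case (const c)
  then show ?case using wave_closure_mult_wave[of n f c "\<lambda>_. 0" 0] by simp
next
  case (sin c)
  have "(\<Sum>j<n. (if j = i then c else 0) * x j) = c * x i" for x :: "nat \<Rightarrow> real"
    using assms(2) by (simp add: if_distrib[of "\<lambda>u. u * _"] cong: if_cong)
  then show ?case using wave_closure_mult_wave[OF sin, of 1 "\<lambda>j. if j = i then c else 0" "- (pi / 2)"]
    by (simp add: cos_diff)
next
  case (cos c)
  have "(\<Sum>j<n. (if j = i then c else 0) * x j) = c * x i" for x :: "nat \<Rightarrow> real"
    using assms(2) by (simp add: if_distrib[of "\<lambda>u. u * _"] cong: if_cong)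
  then show ?case using wave_closure_mult_wave[OF cos, of 1 "\<lambda>j. if j = i then c else 0" 0]
    by simp
next
  case (add a b)
  show ?case using wave_closure.add[OF add.IH(1)[OF add.prems] add.IH(2)[OF add.prems]]
    by (simp add: distrib_left)
next
  case (mult a b)
  show ?case using mult.IH(2)[OF mult.IH(1)[OF mult.prems]] by (simp add: mult.assoc)
qed

lemma wave_closure_const: "wave_closure n (\<lambda>_. c)"
  using wave_closure.wave[of n c "\<lambda>_. 0" 0] by simp

lemma wave_closure_sum:
  "(\<And>k. k \<in> I \<Longrightarrow> wave_closure n (f k)) \<Longrightarrow> wave_closure n (\<lambda>x. \<Sum>k\<in>I. f k x)"
proof (induction I rule: infinite_finite_induct)
  case (insert k I)
  then show ?case using wave_closure.add[of n "f k" "\<lambda>x. \<Sum>k\<in>I. f k x"] by simp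
qed (auto intro: wave_closure_const)

lemma Cb_infinity_continuous_coordinate:
  assumes "Cb_infinity n f" shows "continuous_on UNIV (\<lambda>t. f (x(i := t)))"
proof -
  have "continuous_on UNIV (\<lambda>t. x(i := t))"
  proof (rule continuous_on_coordinatewise_then_product)
    fix j show "continuous_on UNIV (\<lambda>t. (x(i := t)) j)" by (cases "j = i") auto
  qed
  then show ?thesis by (rule continuous_on_compose2[OF Cb_infinity_continuous[OF assms]]) auto
qed

definition bernstein_coord ::
  "nat \<Rightarrow> real \<Rightarrow> nat \<Rightarrow> ((nat \<Rightarrow> real) \<Rightarrow> real) \<Rightarrow> (nat \<Rightarrow> real) \<Rightarrow> real" where
  "bernstein_coord i K N f x = bernstein_sine K N (\<lambda>t. f (x(i := t))) (x i)"

text \<open>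
The operator only uses values of \<open>f\<close> on lines in direction \<open>i\<close>. Hence it commutes with the other
partial derivatives, and in direction \<open>i\<close> the claim is the one about a single variable.
\<close>

lemma C1_limit_bernstein:
  assumes f: "Cb_infinity n f" and i: "i < n" and K: "K > 0"
  shows "C1_limit n (\<lambda>N. bernstein_coord i K N f) (\<lambda>x. f (x(i := K * sin (x i / K))))"
proof -
  obtain B where B: "B \<ge> 0" "\<And>x. \<bar>f x\<bar> \<le> B" "\<And>i x. i < n \<Longrightarrow> \<bar>partial i f x\<bar> \<le> B"
    by (rule Cb_infinity_bounds[OF f]) (rule that)
  let ?f = "\<lambda>x. f (x(i := K * sin (x i / K)))"
  have val: "(\<lambda>N. bernstein_coord i K N h x) \<longlonglongrightarrow> h (x(i := K * sin (x i / K)))" if h: "Cb_infinity n h" for h x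
    unfolding bernstein_coord_def
    by (rule bernstein_sine_tendsto[OF Cb_infinity_continuous_coordinate[OF h]])
  have bnd: "\<bar>bernstein_coord i K N h x\<bar> \<le> B" if "\<And>x. \<bar>h x\<bar> \<le> B" for N h x
    unfolding bernstein_coord_def by (rule bernstein_sine_bound[OF that])
  have pj: "partial j (bernstein_coord i K N f) = bernstein_coord i K N (partial j f)"
    if j: "j < n" "j \<noteq> i" for N j
  proof (rule has_partial_imp_partial, unfold has_partial_def, rule allI)
    fix x :: "nat \<Rightarrow> real"
    have "((\<lambda>t. bernstein_sine K N (\<lambda>s. f ((x(j := t))(i := s))) (x i))
      has_real_derivative bernstein_coord i K N (partial j f) x) (at (x j))"
      unfolding bernstein_coord_def bernstein_sine_def
    proof (intro DERIV_sum DERIV_cmult_right)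
      fix k
      show "((\<lambda>t. f ((x(j := t))(i := K * (2 * (real k / real (Suc N)) - 1)))) has_real_derivative
         partial j f (x(i := K * (2 * (real k / real (Suc N)) - 1)))) (at (x j))"
        using has_partial_upd[OF Cb_infinity_has_partial[OF f j(1)] j(2), of "\<lambda>_. K * (2 * (real k / real (Suc N)) - 1)"]
        unfolding has_partial_def by blast
    qed
    moreover have "(x(j := t)) i = x i" for t using j(2) by simp
    ultimately show "((\<lambda>t. bernstein_coord i K N f (x(j := t))) has_real_derivative
        bernstein_coord i K N (partial j f) x) (at (x j))"
      unfolding bernstein_coord_def by (simp only:)
  qed
  have fj: "partial j ?f = (\<lambda>x. partial j f (x(i := K * sin (x i / K))))"
    if j: "j < n" "j \<noteq> i" for j
    by (rule has_partial_imp_partial, rule has_partial_upd[OF Cb_infinity_has_partial[OF f j(1)] j(2)])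
  have pi: "partial i (bernstein_coord i K N f) = (\<lambda>x. bernstein_sine_deriv K N (\<lambda>t. f (x(i := t))) (x i))" for N
    by (rule has_partial_imp_partial, unfold has_partial_def bernstein_coord_def fun_upd_upd fun_upd_same)
      (rule allI, rule bernstein_sine_has_derivative[OF K])
  have fi: "partial i ?f = (\<lambda>x. partial i f (x(i := K * sin (x i / K))) * cos (x i / K))"
    by (rule has_partial_imp_partial, rule has_partial_upd_same[OF Cb_infinity_has_partial[OF f i]])
      (use K in \<open>auto intro!: derivative_eq_intros\<close>)
  have line: "((\<lambda>t. f (x(i := t))) has_real_derivative partial i f (x(i := s))) (at s)" for x s
    by (rule has_partialD[OF Cb_infinity_has_partial[OF f i]])
  show ?thesis
    unfolding C1_limit_def
  proof (intro conjI allI impI exI[of _ B])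
    fix N x show "\<bar>bernstein_coord i K N f x\<bar> \<le> B" by (rule bnd[OF B(2)])
  next
    fix N x j assume j: "j < n"
    show "\<bar>partial j (bernstein_coord i K N f) x\<bar> \<le> B"
    proof (cases "j = i")
      case True
      show ?thesis unfolding True pi by (rule bernstein_sine_deriv_bound[OF line K B(3)[OF i]])
    next
      case False
      show ?thesis unfolding pj[OF j False] by (rule bnd[OF B(3)[OF j]])
    qed
  next
    fix x show "(\<lambda>N. bernstein_coord i K N f x) \<longlonglongrightarrow> ?f x" by (rule val[OF f])
  next
    fix j x assume j: "j < n"
    show "(\<lambda>N. partial j (bernstein_coord i K N f) x) \<longlonglongrightarrow> partial j ?f x"
    proof (cases "j = i")
      case True
      show ?thesis unfolding True pi fi
        by (rule bernstein_sine_deriv_tendsto[OF line K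
              Cb_infinity_continuous_coordinate[OF Cb_infinity_partial[OF f i]]])
    next
      case False
      show ?thesis unfolding pj[OF j False] fj[OF j False] by (rule val[OF Cb_infinity_partial[OF f j]])
    qed
  qed
qed

lemma C1_limit_fold:
  assumes f: "Cb_infinity n f" and i: "i < n"
  shows "C1_limit n (\<lambda>m x. f (x(i := real (Suc m) * sin (x i / real (Suc m))))) f"
proof -
  obtain B where B: "B \<ge> 0" "\<And>x. \<bar>f x\<bar> \<le> B" "\<And>i x. i < n \<Longrightarrow> \<bar>partial i f x\<bar> \<le> B"
    by (rule Cb_infinity_bounds[OF f]) (rule that)
  let ?f = "\<lambda>m x. f (x(i := real (Suc m) * sin (x i / real (Suc m))))"
  have val: "(\<lambda>m. h (x(i := real (Suc m) * sin (x i / real (Suc m))))) \<longlonglongrightarrow> h x" if h: "Cb_infinity n h" for h x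
  proof -
    have "isCont (\<lambda>t. h (x(i := t))) (x i)"
      using Cb_infinity_continuous_coordinate[OF h, of x i] continuous_on_eq_continuous_at[of UNIV] by auto
    from isCont_tendsto_compose[OF this scaled_sin_tendsto[of "x i"]] show ?thesis by simp
  qed
  have fj: "partial j (?f m) = (\<lambda>x. partial j f (x(i := real (Suc m) * sin (x i / real (Suc m)))))"
    if j: "j < n" "j \<noteq> i" for j m
    by (rule has_partial_imp_partial,
        rule has_partial_upd[OF Cb_infinity_has_partial[OF f j(1)] j(2), of "\<lambda>t. real (Suc m) * sin (t / real (Suc m))"])
  have fi: "partial i (?f m) = (\<lambda>x. partial i f (x(i := real (Suc m) * sin (x i / real (Suc m)))) * cos (x i / real (Suc m)))" for m
    by (rule has_partial_imp_partial, rule has_partial_upd_same[OF Cb_infinity_has_partial[OF f i]])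
      (auto intro!: derivative_eq_intros)
  show ?thesis
    unfolding C1_limit_def
  proof (intro conjI allI impI exI[of _ B])
    fix m x show "\<bar>?f m x\<bar> \<le> B" by (rule B)
  next
    fix m x j assume j: "j < n"
    show "\<bar>partial j (?f m) x\<bar> \<le> B"
    proof (cases "j = i")
      case True
      show ?thesis unfolding True fi abs_mult
        using mult_mono[OF B(3)[OF i] abs_cos_le_one B(1) abs_ge_zero] by simp
    next
      case False
      show ?thesis unfolding fj[OF j False] by (rule B(3)[OF j])
    qed
  next
    fix x show "(\<lambda>m. ?f m x) \<longlonglongrightarrow> f x" by (rule val[OF f])
  next
    fix j x assume j: "j < n"
    show "(\<lambda>m. partial j (?f m) x) \<longlonglongrightarrow> partial j f x"
    proof (cases "j = i")
      case True
      show ?thesis unfolding True fi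
        using tendsto_mult[OF val[OF Cb_infinity_partial[OF f i]] scaled_cos_tendsto] by simp
    next
      case False
      show ?thesis unfolding fj[OF j False] by (rule val[OF Cb_infinity_partial[OF f j]])
    qed
  qed
qed

text \<open>
Induction on the set of coordinates on which \<open>f\<close> depends. The Bernstein operator in coordinate \<open>i\<close>
writes an approximation of \<open>f\<close> as a sum of functions without \<open>x i\<close>, each multiplied by a
trigonometric polynomial in \<open>x i\<close>. Its limit in the degree is \<open>f\<close> with \<open>x i\<close> folded to \<open>K sin (x i / K)\<close>,
and \<open>K \<rightarrow> \<infinity>\<close> recovers \<open>f\<close>.
\<close>

lemma Cb_infinity_imp_wave_closure:
  assumes "Cb_infinity n f" shows "wave_closure n f"
proof -
  have ind: "wave_closure n f" if "finite J" "J \<subseteq> {..<n}" "Cb_infinity n f"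
    "\<And>x y. (\<forall>i\<in>J. x i = y i) \<Longrightarrow> f x = f y" for J f
    using that
  proof (induction J arbitrary: f rule: finite_induct)
    case empty
    have "f = (\<lambda>_. f (\<lambda>_. 0))" by (rule ext, rule empty) simp
    then show ?case using wave_closure_const by metis
  next
    case (insert i J)
    then have i: "i < n" by simp
    have frozen: "wave_closure n (\<lambda>x. f (x(i := c)))" for c
    proof (rule insert.IH)
      show "Cb_infinity n (\<lambda>x. f (x(i := c)))" by (rule Cb_infinity_freeze[OF insert.prems(2)])
      show "f (x(i := c)) = f (y(i := c))" if "\<forall>j\<in>J. x j = y j" for x y
        by (rule insert.prems(3)) (use that in auto)
    qed (use insert.prems in auto)
    have folded: "wave_closure n (\<lambda>x. f (x(i := K * sin (x i / K))))" if K: "K > 0" for K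
    proof (rule wave_closure.limit[OF _ C1_limit_bernstein[OF insert.prems(2) i K]])
      show "wave_closure n (bernstein_coord i K N f)" for N
        unfolding bernstein_coord_def[abs_def] bernstein_sine_def
        by (intro wave_closure_sum wave_closure_mult_trig[OF trig_fun_Bernstein i] frozen)
      show "Cb_infinity n (\<lambda>x. f (x(i := K * sin (x i / K))))"
        by (rule Cb_infinity_fold[OF insert.prems(2) K i])
    qed
    show ?case
      by (rule wave_closure.limit[OF folded C1_limit_fold[OF insert.prems(2) i] insert.prems(2)]) simp
  qed
  show ?thesis
  proof (rule ind[OF _ _ assms, of "{..<n}"])
    show "f x = f y" if "\<forall>i\<in>{..<n}. x i = y i" for x y
      by (rule Cb_infinity_depends[OF assms]) (use that in simp)
  qed simp_all
qed

section \<open>Gaussian expectations of plane waves\<close>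

context isonormal_process begin

lemma X_centered: "centered_gaussian M (X \<phi>)"
  using gaussian[of "{\<phi>}" "\<lambda>_. 1"] by simp

lemma X_measurable [measurable]: "X \<phi> \<in> borel_measurable M"
  using X_centered[of \<phi>] distributed_measurable[of M lborel "X \<phi>"]
  unfolding centered_gaussian_def by fastforce

text \<open>
The covariance determines the unspecified variance of the law of \<open>X \<phi>\<close>.
\<close>

lemma X_cases:
  obtains "AE \<omega> in M. X \<phi> \<omega> = 0" "\<phi> = 0"
  | Z where "distributed M lborel Z (\<lambda>x. ennreal (std_normal_density x))"
      "norm \<phi> > 0" "X \<phi> = (\<lambda>\<omega>. norm \<phi> * Z \<omega>)"
proof -
  consider "AE \<omega> in M. X \<phi> \<omega> = 0"
    | \<sigma> where "\<sigma> > 0" "distributed M lborel (X \<phi>) (\<lambda>x. ennreal (normal_density 0 \<sigma> x))"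
    using X_centered[of \<phi>] unfolding centered_gaussian_def by blast
  then show ?thesis
  proof cases
    case 1
    have "\<phi> \<bullet> \<phi> = expectation (\<lambda>\<omega>. X \<phi> \<omega> * X \<phi> \<omega>)" by (simp add: covariance)
    also have "\<dots> = expectation (\<lambda>\<omega>. 0)" by (rule integral_cong_AE) (use 1 in auto)
    finally show ?thesis using 1 that(1) by simp
  next
    case 2
    let ?Z = "\<lambda>\<omega>. X \<phi> \<omega> / \<sigma>"
    have Z: "distributed M lborel ?Z (\<lambda>x. ennreal (std_normal_density x))"
      using normal_standard_normal_convert[OF 2(1), of "X \<phi>" 0] 2(2) by simp
    have "variance (X \<phi>) = \<sigma>\<^sup>2" "expectation (X \<phi>) = 0"
      using normal_distributed_variance[OF 2] normal_distributed_expectation[OF 2] by auto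
    then have "\<sigma>\<^sup>2 = \<phi> \<bullet> \<phi>" using covariance[of \<phi> \<phi>] by (simp add: power2_eq_square)
    then have "\<sigma> = norm \<phi>" using 2(1) by (metis norm_eq_sqrt_inner real_sqrt_unique less_imp_le)
    then show ?thesis using that(2)[OF Z] 2(1) by simp
  qed
qed

lemma X_square_integrable: "integrable M (\<lambda>\<omega>. (X \<phi> \<omega>)\<^sup>2)"
proof (cases rule: X_cases[of \<phi>])
  case 1
  then have "integrable M (\<lambda>\<omega>. (X \<phi> \<omega>)\<^sup>2) \<longleftrightarrow> integrable M (\<lambda>_. 0 :: real)"
    by (intro integrable_cong_AE) auto
  then show ?thesis by simp
next
  case (2 Z)
  have "integrable M (\<lambda>\<omega>. (Z \<omega>)\<^sup>2)"
    using distributed_integrable[OF 2(1), of "\<lambda>x. x\<^sup>2"] integrable_std_normal_moment[of 2]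
    by simp
  then show ?thesis by (simp add: 2(3) power_mult_distrib)
qed

lemma X_mult_integrable: "integrable M (\<lambda>\<omega>. X \<phi> \<omega> * X \<psi> \<omega>)"
proof (rule Bochner_Integration.integrable_bound)
  show "integrable M (\<lambda>\<omega>. (X \<phi> \<omega>)\<^sup>2 + (X \<psi> \<omega>)\<^sup>2)"
    by (intro Bochner_Integration.integrable_add X_square_integrable)
  have "\<bar>a * b\<bar> \<le> a\<^sup>2 + b\<^sup>2" for a b :: real
    using zero_le_power2[of "a + b"] zero_le_power2[of "a - b"] zero_le_power2[of a] zero_le_power2[of b]
    unfolding power2_sum power2_diff by linarith
  then show "AE \<omega> in M. norm (X \<phi> \<omega> * X \<psi> \<omega>) \<le> norm ((X \<phi> \<omega>)\<^sup>2 + (X \<psi> \<omega>)\<^sup>2)"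
    by simp
qed simp

lemma X_integrable: "integrable M (X \<phi>)"
  by (rule square_integrable_imp_integrable) (auto simp: X_square_integrable)

text \<open>
Linearity is forced by the covariance, which makes the second moment of the difference vanish.
\<close>

lemma X_linear: "AE \<omega> in M. X (a *\<^sub>R \<phi> + b *\<^sub>R \<psi>) \<omega> = a * X \<phi> \<omega> + b * X \<psi> \<omega>"
proof -
  let ?\<eta> = "a *\<^sub>R \<phi> + b *\<^sub>R \<psi>"
  let ?D = "\<lambda>\<omega>. X ?\<eta> \<omega> - (a * X \<phi> \<omega> + b * X \<psi> \<omega>)"
  have eq: "(?D \<omega>)\<^sup>2 = X ?\<eta> \<omega> * X ?\<eta> \<omega> + a\<^sup>2 * (X \<phi> \<omega> * X \<phi> \<omega>) + b\<^sup>2 * (X \<psi> \<omega> * X \<psi> \<omega>)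
      + 2 * a * b * (X \<phi> \<omega> * X \<psi> \<omega>) - 2 * a * (X ?\<eta> \<omega> * X \<phi> \<omega>) - 2 * b * (X ?\<eta> \<omega> * X \<psi> \<omega>)" for \<omega>
    by (simp add: power2_eq_square algebra_simps)
  have int: "integrable M (\<lambda>\<omega>. (?D \<omega>)\<^sup>2)"
    unfolding eq by (intro Bochner_Integration.integrable_add Bochner_Integration.integrable_diff
        integrable_mult_right X_mult_integrable)
  have "expectation (\<lambda>\<omega>. (?D \<omega>)\<^sup>2) = 0"
    unfolding eq by (simp add: X_mult_integrable covariance inner_simps power2_eq_square
        inner_commute algebra_simps)
  then have "AE \<omega> in M. (?D \<omega>)\<^sup>2 = 0"
    using integral_nonneg_eq_0_iff_AE[OF int] by simp
  then show ?thesis by eventually_elim simp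
qed

lemma X_linear_sum:
  fixes n :: nat
  shows "AE \<omega> in M. X (\<Sum>j<n. t j *\<^sub>R \<phi> j) \<omega> = (\<Sum>j<n. t j * X (\<phi> j) \<omega>)"
proof (induction n)
  case 0
  show ?case using X_linear[of 0 0 0 0] by simp
next
  case (Suc n)
  show ?case
    using Suc X_linear[of 1 "\<Sum>j<n. t j *\<^sub>R \<phi> j" "t n" "\<phi> n"] by eventually_elim simp
qed

lemma std_normal_char:
  assumes "distributed M lborel Z (\<lambda>x. ennreal (std_normal_density x))"
  shows "expectation (\<lambda>\<omega>. cos (t * Z \<omega>)) = exp (- t\<^sup>2 / 2)"
    and "expectation (\<lambda>\<omega>. sin (t * Z \<omega>)) = 0"
proof -
  have [measurable]: "Z \<in> borel_measurable M"
    using distributed_measurable[OF assms] by simp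
  have d: "std_normal_distribution = distr M borel Z"
    using distributed_distr_eq_density[OF assms]
    by (metis distr_cong sets_lborel)
  have "exp (- t\<^sup>2 / 2) = char (distr M borel Z) t"
    using fun_cong[OF char_std_normal_distribution, of t] d by simp
  also have "\<dots> = (CLINT \<omega>|M. iexp (t * Z \<omega>))"
    unfolding char_def by (simp add: integral_distr)
  finally have *: "complex_of_real (exp (- t\<^sup>2 / 2)) = (CLINT \<omega>|M. iexp (t * Z \<omega>))" .
  have int: "integrable M (\<lambda>\<omega>. iexp (t * Z \<omega>))"
    by (intro integrable_const_bound[where B = 1]) auto
  show "expectation (\<lambda>\<omega>. cos (t * Z \<omega>)) = exp (- t\<^sup>2 / 2)"
    using arg_cong[OF *, of Re] integral_Re[OF int] by (simp add: Re_exp)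
  show "expectation (\<lambda>\<omega>. sin (t * Z \<omega>)) = 0"
    using arg_cong[OF *, of Im] integral_Im[OF int] by (simp add: Im_exp)
qed

lemma expectation_cos_sin_X:
  "expectation (\<lambda>\<omega>. cos (X \<psi> \<omega>)) = exp (- (\<psi> \<bullet> \<psi>) / 2)"
  "expectation (\<lambda>\<omega>. sin (X \<psi> \<omega>)) = 0"
proof -
  have "expectation (\<lambda>\<omega>. cos (X \<psi> \<omega>)) = exp (- (\<psi> \<bullet> \<psi>) / 2) \<and>
    expectation (\<lambda>\<omega>. sin (X \<psi> \<omega>)) = 0"
  proof (cases rule: X_cases[of \<psi>])
    case 1
    have "expectation (\<lambda>\<omega>. cos (X \<psi> \<omega>)) = expectation (\<lambda>\<omega>. 1)"
      "expectation (\<lambda>\<omega>. sin (X \<psi> \<omega>)) = expectation (\<lambda>\<omega>. 0)"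
      by (rule integral_cong_AE; use 1 in auto)+
    then show ?thesis using 1 by (simp add: prob_space)
  next
    case (2 Z)
    then show ?thesis using std_normal_char[OF 2(1), of "norm \<psi>"]
      by (simp add: power2_norm_eq_inner)
  qed
  then show "expectation (\<lambda>\<omega>. cos (X \<psi> \<omega>)) = exp (- (\<psi> \<bullet> \<psi>) / 2)"
    "expectation (\<lambda>\<omega>. sin (X \<psi> \<omega>)) = 0" by auto
qed

lemma integrable_bounded:
  assumes "f \<in> borel_measurable M" "\<And>\<omega>. \<bar>f \<omega>\<bar> \<le> B"
  shows "integrable M (f :: 'a \<Rightarrow> real)"
  by (intro integrable_const_bound[where B = B]) (use assms in auto)

lemma expectation_cos_phase:
  "expectation (\<lambda>\<omega>. cos (X \<psi> \<omega> + b)) = cos b * exp (- (\<psi> \<bullet> \<psi>) / 2)"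
proof -
  have "integrable M (\<lambda>\<omega>. cos (X \<psi> \<omega>))" "integrable M (\<lambda>\<omega>. sin (X \<psi> \<omega>))"
    by (rule integrable_bounded[where B = 1]; simp)+
  then show ?thesis by (simp add: cos_add expectation_cos_sin_X)
qed

lemma expectation_cos_cos:
  "expectation (\<lambda>\<omega>. cos (X \<psi> \<omega> + b) * cos (X \<eta> \<omega> + c)) =
     exp (- (\<psi> \<bullet> \<psi>) / 2) * exp (- (\<eta> \<bullet> \<eta>) / 2) *
     (cos b * cos c * cosh (\<psi> \<bullet> \<eta>) + sin b * sin c * sinh (\<psi> \<bullet> \<eta>))"
proof -
  let ?p = "1 *\<^sub>R \<psi> + 1 *\<^sub>R \<eta>" and ?m = "1 *\<^sub>R \<psi> + (-1) *\<^sub>R \<eta>"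
  have "expectation (\<lambda>\<omega>. cos (X \<psi> \<omega> + b) * cos (X \<eta> \<omega> + c)) =
      expectation (\<lambda>\<omega>. (cos (X ?m \<omega> + (b - c)) + cos (X ?p \<omega> + (b + c))) / 2)"
  proof (rule integral_cong_AE)
    show "AE \<omega> in M. cos (X \<psi> \<omega> + b) * cos (X \<eta> \<omega> + c) =
        (cos (X ?m \<omega> + (b - c)) + cos (X ?p \<omega> + (b + c))) / 2"
      using X_linear[of 1 \<psi> 1 \<eta>] X_linear[of 1 \<psi> "-1" \<eta>]
    proof eventually_elim
      case (elim \<omega>)
      show ?case unfolding elim cos_times_cos by (simp add: algebra_simps)
    qed
  qed auto
  also have "\<dots> = (cos (b - c) * exp (- (?m \<bullet> ?m) / 2) + cos (b + c) * exp (- (?p \<bullet> ?p) / 2)) / 2"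
  proof -
    have "integrable M (\<lambda>\<omega>. cos (X ?m \<omega> + (b - c)))" "integrable M (\<lambda>\<omega>. cos (X ?p \<omega> + (b + c)))"
      by (rule integrable_bounded[where B = 1]; simp)+
    then show ?thesis by (simp add: expectation_cos_phase del: scaleR_one scaleR_minus1_left)
  qed
  also have "exp (- (?m \<bullet> ?m) / 2) = exp (- (\<psi> \<bullet> \<psi>) / 2) * exp (- (\<eta> \<bullet> \<eta>) / 2) * exp (\<psi> \<bullet> \<eta>)"
    by (simp add: mult_exp_exp inner_simps inner_commute field_simps)
  also have "exp (- (?p \<bullet> ?p) / 2) = exp (- (\<psi> \<bullet> \<psi>) / 2) * exp (- (\<eta> \<bullet> \<eta>) / 2) * exp (- (\<psi> \<bullet> \<eta>))"
    by (simp add: mult_exp_exp inner_simps inner_commute field_simps)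
  finally show ?thesis
    by (simp add: cosh_def sinh_def cos_add cos_diff field_simps)
qed

lemma expectation_sin_sin:
  "expectation (\<lambda>\<omega>. sin (X \<psi> \<omega> + b) * sin (X \<eta> \<omega> + c)) =
     exp (- (\<psi> \<bullet> \<psi>) / 2) * exp (- (\<eta> \<bullet> \<eta>) / 2) *
     (sin b * sin c * cosh (\<psi> \<bullet> \<eta>) + cos b * cos c * sinh (\<psi> \<bullet> \<eta>))"
proof -
  have "cos (y + (d - pi / 2)) = sin (y + d)" for y d
    by (simp add: cos_diff cos_add sin_add algebra_simps)
  then show ?thesis
    using expectation_cos_cos[of \<psi> "b - pi / 2" \<eta> "c - pi / 2"] by (simp add: cos_diff sin_diff)
qed

text \<open>
Both sides are minus the derivative at \<open>s = 0\<close> of \<open>E cos (X (\<psi> + s h) + b)\<close>, once under the expectation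
and once in the closed form.
\<close>

lemma expectation_X_sin:
  "expectation (\<lambda>\<omega>. X h \<omega> * sin (X \<psi> \<omega> + b)) = (\<psi> \<bullet> h) * expectation (\<lambda>\<omega>. cos (X \<psi> \<omega> + b))"
proof -
  define s where "s n = 1 / real (Suc n)" for n
  have s0: "s \<longlonglongrightarrow> 0" unfolding s_def by (rule LIMSEQ_Suc[OF lim_1_over_n])
  have sp: "s n \<noteq> 0" for n by (simp add: s_def)
  have sat: "filterlim s (at 0) sequentially"
    using s0 sp by (auto simp: filterlim_at)
  let ?q = "\<lambda>n \<omega>. (cos (X \<psi> \<omega> + s n * X h \<omega> + b) - cos (X \<psi> \<omega> + b)) / s n"
  have lip: "\<bar>cos (y + z) - cos y\<bar> \<le> \<bar>z\<bar>" for y z :: real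
  proof -
    have "\<bar>cos (y + z) - cos y\<bar> = 2 * (\<bar>sin ((y + z + y) / 2)\<bar> * \<bar>sin ((y - (y + z)) / 2)\<bar>)"
      unfolding cos_diff_cos by (simp add: abs_mult)
    also have "\<dots> \<le> 2 * (1 * \<bar>(y - (y + z)) / 2\<bar>)"
      by (intro mult_left_mono mult_mono abs_sin_le_one abs_sin_x_le_abs_x) auto
    finally show ?thesis by simp
  qed
  have 1: "(\<lambda>n. expectation (?q n)) \<longlonglongrightarrow> expectation (\<lambda>\<omega>. - (X h \<omega> * sin (X \<psi> \<omega> + b)))"
  proof (rule integral_dominated_convergence[where w = "\<lambda>\<omega>. \<bar>X h \<omega>\<bar>"])
    show "integrable M (\<lambda>\<omega>. \<bar>X h \<omega>\<bar>)" using X_integrable by auto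
    show "AE \<omega> in M. (\<lambda>n. ?q n \<omega>) \<longlonglongrightarrow> - (X h \<omega> * sin (X \<psi> \<omega> + b))"
    proof (rule AE_I2)
      fix \<omega>
      have "((\<lambda>z. cos (X \<psi> \<omega> + z * X h \<omega> + b)) has_real_derivative - (X h \<omega> * sin (X \<psi> \<omega> + b))) (at 0)"
        by (auto intro!: derivative_eq_intros)
      then have "((\<lambda>z. (cos (X \<psi> \<omega> + z * X h \<omega> + b) - cos (X \<psi> \<omega> + b)) / z) \<longlongrightarrow> - (X h \<omega> * sin (X \<psi> \<omega> + b))) (at 0)"
        by (simp add: DERIV_def)
      from filterlim_compose[OF this sat]
      show "(\<lambda>n. ?q n \<omega>) \<longlonglongrightarrow> - (X h \<omega> * sin (X \<psi> \<omega> + b))" .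
    qed
    show "AE \<omega> in M. norm (?q n \<omega>) \<le> \<bar>X h \<omega>\<bar>" for n
    proof (rule AE_I2)
      fix \<omega>
      show "norm (?q n \<omega>) \<le> \<bar>X h \<omega>\<bar>"
        using lip[of "X \<psi> \<omega> + b" "s n * X h \<omega>"] sp[of n]
        by (simp add: abs_mult abs_divide field_simps)
    qed
  qed auto
  let ?E = "\<lambda>z. cos b * exp (- (\<psi> \<bullet> \<psi> + 2 * z * (\<psi> \<bullet> h) + z\<^sup>2 * (h \<bullet> h)) / 2)"
  have 2: "expectation (?q n) = (?E (s n) - ?E 0) / s n" for n
  proof -
    let ?p = "1 *\<^sub>R \<psi> + s n *\<^sub>R h"
    have "integrable M (\<lambda>\<omega>. cos (X \<psi> \<omega> + s n * X h \<omega> + b))" "integrable M (\<lambda>\<omega>. cos (X \<psi> \<omega> + b))"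
      by (rule integrable_bounded[where B = 1]; simp)+
    then have "expectation (?q n) = (expectation (\<lambda>\<omega>. cos (X \<psi> \<omega> + s n * X h \<omega> + b))
        - expectation (\<lambda>\<omega>. cos (X \<psi> \<omega> + b))) / s n" by simp
    also have "expectation (\<lambda>\<omega>. cos (X \<psi> \<omega> + s n * X h \<omega> + b)) = expectation (\<lambda>\<omega>. cos (X ?p \<omega> + b))"
    proof (rule integral_cong_AE)
      show "AE \<omega> in M. cos (X \<psi> \<omega> + s n * X h \<omega> + b) = cos (X ?p \<omega> + b)"
        using X_linear[of 1 \<psi> "s n" h] by eventually_elim simp
    qed auto
    also have "\<dots> = ?E (s n)"
      unfolding expectation_cos_phase
      by (simp add: inner_simps inner_commute power2_eq_square algebra_simps)
    also have "expectation (\<lambda>\<omega>. cos (X \<psi> \<omega> + b)) = ?E 0"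
      by (simp add: expectation_cos_phase)
    finally show ?thesis .
  qed
  have "(?E has_real_derivative - ((\<psi> \<bullet> h) * (cos b * exp (- (\<psi> \<bullet> \<psi>) / 2)))) (at 0)"
    by (auto intro!: derivative_eq_intros simp: algebra_simps)
  then have "((\<lambda>z. (?E z - ?E 0) / z) \<longlongrightarrow> - ((\<psi> \<bullet> h) * (cos b * exp (- (\<psi> \<bullet> \<psi>) / 2)))) (at 0)"
    by (simp add: DERIV_def)
  from filterlim_compose[OF this sat]
  have "(\<lambda>n. expectation (?q n)) \<longlonglongrightarrow> - ((\<psi> \<bullet> h) * (cos b * exp (- (\<psi> \<bullet> \<psi>) / 2)))"
    unfolding 2 .
  from LIMSEQ_unique[OF 1 this] show ?thesis by (simp add: expectation_cos_phase)
qed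

lemma expectation_X_cos:
  "expectation (\<lambda>\<omega>. X h \<omega> * cos (X \<psi> \<omega> + b)) = (\<psi> \<bullet> h) * expectation (\<lambda>\<omega>. - sin (X \<psi> \<omega> + b))"
proof -
  have "cos (y + b) = sin (y + (b + pi / 2))" "- sin (y + b) = cos (y + (b + pi / 2))" for y
    by (simp_all add: cos_add sin_add algebra_simps)
  then show ?thesis using expectation_X_sin[of h \<psi> "b + pi / 2"] by (simp only:)
qed

lemma integral_double_sum:
  fixes f :: "'i \<Rightarrow> 'i \<Rightarrow> 'a \<Rightarrow> real"
  assumes "\<And>k l. integrable M (f k l)"
  shows "expectation (\<lambda>\<omega>. \<Sum>k\<in>I. \<Sum>l\<in>I. a k l * f k l \<omega>) = (\<Sum>k\<in>I. \<Sum>l\<in>I. a k l * expectation (f k l))"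
  using assms by (simp add: Bochner_Integration.integral_sum)

text \<open>
The Schur product theorem for Gram matrices: as \<open>\<psi> k \<bullet> \<psi> l\<close> is the covariance of \<open>X (\<psi> k)\<close> and \<open>X (\<psi> l)\<close>,
one more factor amounts to averaging the form with the random coefficients \<open>c k * X (\<psi> k) \<omega>\<close>.
\<close>

lemma inner_power_psd:
  fixes c :: "'i \<Rightarrow> real" and \<psi> :: "'i \<Rightarrow> 'h"
  assumes "finite I"
  shows "0 \<le> (\<Sum>k\<in>I. \<Sum>l\<in>I. c k * c l * (\<psi> k \<bullet> \<psi> l) ^ m)"
proof (induction m arbitrary: c)
  case 0
  have "(\<Sum>k\<in>I. \<Sum>l\<in>I. c k * c l) = (\<Sum>k\<in>I. c k)\<^sup>2"
    by (simp add: power2_eq_square sum_product)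
  then show ?case by simp
next
  case (Suc m)
  have "(\<Sum>k\<in>I. \<Sum>l\<in>I. c k * c l * (\<psi> k \<bullet> \<psi> l) ^ Suc m) =
    expectation (\<lambda>\<omega>. \<Sum>k\<in>I. \<Sum>l\<in>I. (c k * X (\<psi> k) \<omega>) * (c l * X (\<psi> l) \<omega>) * (\<psi> k \<bullet> \<psi> l) ^ m)"
  proof -
    have "(c k * X (\<psi> k) \<omega>) * (c l * X (\<psi> l) \<omega>) * (\<psi> k \<bullet> \<psi> l) ^ m =
      (c k * c l * (\<psi> k \<bullet> \<psi> l) ^ m) * (X (\<psi> k) \<omega> * X (\<psi> l) \<omega>)" for k l \<omega> by simp
    then show ?thesis
      by (simp only: integral_double_sum[OF X_mult_integrable] covariance) (simp add: mult_ac)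
  qed
  also have "\<dots> \<ge> 0" by (intro Bochner_Integration.integral_nonneg Suc)
  finally show ?case .
qed

lemma power_series_psd:
  fixes c :: "'i \<Rightarrow> real" and \<psi> :: "'i \<Rightarrow> 'h"
  assumes "finite I" "\<And>m. 0 \<le> d m" "\<And>x. (\<lambda>m. d m * x ^ m) sums g x"
  shows "0 \<le> (\<Sum>k\<in>I. \<Sum>l\<in>I. c k * c l * g (\<psi> k \<bullet> \<psi> l))"
proof -
  have S: "(\<lambda>m. \<Sum>k\<in>I. \<Sum>l\<in>I. c k * c l * (d m * (\<psi> k \<bullet> \<psi> l) ^ m)) sums
      (\<Sum>k\<in>I. \<Sum>l\<in>I. c k * c l * g (\<psi> k \<bullet> \<psi> l))"
    by (intro sums_sum sums_mult assms(3))
  have nn: "0 \<le> (\<Sum>k\<in>I. \<Sum>l\<in>I. c k * c l * (d m * (\<psi> k \<bullet> \<psi> l) ^ m))" for m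
  proof -
    have "(\<Sum>k\<in>I. \<Sum>l\<in>I. c k * c l * (d m * (\<psi> k \<bullet> \<psi> l) ^ m)) =
        d m * (\<Sum>k\<in>I. \<Sum>l\<in>I. c k * c l * (\<psi> k \<bullet> \<psi> l) ^ m)"
      by (simp add: sum_distrib_left mult_ac)
    also have "\<dots> \<ge> 0" by (intro mult_nonneg_nonneg assms(2) inner_power_psd[OF assms(1)])
    finally show ?thesis .
  qed
  show ?thesis by (rule sums_le[OF _ sums_zero S]) (rule nn)
qed

text \<open>
With the explicit covariances, the difference of the two sides is the sum of a form in the cosine
amplitudes and one in the sine amplitudes. Their kernels are the even and the odd part, at
\<open>x = \<psi> k \<bullet> \<psi> l\<close>, of \<open>x e\<^sup>x - e\<^sup>x + 1\<close>, whose Taylor coefficients \<open>(m - 1)/m!\<close>, \<open>m \<ge> 1\<close>, are nonnegative.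
\<close>

lemma poincare_trig:
  fixes a b :: "'i \<Rightarrow> real" and \<psi> :: "'i \<Rightarrow> 'h"
  assumes I: "finite I"
  shows "expectation (\<lambda>\<omega>. (\<Sum>k\<in>I. a k * cos (X (\<psi> k) \<omega> + b k))\<^sup>2)
      - (expectation (\<lambda>\<omega>. \<Sum>k\<in>I. a k * cos (X (\<psi> k) \<omega> + b k)))\<^sup>2
    \<le> expectation (\<lambda>\<omega>. (norm (\<Sum>k\<in>I. (a k * sin (X (\<psi> k) \<omega> + b k)) *\<^sub>R \<psi> k))\<^sup>2)"
proof -
  define \<alpha> where "\<alpha> k = a k * cos (b k) * exp (- (\<psi> k \<bullet> \<psi> k) / 2)" for k
  define \<beta> where "\<beta> k = a k * sin (b k) * exp (- (\<psi> k \<bullet> \<psi> k) / 2)" for k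
  let ?x = "\<lambda>k l. \<psi> k \<bullet> \<psi> l"
  have int: "integrable M (\<lambda>\<omega>. cos (X (\<psi> k) \<omega> + b k))"
    "integrable M (\<lambda>\<omega>. cos (X (\<psi> k) \<omega> + b k) * cos (X (\<psi> l) \<omega> + b l))"
    "integrable M (\<lambda>\<omega>. sin (X (\<psi> k) \<omega> + b k) * sin (X (\<psi> l) \<omega> + b l))" for k l
    by (rule integrable_bounded[where B = 1]; simp add: abs_mult mult_le_one)+
  have 1: "expectation (\<lambda>\<omega>. (\<Sum>k\<in>I. a k * cos (X (\<psi> k) \<omega> + b k))\<^sup>2) =
      (\<Sum>k\<in>I. \<Sum>l\<in>I. \<alpha> k * \<alpha> l * cosh (?x k l) + \<beta> k * \<beta> l * sinh (?x k l))"
  proof -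
    have "(\<Sum>k\<in>I. a k * cos (X (\<psi> k) \<omega> + b k))\<^sup>2 =
        (\<Sum>k\<in>I. \<Sum>l\<in>I. (a k * a l) * (cos (X (\<psi> k) \<omega> + b k) * cos (X (\<psi> l) \<omega> + b l)))" for \<omega>
      by (simp add: power2_eq_square sum_product mult_ac)
    then show ?thesis
      by (simp only: integral_double_sum[OF int(2)] expectation_cos_cos)
        (simp add: \<alpha>_def \<beta>_def algebra_simps)
  qed
  have 2: "(expectation (\<lambda>\<omega>. \<Sum>k\<in>I. a k * cos (X (\<psi> k) \<omega> + b k)))\<^sup>2 = (\<Sum>k\<in>I. \<Sum>l\<in>I. \<alpha> k * \<alpha> l)"
    by (simp add: int expectation_cos_phase \<alpha>_def power2_eq_square sum_product mult_ac)
  have 3: "expectation (\<lambda>\<omega>. (norm (\<Sum>k\<in>I. (a k * sin (X (\<psi> k) \<omega> + b k)) *\<^sub>R \<psi> k))\<^sup>2) =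
      (\<Sum>k\<in>I. \<Sum>l\<in>I. ?x k l * (\<beta> k * \<beta> l * cosh (?x k l) + \<alpha> k * \<alpha> l * sinh (?x k l)))"
  proof -
    have "(norm (\<Sum>k\<in>I. (a k * sin (X (\<psi> k) \<omega> + b k)) *\<^sub>R \<psi> k))\<^sup>2 =
        (\<Sum>k\<in>I. \<Sum>l\<in>I. (a k * a l * ?x k l) * (sin (X (\<psi> k) \<omega> + b k) * sin (X (\<psi> l) \<omega> + b l)))" for \<omega>
      by (simp add: power2_norm_eq_inner inner_sum_left inner_sum_right sum_distrib_left mult_ac)
        (subst sum.swap, simp add: inner_commute mult_ac)
    then show ?thesis
      by (simp only: integral_double_sum[OF int(3)] expectation_sin_sin)
        (simp add: \<alpha>_def \<beta>_def algebra_simps)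
  qed
  define d where "d m = (real m - 1) / fact m + (if m = 0 then 1 else 0)" for m
  define g where "g x = x * exp x - exp x + 1" for x :: real
  have d: "(\<lambda>m. d m * x ^ m) sums g x" for x
  proof -
    have e: "(\<lambda>m. x ^ m / fact m) sums exp x"
      using exp_converges[of x] by (simp add: field_simps)
    have "(\<lambda>m. x * (x ^ m / fact m)) sums (x * exp x)" by (rule sums_mult[OF e])
    then have "(\<lambda>m. real (Suc m) / fact (Suc m) * x ^ Suc m) sums (x * exp x)"
      by (simp add: field_simps del: of_nat_Suc)
    then have "(\<lambda>m. real m / fact m * x ^ m) sums (x * exp x)"
      by (subst (asm) sums_Suc_iff) simp
    from sums_add[OF sums_diff[OF this e] sums_single[of 0 "\<lambda>_. 1"]]
    have "(\<lambda>m. real m / fact m * x ^ m - x ^ m / fact m + (if m = 0 then 1 else 0)) sums g x"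
      by (simp add: g_def)
    moreover have "d m * x ^ m = real m / fact m * x ^ m - x ^ m / fact m + (if m = 0 then 1 else 0)" for m
      by (simp add: d_def field_simps)
    ultimately show ?thesis by simp
  qed
  have d0: "0 \<le> d m" for m by (cases m) (auto simp: d_def)
  have even: "(\<lambda>m. (if even m then d m else 0) * x ^ m) sums ((g x + g (- x)) / 2)" for x
  proof -
    have eq: "(if even m then d m else 0) * x ^ m = (d m * x ^ m + d m * (- x) ^ m) / 2" for m
      by (auto simp: power_minus_odd)
    show ?thesis unfolding eq by (rule sums_divide[OF sums_add[OF d[of x] d[of "- x"]]])
  qed
  have odd: "(\<lambda>m. (if odd m then d m else 0) * x ^ m) sums ((g x - g (- x)) / 2)" for x
  proof -
    have eq: "(if odd m then d m else 0) * x ^ m = (d m * x ^ m - d m * (- x) ^ m) / 2" for m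
      by (auto simp: power_minus_odd)
    show ?thesis unfolding eq by (rule sums_divide[OF sums_diff[OF d[of x] d[of "- x"]]])
  qed
  \<comment> \<open>Even and odd part of \<open>g\<close> in terms of hyperbolic functions.\<close>
  have hyp: "p * ((g x + g (- x)) / 2) + q * ((g x - g (- x)) / 2) =
      x * (q * cosh x + p * sinh x) - (p * cosh x + q * sinh x) + p" for p q x
    by (simp add: g_def cosh_def sinh_def field_simps)
  have "0 \<le> (\<Sum>k\<in>I. \<Sum>l\<in>I. \<alpha> k * \<alpha> l * ((g (?x k l) + g (- ?x k l)) / 2))
        + (\<Sum>k\<in>I. \<Sum>l\<in>I. \<beta> k * \<beta> l * ((g (?x k l) - g (- ?x k l)) / 2))"
    by (intro add_nonneg_nonneg power_series_psd[OF I _ even] power_series_psd[OF I _ odd])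
      (simp_all add: d0)
  also have "\<dots> = (\<Sum>k\<in>I. \<Sum>l\<in>I. ?x k l * (\<beta> k * \<beta> l * cosh (?x k l) + \<alpha> k * \<alpha> l * sinh (?x k l))
      - (\<alpha> k * \<alpha> l * cosh (?x k l) + \<beta> k * \<beta> l * sinh (?x k l)) + \<alpha> k * \<alpha> l)"
    unfolding sum.distrib[symmetric] hyp ..
  finally show ?thesis
    unfolding 1 2 3 sum.distrib sum_subtractf by linarith
qed

end

section \<open>Square integrable functions\<close>

text \<open>
Real random variables and random vectors, in particular gradients, are treated alike through
the norm.
\<close>

definition L2 :: "'a measure \<Rightarrow> ('a \<Rightarrow> 'b::{real_inner, second_countable_topology}) \<Rightarrow> bool" where
  "L2 M f \<longleftrightarrow> f \<in> borel_measurable M \<and> integrable M (\<lambda>\<omega>. (norm (f \<omega>))\<^sup>2)"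

definition L2_dist :: "'a measure \<Rightarrow> ('a \<Rightarrow> 'b::{real_inner, second_countable_topology}) \<Rightarrow> ('a \<Rightarrow> 'b) \<Rightarrow> real" where
  "L2_dist M f g = (\<integral>\<omega>. (norm (f \<omega> - g \<omega>))\<^sup>2 \<partial>M)"

definition L2_lim :: "'a measure \<Rightarrow> (nat \<Rightarrow> 'a \<Rightarrow> 'b::{real_inner, second_countable_topology}) \<Rightarrow> ('a \<Rightarrow> 'b) \<Rightarrow> bool" where
  "L2_lim M f g \<longleftrightarrow> (\<forall>n. L2 M (f n)) \<and> L2 M g \<and> (\<lambda>n. L2_dist M (f n) g) \<longlonglongrightarrow> 0"

lemma L2_measurable: "L2 M f \<Longrightarrow> f \<in> borel_measurable M"
  by (simp add: L2_def)

lemma L2_integrable: "L2 M f \<Longrightarrow> integrable M (\<lambda>\<omega>. (norm (f \<omega>))\<^sup>2)"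
  by (simp add: L2_def)

lemma L2_real_integrable: "L2 M f \<Longrightarrow> integrable M (\<lambda>\<omega>. (f \<omega> :: real)\<^sup>2)"
  using L2_integrable[of M f] by simp

lemma L2_bound:
  assumes "f \<in> borel_measurable M" "integrable M g" "\<And>\<omega>. (norm (f \<omega>))\<^sup>2 \<le> (g \<omega> :: real)"
  shows "L2 M f"
  unfolding L2_def
proof (intro conjI assms(1) Bochner_Integration.integrable_bound[OF assms(2)] AE_I2)
  show "(\<lambda>\<omega>. (norm (f \<omega>))\<^sup>2) \<in> borel_measurable M" using assms(1) by simp
  show "norm ((norm (f \<omega>))\<^sup>2) \<le> norm (g \<omega>)" for \<omega>
    using assms(3)[of \<omega>] by (simp add: order_trans[OF _ abs_ge_self])
qed

lemma norm_add_sq_le: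
  fixes x y :: "'b::real_inner"
  shows "(norm (x + y))\<^sup>2 \<le> 2 * (norm x)\<^sup>2 + 2 * (norm y)\<^sup>2"
proof -
  have "0 \<le> (norm (x - y))\<^sup>2" by simp
  then show ?thesis unfolding power2_norm_eq_inner by (simp add: inner_simps inner_commute)
qed

lemma L2_add:
  assumes "L2 M f" "L2 M g" shows "L2 M (\<lambda>\<omega>. f \<omega> + g \<omega>)"
proof (rule L2_bound)
  show "integrable M (\<lambda>\<omega>. 2 * (norm (f \<omega>))\<^sup>2 + 2 * (norm (g \<omega>))\<^sup>2)"
    using assms by (auto simp: L2_def)
  show "(\<lambda>\<omega>. f \<omega> + g \<omega>) \<in> borel_measurable M"
    using assms by (auto simp: L2_def)
qed (rule norm_add_sq_le)

lemma L2_scaleR: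
  assumes "L2 M f" shows "L2 M (\<lambda>\<omega>. c *\<^sub>R f \<omega>)"
proof -
  have [measurable]: "f \<in> borel_measurable M" using L2_measurable[OF assms] .
  show ?thesis
    using L2_integrable[OF assms] unfolding L2_def by (simp add: power_mult_distrib)
qed

lemma L2_minus: "L2 M f \<Longrightarrow> L2 M (\<lambda>\<omega>. - f \<omega>)"
  using L2_scaleR[of M f "-1"] by simp

lemma L2_diff: "L2 M f \<Longrightarrow> L2 M g \<Longrightarrow> L2 M (\<lambda>\<omega>. f \<omega> - g \<omega>)"
  using L2_add[of M f "\<lambda>\<omega>. - g \<omega>"] L2_minus[of M g] by simp

lemma L2_zero: "L2 M (\<lambda>_. 0)"
  by (simp add: L2_def)

lemma L2_norm: "L2 M f \<Longrightarrow> L2 M (\<lambda>\<omega>. norm (f \<omega>))"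
  by (auto simp: L2_def intro: borel_measurable_norm)

lemma L2_mult_bounded:
  assumes "L2 M f" "a \<in> borel_measurable M" "\<And>\<omega>. \<bar>a \<omega>\<bar> \<le> B"
  shows "L2 M (\<lambda>\<omega>. (a \<omega> :: real) *\<^sub>R f \<omega>)"
proof (rule L2_bound)
  show "(\<lambda>\<omega>. a \<omega> *\<^sub>R f \<omega>) \<in> borel_measurable M"
    using assms(2) L2_measurable[OF assms(1)] by simp
  show "integrable M (\<lambda>\<omega>. B\<^sup>2 * (norm (f \<omega>))\<^sup>2)" using L2_integrable[OF assms(1)] by simp
  show "(norm (a \<omega> *\<^sub>R f \<omega>))\<^sup>2 \<le> B\<^sup>2 * (norm (f \<omega>))\<^sup>2" for \<omega>
    using power_mono[OF assms(3)[of \<omega>] abs_ge_zero, of 2]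
    by (simp add: power_mult_distrib mult_right_mono)
qed

lemma L2_real_mult_bounded:
  "L2 M f \<Longrightarrow> a \<in> borel_measurable M \<Longrightarrow> (\<And>\<omega>. \<bar>a \<omega>\<bar> \<le> B) \<Longrightarrow> L2 M (\<lambda>\<omega>. a \<omega> * f \<omega> :: real)"
  using L2_mult_bounded[of M f a B] by simp

lemma L2_mult_integrable:
  assumes "L2 M f" "L2 M g" shows "integrable M (\<lambda>\<omega>. f \<omega> * g \<omega> :: real)"
proof (rule Bochner_Integration.integrable_bound)
  show "integrable M (\<lambda>\<omega>. (f \<omega>)\<^sup>2 + (g \<omega>)\<^sup>2)"
    using assms[THEN L2_real_integrable] by (rule Bochner_Integration.integrable_add)
  show "(\<lambda>\<omega>. f \<omega> * g \<omega>) \<in> borel_measurable M" using assms[THEN L2_measurable] by simp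
  have "\<bar>a * b\<bar> \<le> a\<^sup>2 + b\<^sup>2" for a b :: real
    using zero_le_power2[of "a + b"] zero_le_power2[of "a - b"] zero_le_power2[of a] zero_le_power2[of b]
    unfolding power2_sum power2_diff by linarith
  then show "AE \<omega> in M. norm (f \<omega> * g \<omega>) \<le> norm ((f \<omega>)\<^sup>2 + (g \<omega>)\<^sup>2)" by simp
qed

lemma L2_inner_integrable:
  assumes "L2 M f" "L2 M g" shows "integrable M (\<lambda>\<omega>. f \<omega> \<bullet> g \<omega>)"
proof (rule Bochner_Integration.integrable_bound[OF L2_mult_integrable[OF assms[THEN L2_norm]]])
  show "(\<lambda>\<omega>. f \<omega> \<bullet> g \<omega>) \<in> borel_measurable M" using assms[THEN L2_measurable] by simp
  show "AE \<omega> in M. norm (f \<omega> \<bullet> g \<omega>) \<le> norm (norm (f \<omega>) * norm (g \<omega>))"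
    using Cauchy_Schwarz_ineq2[of "f _" "g _"] by simp
qed

lemma L2_Cauchy_Schwarz_real:
  assumes "L2 M f" "L2 M g" "\<And>\<omega>. 0 \<le> f \<omega>" "\<And>\<omega>. 0 \<le> (g \<omega> :: real)"
  shows "(\<integral>\<omega>. f \<omega> * g \<omega> \<partial>M) \<le> sqrt (\<integral>\<omega>. (f \<omega>)\<^sup>2 \<partial>M) * sqrt (\<integral>\<omega>. (g \<omega>)\<^sup>2 \<partial>M)"
proof -
  let ?A = "\<integral>\<omega>. (f \<omega>)\<^sup>2 \<partial>M" and ?B = "\<integral>\<omega>. (g \<omega>)\<^sup>2 \<partial>M" and ?I = "\<integral>\<omega>. f \<omega> * g \<omega> \<partial>M"
  have int: "integrable M (\<lambda>\<omega>. (f \<omega>)\<^sup>2)" "integrable M (\<lambda>\<omega>. (g \<omega>)\<^sup>2)" "integrable M (\<lambda>\<omega>. f \<omega> * g \<omega>)"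
    using L2_real_integrable L2_mult_integrable assms by blast+
  have nn: "0 \<le> ?A" "0 \<le> ?B" by (auto intro: Bochner_Integration.integral_nonneg)
  have q: "2 * (s * r) * ?I \<le> s\<^sup>2 * ?A + r\<^sup>2 * ?B" for s r :: real
  proof -
    have "0 \<le> (\<integral>\<omega>. (s * f \<omega> - r * g \<omega>)\<^sup>2 \<partial>M)" by (rule Bochner_Integration.integral_nonneg) simp
    also have "\<dots> = (\<integral>\<omega>. s\<^sup>2 * (f \<omega>)\<^sup>2 + r\<^sup>2 * (g \<omega>)\<^sup>2 - 2 * (s * r) * (f \<omega> * g \<omega>) \<partial>M)"
      by (intro Bochner_Integration.integral_cong refl) (simp add: power2_eq_square algebra_simps)
    also have "\<dots> = s\<^sup>2 * ?A + r\<^sup>2 * ?B - 2 * (s * r) * ?I" using int by simp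
    finally show ?thesis by simp
  qed
  show ?thesis
  proof (cases "?A = 0 \<or> ?B = 0")
    case True
    then have "AE \<omega> in M. f \<omega> * g \<omega> = 0"
    proof
      assume "?A = 0"
      then have "AE \<omega> in M. (f \<omega>)\<^sup>2 = 0" using integral_nonneg_eq_0_iff_AE[OF int(1)] by simp
      then show ?thesis by eventually_elim simp
    next
      assume "?B = 0"
      then have "AE \<omega> in M. (g \<omega>)\<^sup>2 = 0" using integral_nonneg_eq_0_iff_AE[OF int(2)] by simp
      then show ?thesis by eventually_elim simp
    qed
    then have "?I = 0" by (simp add: integral_eq_zero_AE)
    then show ?thesis using nn by simp
  next
    case False
    then have p: "0 < sqrt ?A * sqrt ?B" using nn by (simp add: less_le)
    have "2 * (sqrt ?B * sqrt ?A) * ?I \<le> 2 * (sqrt ?A * sqrt ?B) * (sqrt ?A * sqrt ?B)"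
      using q[of "sqrt ?B" "sqrt ?A"] nn by (simp add: mult_ac real_sqrt_mult[symmetric])
    then have "?I * (sqrt ?A * sqrt ?B) \<le> (sqrt ?A * sqrt ?B) * (sqrt ?A * sqrt ?B)" by (simp add: mult_ac)
    then show ?thesis by (rule mult_right_le_imp_le[OF _ p])
  qed
qed

lemma L2_Cauchy_Schwarz:
  assumes "L2 M f" "L2 M g"
  shows "\<bar>\<integral>\<omega>. f \<omega> \<bullet> g \<omega> \<partial>M\<bar> \<le> sqrt (\<integral>\<omega>. (norm (f \<omega>))\<^sup>2 \<partial>M) * sqrt (\<integral>\<omega>. (norm (g \<omega>))\<^sup>2 \<partial>M)"
proof -
  have "\<bar>\<integral>\<omega>. f \<omega> \<bullet> g \<omega> \<partial>M\<bar> \<le> (\<integral>\<omega>. \<bar>f \<omega> \<bullet> g \<omega>\<bar> \<partial>M)" by (rule integral_abs_bound)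
  also have "\<dots> \<le> (\<integral>\<omega>. norm (f \<omega>) * norm (g \<omega>) \<partial>M)"
    by (intro integral_mono L2_mult_integrable[OF assms[THEN L2_norm]] integrable_abs
        L2_inner_integrable[OF assms] Cauchy_Schwarz_ineq2)
  also have "\<dots> \<le> sqrt (\<integral>\<omega>. (norm (f \<omega>))\<^sup>2 \<partial>M) * sqrt (\<integral>\<omega>. (norm (g \<omega>))\<^sup>2 \<partial>M)"
    by (rule L2_Cauchy_Schwarz_real[OF assms[THEN L2_norm]]) auto
  finally show ?thesis .
qed

lemma L2_dist_nonneg: "0 \<le> L2_dist M f g"
  unfolding L2_dist_def by (rule Bochner_Integration.integral_nonneg) simp

lemma L2_dist_commute: "L2_dist M f g = L2_dist M g f"
  unfolding L2_dist_def by (simp add: norm_minus_commute)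

lemma L2_dist_add:
  assumes "L2 M f" "L2 M g" "L2 M f'" "L2 M g'"
  shows "L2_dist M (\<lambda>\<omega>. f \<omega> + f' \<omega>) (\<lambda>\<omega>. g \<omega> + g' \<omega>) \<le> 2 * L2_dist M f g + 2 * L2_dist M f' g'"
proof -
  have "L2_dist M (\<lambda>\<omega>. f \<omega> + f' \<omega>) (\<lambda>\<omega>. g \<omega> + g' \<omega>) \<le>
      (\<integral>\<omega>. 2 * (norm (f \<omega> - g \<omega>))\<^sup>2 + 2 * (norm (f' \<omega> - g' \<omega>))\<^sup>2 \<partial>M)"
    unfolding L2_dist_def
  proof (rule integral_mono)
    show "integrable M (\<lambda>\<omega>. (norm (f \<omega> + f' \<omega> - (g \<omega> + g' \<omega>)))\<^sup>2)"
      by (intro L2_integrable L2_diff L2_add assms)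
    show "integrable M (\<lambda>\<omega>. 2 * (norm (f \<omega> - g \<omega>))\<^sup>2 + 2 * (norm (f' \<omega> - g' \<omega>))\<^sup>2)"
      by (intro Bochner_Integration.integrable_add integrable_mult_right L2_integrable L2_diff assms)
    show "(norm (f \<omega> + f' \<omega> - (g \<omega> + g' \<omega>)))\<^sup>2 \<le> 2 * (norm (f \<omega> - g \<omega>))\<^sup>2 + 2 * (norm (f' \<omega> - g' \<omega>))\<^sup>2" for \<omega>
      using norm_add_sq_le[of "f \<omega> - g \<omega>" "f' \<omega> - g' \<omega>"] by (simp add: algebra_simps)
  qed
  also have "\<dots> = 2 * L2_dist M f g + 2 * L2_dist M f' g'"
    unfolding L2_dist_def
    by (subst Bochner_Integration.integral_add) (simp_all add: L2_integrable[OF L2_diff] assms)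
  finally show ?thesis .
qed

lemma L2_dist_triangle:
  assumes "L2 M f" "L2 M g" "L2 M h"
  shows "L2_dist M f h \<le> 2 * L2_dist M f g + 2 * L2_dist M g h"
  using L2_dist_add[OF assms(1,2) L2_diff[OF assms(2,3)] L2_zero]
    L2_dist_add[OF L2_diff[OF assms(1,2)] L2_zero L2_diff[OF assms(2,3)] L2_zero]
  by (simp add: L2_dist_def)

lemma null_sequence_dominated:
  fixes x y :: "nat \<Rightarrow> real"
  assumes "\<And>n. 0 \<le> x n" "\<And>n. x n \<le> y n" "y \<longlonglongrightarrow> 0"
  shows "x \<longlonglongrightarrow> 0"
  by (rule Lim_null_comparison[OF _ assms(3)]) (simp add: assms(1,2))

lemma L2_lim_add:
  assumes "L2_lim M f g" "L2_lim M f' g'"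
  shows "L2_lim M (\<lambda>n \<omega>. f n \<omega> + f' n \<omega>) (\<lambda>\<omega>. g \<omega> + g' \<omega>)"
proof -
  have l: "(\<lambda>n. 2 * L2_dist M (f n) g + 2 * L2_dist M (f' n) g') \<longlonglongrightarrow> 2 * 0 + 2 * 0"
    using assms unfolding L2_lim_def by (intro tendsto_intros) auto
  have "(\<lambda>n. L2_dist M (\<lambda>\<omega>. f n \<omega> + f' n \<omega>) (\<lambda>\<omega>. g \<omega> + g' \<omega>)) \<longlonglongrightarrow> 0"
    by (rule tendsto_sandwich[OF _ _ tendsto_const l[simplified]])
      (use assms in \<open>auto simp: L2_lim_def L2_dist_nonneg intro!: always_eventually L2_dist_add\<close>)
  then show ?thesis using assms by (auto simp: L2_lim_def intro: L2_add)
qed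

lemma L2_lim_scaleR:
  assumes "L2_lim M f g"
  shows "L2_lim M (\<lambda>n \<omega>. c *\<^sub>R f n \<omega>) (\<lambda>\<omega>. c *\<^sub>R g \<omega>)"
proof -
  have "L2_dist M (\<lambda>\<omega>. c *\<^sub>R f n \<omega>) (\<lambda>\<omega>. c *\<^sub>R g \<omega>) = c\<^sup>2 * L2_dist M (f n) g" for n
    unfolding L2_dist_def by (simp add: scaleR_diff_right[symmetric] power_mult_distrib del: scaleR_diff_right)
  moreover have "(\<lambda>n. c\<^sup>2 * L2_dist M (f n) g) \<longlonglongrightarrow> c\<^sup>2 * 0"
    using assms unfolding L2_lim_def by (intro tendsto_intros) auto
  ultimately show ?thesis using assms by (auto simp: L2_lim_def intro: L2_scaleR)
qed

lemma L2_lim_const: "L2 M f \<Longrightarrow> L2_lim M (\<lambda>_. f) f"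
  by (simp add: L2_lim_def L2_dist_def)

lemma L2_lim_subseq:
  assumes "L2_lim M f g" "strict_mono r" shows "L2_lim M (\<lambda>n. f (r n)) g"
  using assms LIMSEQ_subseq_LIMSEQ[of "\<lambda>n. L2_dist M (f n) g" 0 r]
  by (auto simp: L2_lim_def o_def)

lemma L2_lim_inner:
  assumes "L2_lim M f g" "L2_lim M f' g'"
  shows "(\<lambda>n. \<integral>\<omega>. f n \<omega> \<bullet> f' n \<omega> \<partial>M) \<longlonglongrightarrow> (\<integral>\<omega>. g \<omega> \<bullet> g' \<omega> \<partial>M)"
proof -
  have L: "\<And>n. L2 M (f n)" "L2 M g" "\<And>n. L2 M (f' n)" "L2 M g'"
    and d: "(\<lambda>n. L2_dist M (f n) g) \<longlonglongrightarrow> 0" "(\<lambda>n. L2_dist M (f' n) g') \<longlonglongrightarrow> 0"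
    using assms unfolding L2_lim_def by auto
  let ?N = "\<lambda>h. \<integral>\<omega>. (norm (h \<omega>))\<^sup>2 \<partial>M"
  have eq: "(\<integral>\<omega>. f n \<omega> \<bullet> f' n \<omega> \<partial>M) - (\<integral>\<omega>. g \<omega> \<bullet> g' \<omega> \<partial>M) =
      (\<integral>\<omega>. (f n \<omega> - g \<omega>) \<bullet> (f' n \<omega> - g' \<omega>) \<partial>M) + (\<integral>\<omega>. (f n \<omega> - g \<omega>) \<bullet> g' \<omega> \<partial>M)
      + (\<integral>\<omega>. g \<omega> \<bullet> (f' n \<omega> - g' \<omega>) \<partial>M)" for n
    by (simp add: inner_diff_left inner_diff_right L L2_inner_integrable)
  have b: "\<bar>(\<integral>\<omega>. f n \<omega> \<bullet> f' n \<omega> \<partial>M) - (\<integral>\<omega>. g \<omega> \<bullet> g' \<omega> \<partial>M)\<bar> \<le>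
      sqrt (L2_dist M (f n) g) * sqrt (L2_dist M (f' n) g') + sqrt (L2_dist M (f n) g) * sqrt (?N g')
      + sqrt (?N g) * sqrt (L2_dist M (f' n) g')" for n
    unfolding eq L2_dist_def
    by (intro order_trans[OF abs_triangle_ineq] add_mono L2_Cauchy_Schwarz L2_diff L)
  have "(\<lambda>n. sqrt (L2_dist M (f n) g) * sqrt (L2_dist M (f' n) g') + sqrt (L2_dist M (f n) g) * sqrt (?N g')
      + sqrt (?N g) * sqrt (L2_dist M (f' n) g')) \<longlonglongrightarrow> sqrt 0 * sqrt 0 + sqrt 0 * sqrt (?N g') + sqrt (?N g) * sqrt 0"
    by (intro tendsto_intros d)
  then have lim0: "(\<lambda>n. sqrt (L2_dist M (f n) g) * sqrt (L2_dist M (f' n) g') + sqrt (L2_dist M (f n) g) * sqrt (?N g')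
      + sqrt (?N g) * sqrt (L2_dist M (f' n) g')) \<longlonglongrightarrow> 0" by simp
  have "(\<lambda>n. (\<integral>\<omega>. f n \<omega> \<bullet> f' n \<omega> \<partial>M) - (\<integral>\<omega>. g \<omega> \<bullet> g' \<omega> \<partial>M)) \<longlonglongrightarrow> 0"
    by (rule Lim_null_comparison[OF _ lim0]) (simp only: real_norm_def b eventually_True)
  then show ?thesis by (simp add: LIM_zero_iff)
qed

lemma L2_lim_AE_subseq:
  assumes "L2_lim M f g"
  obtains r where "strict_mono r" "AE \<omega> in M. (\<lambda>n. f (r n) \<omega>) \<longlonglongrightarrow> g \<omega>"
proof -
  have L: "\<And>n. L2 M (f n)" "L2 M g" and d: "(\<lambda>n. L2_dist M (f n) g) \<longlonglongrightarrow> 0"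
    using assms unfolding L2_lim_def by auto
  have "\<exists>r. strict_mono r \<and> (AE \<omega> in M. (\<lambda>n. (norm (f (r n) \<omega> - g \<omega>))\<^sup>2) \<longlonglongrightarrow> 0)"
    by (rule tendsto_L1_AE_subseq[OF L2_integrable[OF L2_diff[OF L]]])
      (use d in \<open>simp add: L2_dist_def\<close>)
  then obtain r where r: "strict_mono r" "AE \<omega> in M. (\<lambda>n. (norm (f (r n) \<omega> - g \<omega>))\<^sup>2) \<longlonglongrightarrow> 0" by blast
  have "AE \<omega> in M. (\<lambda>n. f (r n) \<omega>) \<longlonglongrightarrow> g \<omega>"
    using r(2)
  proof eventually_elim
    case (elim \<omega>)
    from tendsto_real_sqrt[OF elim] have "(\<lambda>n. norm (f (r n) \<omega> - g \<omega>)) \<longlonglongrightarrow> 0" by simp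
    then show ?case by (metis LIM_zero_iff tendsto_norm_zero_iff)
  qed
  then show ?thesis using that r(1) by blast
qed

lemma L2_dist_nn_integral:
  assumes "L2 M f" "L2 M g"
  shows "(\<integral>\<^sup>+\<omega>. ennreal ((norm (f \<omega> - g \<omega>))\<^sup>2) \<partial>M) = ennreal (L2_dist M f g)"
  unfolding L2_dist_def by (rule nn_integral_eq_integral[OF L2_integrable[OF L2_diff[OF assms]]]) simp

lemma L2_inner_const: "L2 M f \<Longrightarrow> L2 M (\<lambda>\<omega>. f \<omega> \<bullet> h)"
proof (rule L2_bound)
  assume f: "L2 M f"
  show "(\<lambda>\<omega>. f \<omega> \<bullet> h) \<in> borel_measurable M" using L2_measurable[OF f] by simp
  show "integrable M (\<lambda>\<omega>. (norm h)\<^sup>2 * (norm (f \<omega>))\<^sup>2)" using L2_integrable[OF f] by simp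
  show "(norm (f \<omega> \<bullet> h))\<^sup>2 \<le> (norm h)\<^sup>2 * (norm (f \<omega>))\<^sup>2" for \<omega>
    using power_mono[OF Cauchy_Schwarz_ineq2[of "f \<omega>" h] abs_ge_zero, of 2]
    by (simp add: power_mult_distrib mult.commute)
qed

lemma L2_lim_inner_const:
  assumes "L2_lim M f g" shows "L2_lim M (\<lambda>n \<omega>. f n \<omega> \<bullet> h) (\<lambda>\<omega>. g \<omega> \<bullet> h)"
proof -
  have L: "\<And>n. L2 M (f n)" "L2 M g" and d: "(\<lambda>n. L2_dist M (f n) g) \<longlonglongrightarrow> 0"
    using assms unfolding L2_lim_def by auto
  have le: "L2_dist M (\<lambda>\<omega>. f n \<omega> \<bullet> h) (\<lambda>\<omega>. g \<omega> \<bullet> h) \<le> (norm h)\<^sup>2 * L2_dist M (f n) g" for n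
  proof -
    have "L2_dist M (\<lambda>\<omega>. f n \<omega> \<bullet> h) (\<lambda>\<omega>. g \<omega> \<bullet> h) \<le> (\<integral>\<omega>. (norm h)\<^sup>2 * (norm (f n \<omega> - g \<omega>))\<^sup>2 \<partial>M)"
      unfolding L2_dist_def
    proof (rule integral_mono)
      show "integrable M (\<lambda>\<omega>. (norm (f n \<omega> \<bullet> h - g \<omega> \<bullet> h))\<^sup>2)"
        by (intro L2_integrable L2_diff L2_inner_const L)
      show "integrable M (\<lambda>\<omega>. (norm h)\<^sup>2 * (norm (f n \<omega> - g \<omega>))\<^sup>2)"
        by (intro integrable_mult_right L2_integrable L2_diff L)
      show "(norm (f n \<omega> \<bullet> h - g \<omega> \<bullet> h))\<^sup>2 \<le> (norm h)\<^sup>2 * (norm (f n \<omega> - g \<omega>))\<^sup>2" for \<omega>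
        using power_mono[OF Cauchy_Schwarz_ineq2[of "f n \<omega> - g \<omega>" h] abs_ge_zero, of 2]
        by (simp add: power_mult_distrib mult.commute inner_diff_left)
    qed
    then show ?thesis by (simp add: L2_dist_def)
  qed
  have "(\<lambda>n. (norm h)\<^sup>2 * L2_dist M (f n) g) \<longlonglongrightarrow> (norm h)\<^sup>2 * 0"
    by (intro tendsto_intros d)
  then have "(\<lambda>n. (norm h)\<^sup>2 * L2_dist M (f n) g) \<longlonglongrightarrow> 0" by simp
  from null_sequence_dominated[OF L2_dist_nonneg le this]
  have "(\<lambda>n. L2_dist M (\<lambda>\<omega>. f n \<omega> \<bullet> h) (\<lambda>\<omega>. g \<omega> \<bullet> h)) \<longlonglongrightarrow> 0" .
  then show ?thesis by (simp add: L2_lim_def L2_inner_const L)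
qed

lemma L2_lim_scaleR_vector:
  assumes "L2_lim M f g" shows "L2_lim M (\<lambda>n \<omega>. f n \<omega> *\<^sub>R v) (\<lambda>\<omega>. (g \<omega> :: real) *\<^sub>R v)"
proof -
  have L: "\<And>n. L2 M (f n)" "L2 M g" and d: "(\<lambda>n. L2_dist M (f n) g) \<longlonglongrightarrow> 0"
    using assms unfolding L2_lim_def by auto
  have Lv: "L2 M (\<lambda>\<omega>. f \<omega> *\<^sub>R v)" if f: "L2 M f" for f :: "'a \<Rightarrow> real"
    using L2_measurable[OF f] L2_real_integrable[OF f] by (simp add: L2_def power_mult_distrib)
  have "L2_dist M (\<lambda>\<omega>. f n \<omega> *\<^sub>R v) (\<lambda>\<omega>. g \<omega> *\<^sub>R v) = L2_dist M (f n) g * (norm v)\<^sup>2" for n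
    unfolding L2_dist_def by (simp add: scaleR_diff_left[symmetric] power_mult_distrib del: scaleR_diff_left)
  moreover have "(\<lambda>n. L2_dist M (f n) g * (norm v)\<^sup>2) \<longlonglongrightarrow> 0 * (norm v)\<^sup>2"
    by (intro tendsto_intros d)
  ultimately show ?thesis by (simp add: L2_lim_def Lv L)
qed

lemma L2_lim_sum:
  "(\<And>i. i \<in> I \<Longrightarrow> L2_lim M (f i) (g i)) \<Longrightarrow> L2_lim M (\<lambda>n \<omega>. \<Sum>i\<in>I. f i n \<omega>) (\<lambda>\<omega>. \<Sum>i\<in>I. g i \<omega>)"
proof (induction I rule: infinite_finite_induct)
  case (insert i I)
  then show ?case using L2_lim_add[of M "f i" "g i" "\<lambda>n \<omega>. \<Sum>i\<in>I. f i n \<omega>" "\<lambda>\<omega>. \<Sum>i\<in>I. g i \<omega>"] by simp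
qed (auto intro: L2_lim_const L2_zero)

text \<open>
The Sobolev space and the derivative are defined by nonnegative integrals, where membership of the
limit in \<open>L\<^sup>2\<close> is a consequence of the convergence.
\<close>

lemma L2_lim_iff_nn_integral:
  assumes "\<And>n. L2 M (f n)"
  shows "L2_lim M f g \<longleftrightarrow> g \<in> borel_measurable M \<and>
    (\<lambda>n. \<integral>\<^sup>+\<omega>. ennreal ((norm (f n \<omega> - g \<omega>))\<^sup>2) \<partial>M) \<longlonglongrightarrow> 0"
proof
  assume "L2_lim M f g"
  then show "g \<in> borel_measurable M \<and> (\<lambda>n. \<integral>\<^sup>+\<omega>. ennreal ((norm (f n \<omega> - g \<omega>))\<^sup>2) \<partial>M) \<longlonglongrightarrow> 0"
    using tendsto_ennrealI[of "\<lambda>n. L2_dist M (f n) g" 0]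
    by (simp add: L2_lim_def L2_dist_nn_integral L2_measurable)
next
  assume R: "g \<in> borel_measurable M \<and> (\<lambda>n. \<integral>\<^sup>+\<omega>. ennreal ((norm (f n \<omega> - g \<omega>))\<^sup>2) \<partial>M) \<longlonglongrightarrow> 0"
  then have [measurable]: "g \<in> borel_measurable M" by simp
  have [measurable]: "f n \<in> borel_measurable M" for n using assms by (rule L2_measurable)
  have "\<forall>\<^sub>F n in sequentially. (\<integral>\<^sup>+\<omega>. ennreal ((norm (f n \<omega> - g \<omega>))\<^sup>2) \<partial>M) < 1"
    using R order_tendstoD(2)[of _ 0 sequentially "1::ennreal"] by simp
  then obtain n where n: "(\<integral>\<^sup>+\<omega>. ennreal ((norm (f n \<omega> - g \<omega>))\<^sup>2) \<partial>M) < 1"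
    by (auto simp: eventually_sequentially)
  then have "(\<integral>\<^sup>+\<omega>. ennreal (norm ((norm (f n \<omega> - g \<omega>))\<^sup>2)) \<partial>M) < \<infinity>"
    using order.strict_trans[OF n] by simp
  then have "integrable M (\<lambda>\<omega>. (norm (f n \<omega> - g \<omega>))\<^sup>2)"
    by (intro integrableI_bounded) auto
  then have "L2 M (\<lambda>\<omega>. f n \<omega> - g \<omega>)" by (simp add: L2_def)
  from L2_diff[OF assms[of n] this] have g: "L2 M g" by simp
  have "(\<lambda>n. ennreal (L2_dist M (f n) g)) \<longlonglongrightarrow> ennreal 0"
    using R by (simp add: L2_dist_nn_integral[OF assms g])
  then have "(\<lambda>n. L2_dist M (f n) g) \<longlonglongrightarrow> 0"
    by (subst (asm) tendsto_ennreal_iff) (auto simp: L2_dist_nonneg)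
  then show "L2_lim M f g" using assms g by (simp add: L2_lim_def)
qed

text \<open>
The Riesz--Fischer argument: a subsequence with rapidly decreasing increments is almost surely
Cauchy, and Fatou's lemma gives convergence in \<open>L\<^sup>2\<close> to its pointwise limit.
\<close>

lemma (in prob_space) L2_complete:
  fixes f :: "nat \<Rightarrow> 'a \<Rightarrow> 'b::{real_inner, complete_space, second_countable_topology}"
  assumes L: "\<And>n. L2 M (f n)"
    and Cauchy: "\<And>e. e > 0 \<Longrightarrow> \<exists>N. \<forall>m\<ge>N. \<forall>n\<ge>N. L2_dist M (f m) (f n) < e"
  obtains g where "L2_lim M f g"
proof -
  have [measurable]: "f n \<in> borel_measurable M" for n using L by (rule L2_measurable)
  have "\<forall>k. \<exists>N. \<forall>m\<ge>N. \<forall>n\<ge>N. L2_dist M (f m) (f n) < (1 / 4) ^ k" using Cauchy by simp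
  then obtain N where N: "\<And>k m n. N k \<le> m \<Longrightarrow> N k \<le> n \<Longrightarrow> L2_dist M (f m) (f n) < (1 / 4) ^ k" by metis
  \<comment> \<open>Indices that increase and stay beyond \<open>N k\<close>.\<close>
  define r where "r k = (\<Sum>j\<le>k. N j) + k" for k
  have rN: "N k \<le> r k" for k unfolding r_def using member_le_sum[of k "{..k}" N] by simp
  have rm: "r k \<le> r (Suc k)" for k unfolding r_def by simp
  have rk: "k \<le> r k" for k unfolding r_def by simp
  let ?d = "\<lambda>k \<omega>. norm (f (r (Suc k)) \<omega> - f (r k) \<omega>)"
  have d: "(\<integral>\<^sup>+\<omega>. ennreal (?d k \<omega>) \<partial>M) \<le> ennreal ((1 / 2) ^ k)" for k
  proof -
    have Ld: "L2 M (?d k)" by (intro L2_norm L2_diff L)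
    have one: "L2 M (\<lambda>_. 1 :: real)" by (simp add: L2_def)
    have "(\<integral>\<omega>. ?d k \<omega> * 1 \<partial>M) \<le> sqrt (\<integral>\<omega>. (?d k \<omega>)\<^sup>2 \<partial>M) * sqrt (\<integral>\<omega>. 1\<^sup>2 \<partial>M)"
      by (rule L2_Cauchy_Schwarz_real[OF Ld one]) auto
    also have "\<dots> = sqrt (L2_dist M (f (r (Suc k))) (f (r k)))"
      by (simp add: L2_dist_def prob_space)
    also have "\<dots> \<le> sqrt ((1 / 4) ^ k)"
      using N[of k "r (Suc k)" "r k"] rN[of k] rm[of k] by (intro real_sqrt_le_mono) simp
    also have "\<dots> = (1 / 2) ^ k"
      by (simp add: real_sqrt_power real_sqrt_divide)
    finally have "(\<integral>\<omega>. ?d k \<omega> \<partial>M) \<le> (1 / 2) ^ k" by simp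
    moreover have "integrable M (?d k)" using L2_mult_integrable[OF Ld one] by simp
    ultimately show ?thesis by (simp add: nn_integral_eq_integral ennreal_leI)
  qed
  have "(\<integral>\<^sup>+\<omega>. (\<Sum>k. ennreal (?d k \<omega>)) \<partial>M) = (\<Sum>k. \<integral>\<^sup>+\<omega>. ennreal (?d k \<omega>) \<partial>M)"
    by (rule nn_integral_suminf) simp
  also have "\<dots> \<le> (\<Sum>k. ennreal ((1 / 2) ^ k))" by (intro suminf_le d) auto
  also have "\<dots> = ennreal (\<Sum>k. (1 / 2) ^ k)"
    by (rule suminf_ennreal2) (auto intro: summable_geometric)
  also have "\<dots> < \<infinity>" by simp
  finally have "AE \<omega> in M. (\<Sum>k. ennreal (?d k \<omega>)) \<noteq> \<infinity>"
    by (intro nn_integral_noteq_infinite) auto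
  then have conv: "AE \<omega> in M. Cauchy (\<lambda>k. f (r k) \<omega>)"
  proof eventually_elim
    case (elim \<omega>)
    then have "summable (\<lambda>k. ?d k \<omega>)"
      by (intro summable_suminf_not_top) auto
    then have C: "Cauchy (\<lambda>n. \<Sum>k<n. ?d k \<omega>)"
      by (simp add: summable_iff_convergent convergent_Cauchy)
    have step: "dist (f (r m) \<omega>) (f (r n) \<omega>) \<le> dist (\<Sum>k<m. ?d k \<omega>) (\<Sum>k<n. ?d k \<omega>)" if "m \<le> n" for m n
      using that
    proof (induction n rule: dec_induct)
      case (step n)
      have mono: "(\<Sum>k<m. ?d k \<omega>) \<le> (\<Sum>k<n. ?d k \<omega>)"
        by (rule sum_mono2) (use step in auto)
      have "dist (f (r m) \<omega>) (f (r (Suc n)) \<omega>) \<le> dist (f (r m) \<omega>) (f (r n) \<omega>) + ?d n \<omega>"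
        using dist_triangle[of "f (r m) \<omega>" "f (r (Suc n)) \<omega>" "f (r n) \<omega>"]
        by (simp add: dist_norm norm_minus_commute)
      then show ?case using step.IH mono by (simp add: dist_real_def)
    qed simp
    show ?case
      unfolding Cauchy_altdef2
    proof (intro allI impI)
      fix e :: real assume "0 < e"
      then have "\<exists>N. \<forall>n\<ge>N. dist (\<Sum>k<n. ?d k \<omega>) (\<Sum>k<N. ?d k \<omega>) < e"
        using C unfolding Cauchy_altdef2 by simp
      then obtain N where N: "\<forall>n\<ge>N. dist (\<Sum>k<n. ?d k \<omega>) (\<Sum>k<N. ?d k \<omega>) < e" ..
      have "dist (f (r n) \<omega>) (f (r N) \<omega>) < e" if "N \<le> n" for n
        using step[OF that] N[rule_format, OF that] unfolding dist_commute[of "f (r n) \<omega>"]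
          dist_commute[of "\<Sum>k<n. ?d k \<omega>"] by (rule le_less_trans)
      then show "\<exists>N. \<forall>n\<ge>N. dist (f (r n) \<omega>) (f (r N) \<omega>) < e" by (intro exI allI impI)
    qed
  qed
  \<comment> \<open>Cut off to \<open>0\<close> where the subsequence diverges, so that the limit exists everywhere and is measurable.\<close>
  define h where "h k \<omega> = (if Cauchy (\<lambda>k. f (r k) \<omega>) then f (r k) \<omega> else 0)" for k \<omega>
  define g where "g \<omega> = lim (\<lambda>k. h k \<omega>)" for \<omega>
  have h: "(\<lambda>k. h k \<omega>) \<longlonglongrightarrow> g \<omega>" for \<omega>
  proof -
    have "convergent (\<lambda>k. h k \<omega>)"
      unfolding h_def by (cases "Cauchy (\<lambda>k. f (r k) \<omega>)") (auto intro: Cauchy_convergent convergent_const)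
    then show ?thesis unfolding g_def by (simp add: convergent_LIMSEQ_iff)
  qed
  have [measurable]: "g \<in> borel_measurable M"
  proof (rule borel_measurable_LIMSEQ_metric[OF _ h])
    show "h k \<in> borel_measurable M" for k unfolding h_def[abs_def] by measurable
  qed
  have glim: "AE \<omega> in M. (\<lambda>k. f (r k) \<omega>) \<longlonglongrightarrow> g \<omega>"
    using conv
  proof eventually_elim
    case (elim \<omega>)
    then show ?case using h[of \<omega>] by (simp add: h_def)
  qed
  have bound: "(\<integral>\<^sup>+\<omega>. ennreal ((norm (f n \<omega> - g \<omega>))\<^sup>2) \<partial>M) \<le> ennreal ((1 / 4) ^ k)" if "N k \<le> n" for n k
  proof -
    have "(\<integral>\<^sup>+\<omega>. ennreal ((norm (f n \<omega> - g \<omega>))\<^sup>2) \<partial>M) =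
        (\<integral>\<^sup>+\<omega>. liminf (\<lambda>j. ennreal ((norm (f n \<omega> - f (r j) \<omega>))\<^sup>2)) \<partial>M)"
    proof (rule nn_integral_cong_AE)
      show "AE \<omega> in M. ennreal ((norm (f n \<omega> - g \<omega>))\<^sup>2) = liminf (\<lambda>j. ennreal ((norm (f n \<omega> - f (r j) \<omega>))\<^sup>2))"
        using glim
      proof eventually_elim
        case (elim \<omega>)
        then have "(\<lambda>j. ennreal ((norm (f n \<omega> - f (r j) \<omega>))\<^sup>2)) \<longlonglongrightarrow> ennreal ((norm (f n \<omega> - g \<omega>))\<^sup>2)"
          by (intro tendsto_ennrealI tendsto_intros)
        then show ?case by (rule lim_imp_Liminf[OF sequentially_bot, symmetric])
      qed
    qed
    also have "\<dots> \<le> liminf (\<lambda>j. \<integral>\<^sup>+\<omega>. ennreal ((norm (f n \<omega> - f (r j) \<omega>))\<^sup>2) \<partial>M)"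
      by (rule nn_integral_liminf) simp
    also have "\<dots> \<le> ennreal ((1 / 4) ^ k)"
    proof (rule Liminf_le)
      show "\<forall>\<^sub>F j in sequentially. (\<integral>\<^sup>+\<omega>. ennreal ((norm (f n \<omega> - f (r j) \<omega>))\<^sup>2) \<partial>M) \<le> ennreal ((1 / 4) ^ k)"
        unfolding L2_dist_nn_integral[OF L L] eventually_sequentially
      proof (intro exI[of _ "N k"] allI impI ennreal_leI)
        fix j assume "N k \<le> j"
        then show "L2_dist M (f n) (f (r j)) \<le> (1 / 4) ^ k"
          using N[of k n "r j"] that rk[of j] by simp
      qed
    qed simp
    finally show ?thesis .
  qed
  have "(\<lambda>n. \<integral>\<^sup>+\<omega>. ennreal ((norm (f n \<omega> - g \<omega>))\<^sup>2) \<partial>M) \<longlonglongrightarrow> 0"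
  proof (rule order_tendstoI)
    fix a :: ennreal assume a: "0 < a"
    have "(\<lambda>k. ennreal ((1 / 4) ^ k)) \<longlonglongrightarrow> ennreal 0"
      by (intro tendsto_ennrealI LIMSEQ_realpow_zero) auto
    then have "\<forall>\<^sub>F k in sequentially. ennreal ((1 / 4) ^ k) < a"
      by (rule order_tendstoD(2)) (use a in simp)
    then obtain k where "ennreal ((1 / 4) ^ k) < a" by (auto simp: eventually_sequentially)
    then show "\<forall>\<^sub>F n in sequentially. (\<integral>\<^sup>+\<omega>. ennreal ((norm (f n \<omega> - g \<omega>))\<^sup>2) \<partial>M) < a"
      unfolding eventually_sequentially using bound by (auto intro!: exI[of _ "N k"] intro: le_less_trans)
  qed simp
  then have "L2_lim M f g" using L2_lim_iff_nn_integral[of M f g] L by simp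
  then show ?thesis by (rule that)
qed

context prob_space
begin

lemma L2_bounded:
  assumes "f \<in> borel_measurable M" "\<And>\<omega>. norm (f \<omega>) \<le> B"
  shows "L2 M f"
  by (rule L2_bound[OF assms(1), of "\<lambda>_. B\<^sup>2"]) (auto intro: power_mono assms(2))

lemma L2_imp_integrable: "L2 M f \<Longrightarrow> integrable M (f :: 'a \<Rightarrow> real)"
  using L2_mult_integrable[of M f "\<lambda>_. 1"] by (simp add: L2_def)

lemma L2_lim_bounded_convergence:
  assumes "\<And>n. f n \<in> borel_measurable M" "\<And>n \<omega>. \<bar>f n \<omega>\<bar> \<le> B" "\<And>\<omega>. (\<lambda>n. f n \<omega>) \<longlonglongrightarrow> (g \<omega> :: real)"
  shows "L2_lim M f g"
proof -
  have [measurable]: "g \<in> borel_measurable M"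
    by (rule borel_measurable_LIMSEQ_real[OF assms(3,1)])
  note [measurable] = assms(1)
  have gB: "\<bar>g \<omega>\<bar> \<le> B" for \<omega>
    by (rule LIMSEQ_le_const2[OF tendsto_rabs[OF assms(3)]]) (intro exI allI impI assms(2))
  have L: "L2 M (f n)" "L2 M g" for n
    using assms(2) gB by (auto intro!: L2_bounded[where B = B])
  have "(\<lambda>n. \<integral>\<omega>. (norm (f n \<omega> - g \<omega>))\<^sup>2 \<partial>M) \<longlonglongrightarrow> (\<integral>\<omega>. 0 \<partial>M)"
  proof (rule integral_dominated_convergence[where w = "\<lambda>_. (2 * B)\<^sup>2"])
    show "AE \<omega> in M. (\<lambda>n. (norm (f n \<omega> - g \<omega>))\<^sup>2) \<longlonglongrightarrow> 0"
    proof (rule AE_I2)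
      fix \<omega>
      have "(\<lambda>n. (norm (f n \<omega> - g \<omega>))\<^sup>2) \<longlonglongrightarrow> (norm (g \<omega> - g \<omega>))\<^sup>2"
        by (intro tendsto_intros assms(3))
      then show "(\<lambda>n. (norm (f n \<omega> - g \<omega>))\<^sup>2) \<longlonglongrightarrow> 0" by simp
    qed
    show "AE \<omega> in M. norm ((norm (f n \<omega> - g \<omega>))\<^sup>2) \<le> (2 * B)\<^sup>2" for n
    proof (rule AE_I2)
      fix \<omega>
      have "norm (f n \<omega> - g \<omega>) \<le> 2 * B"
        using abs_triangle_ineq4[of "f n \<omega>" "g \<omega>"] assms(2)[of n \<omega>] gB[of \<omega>] by simp
      from power_mono[OF this, of 2] show "norm ((norm (f n \<omega> - g \<omega>))\<^sup>2) \<le> (2 * B)\<^sup>2" by simp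
    qed
  qed auto
  then show ?thesis using L by (simp add: L2_lim_def L2_dist_def)
qed

text \<open>
Means, second moments and \<open>E \<parallel>Y\<parallel>\<^sup>2\<close> are continuous for convergence in \<open>L\<^sup>2\<close>.
\<close>

lemma poincare_limit:
  assumes "L2_lim M f g" "L2_lim M Y W"
    "\<And>n. expectation (\<lambda>\<omega>. (f n \<omega>)\<^sup>2) - (expectation (f n))\<^sup>2 \<le> expectation (\<lambda>\<omega>. (norm (Y n \<omega>))\<^sup>2)"
  shows "expectation (\<lambda>\<omega>. (g \<omega>)\<^sup>2) - (expectation g)\<^sup>2 \<le> expectation (\<lambda>\<omega>. (norm (W \<omega>))\<^sup>2)"
proof (rule LIMSEQ_le)
  have one: "L2_lim M (\<lambda>_ _. 1 :: real) (\<lambda>_. 1)" by (rule L2_lim_const) (simp add: L2_def)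
  have "(\<lambda>n. expectation (\<lambda>\<omega>. f n \<omega> \<bullet> f n \<omega>) - (expectation (\<lambda>\<omega>. f n \<omega> \<bullet> 1))\<^sup>2) \<longlonglongrightarrow>
      expectation (\<lambda>\<omega>. g \<omega> \<bullet> g \<omega>) - (expectation (\<lambda>\<omega>. g \<omega> \<bullet> 1))\<^sup>2"
    by (intro tendsto_diff tendsto_power L2_lim_inner assms(1) one)
  then show "(\<lambda>n. expectation (\<lambda>\<omega>. (f n \<omega>)\<^sup>2) - (expectation (f n))\<^sup>2) \<longlonglongrightarrow>
      expectation (\<lambda>\<omega>. (g \<omega>)\<^sup>2) - (expectation g)\<^sup>2" by (simp add: power2_eq_square)
  show "(\<lambda>n. expectation (\<lambda>\<omega>. (norm (Y n \<omega>))\<^sup>2)) \<longlonglongrightarrow> expectation (\<lambda>\<omega>. (norm (W \<omega>))\<^sup>2)"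
    using L2_lim_inner[OF assms(2,2)] by (simp add: power2_norm_eq_inner)
qed (use assms(3) in blast)

end

text \<open>
Split \<open>a n f n - \<alpha> g = a n (f n - g) + (a n - \<alpha>) g\<close>; the first part is small because \<open>a n\<close> is bounded, the
second by dominated convergence.
\<close>

lemma (in prob_space) L2_lim_mult_bounded:
  assumes f: "L2_lim M f g"
    and a: "\<And>n. a n \<in> borel_measurable M" "\<And>n \<omega>. \<bar>a n \<omega>\<bar> \<le> B"
    and \<alpha>: "\<alpha> \<in> borel_measurable M" "\<And>\<omega>. \<bar>\<alpha> \<omega>\<bar> \<le> B" "AE \<omega> in M. (\<lambda>n. a n \<omega>) \<longlonglongrightarrow> (\<alpha> \<omega> :: real)"
  shows "L2_lim M (\<lambda>n \<omega>. a n \<omega> *\<^sub>R f n \<omega>) (\<lambda>\<omega>. \<alpha> \<omega> *\<^sub>R g \<omega>)"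
proof -
  have L: "\<And>n. L2 M (f n)" "L2 M g" and d: "(\<lambda>n. L2_dist M (f n) g) \<longlonglongrightarrow> 0"
    using f unfolding L2_lim_def by auto
  note [measurable] = a(1) \<alpha>(1) L2_measurable[OF L(1)] L2_measurable[OF L(2)]
  have Laf: "L2 M (\<lambda>\<omega>. a n \<omega> *\<^sub>R f n \<omega>)" "L2 M (\<lambda>\<omega>. a n \<omega> *\<^sub>R g \<omega>)" "L2 M (\<lambda>\<omega>. \<alpha> \<omega> *\<^sub>R g \<omega>)" for n
    by (rule L2_mult_bounded[OF L(1) a] L2_mult_bounded[OF L(2) a] L2_mult_bounded[OF L(2) \<alpha>(1,2)])+
  have 1: "L2_dist M (\<lambda>\<omega>. a n \<omega> *\<^sub>R f n \<omega>) (\<lambda>\<omega>. a n \<omega> *\<^sub>R g \<omega>) \<le> B\<^sup>2 * L2_dist M (f n) g" for n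
  proof -
    have "L2_dist M (\<lambda>\<omega>. a n \<omega> *\<^sub>R f n \<omega>) (\<lambda>\<omega>. a n \<omega> *\<^sub>R g \<omega>) \<le> (\<integral>\<omega>. B\<^sup>2 * (norm (f n \<omega> - g \<omega>))\<^sup>2 \<partial>M)"
      unfolding L2_dist_def
    proof (rule integral_mono)
      show "integrable M (\<lambda>\<omega>. (norm (a n \<omega> *\<^sub>R f n \<omega> - a n \<omega> *\<^sub>R g \<omega>))\<^sup>2)"
        by (rule L2_integrable[OF L2_diff[OF Laf(1,2)]])
      show "integrable M (\<lambda>\<omega>. B\<^sup>2 * (norm (f n \<omega> - g \<omega>))\<^sup>2)"
        by (rule integrable_mult_right[OF L2_integrable[OF L2_diff[OF L]]])
      show "(norm (a n \<omega> *\<^sub>R f n \<omega> - a n \<omega> *\<^sub>R g \<omega>))\<^sup>2 \<le> B\<^sup>2 * (norm (f n \<omega> - g \<omega>))\<^sup>2" for \<omega>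
        using power_mono[OF a(2)[of n \<omega>] abs_ge_zero, of 2]
        by (simp add: scaleR_diff_right[symmetric] power_mult_distrib mult_right_mono del: scaleR_diff_right)
    qed
    then show ?thesis by (simp add: L2_dist_def)
  qed
  have 2: "(\<lambda>n. L2_dist M (\<lambda>\<omega>. a n \<omega> *\<^sub>R g \<omega>) (\<lambda>\<omega>. \<alpha> \<omega> *\<^sub>R g \<omega>)) \<longlonglongrightarrow> (\<integral>\<omega>. 0 \<partial>M)"
    unfolding L2_dist_def
  proof (rule integral_dominated_convergence[where w = "\<lambda>\<omega>. (2 * B)\<^sup>2 * (norm (g \<omega>))\<^sup>2"])
    show "integrable M (\<lambda>\<omega>. (2 * B)\<^sup>2 * (norm (g \<omega>))\<^sup>2)" by (rule integrable_mult_right[OF L2_integrable[OF L(2)]])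
    show "AE \<omega> in M. (\<lambda>n. (norm (a n \<omega> *\<^sub>R g \<omega> - \<alpha> \<omega> *\<^sub>R g \<omega>))\<^sup>2) \<longlonglongrightarrow> 0"
      using \<alpha>(3)
    proof eventually_elim
      case (elim \<omega>)
      have "(\<lambda>n. (norm (a n \<omega> *\<^sub>R g \<omega> - \<alpha> \<omega> *\<^sub>R g \<omega>))\<^sup>2) \<longlonglongrightarrow> (norm (\<alpha> \<omega> *\<^sub>R g \<omega> - \<alpha> \<omega> *\<^sub>R g \<omega>))\<^sup>2"
        by (intro tendsto_intros elim)
      then show ?case by simp
    qed
    show "AE \<omega> in M. norm ((norm (a n \<omega> *\<^sub>R g \<omega> - \<alpha> \<omega> *\<^sub>R g \<omega>))\<^sup>2) \<le> (2 * B)\<^sup>2 * (norm (g \<omega>))\<^sup>2" for n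
    proof (rule AE_I2)
      fix \<omega>
      have "\<bar>a n \<omega> - \<alpha> \<omega>\<bar> \<le> 2 * B"
        using abs_triangle_ineq4[of "a n \<omega>" "\<alpha> \<omega>"] a(2)[of n \<omega>] \<alpha>(2)[of \<omega>] by simp
      from power_mono[OF this abs_ge_zero, of 2]
      show "norm ((norm (a n \<omega> *\<^sub>R g \<omega> - \<alpha> \<omega> *\<^sub>R g \<omega>))\<^sup>2) \<le> (2 * B)\<^sup>2 * (norm (g \<omega>))\<^sup>2"
        by (simp add: scaleR_diff_left[symmetric] power_mult_distrib mult_right_mono del: scaleR_diff_left)
    qed
  qed simp_all
  have "(\<lambda>n. 2 * (B\<^sup>2 * L2_dist M (f n) g) + 2 * L2_dist M (\<lambda>\<omega>. a n \<omega> *\<^sub>R g \<omega>) (\<lambda>\<omega>. \<alpha> \<omega> *\<^sub>R g \<omega>)) \<longlonglongrightarrow> 2 * (B\<^sup>2 * 0) + 2 * (\<integral>\<omega>. 0 \<partial>M)"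
    by (intro tendsto_intros d 2)
  then have lim: "(\<lambda>n. 2 * (B\<^sup>2 * L2_dist M (f n) g) + 2 * L2_dist M (\<lambda>\<omega>. a n \<omega> *\<^sub>R g \<omega>) (\<lambda>\<omega>. \<alpha> \<omega> *\<^sub>R g \<omega>)) \<longlonglongrightarrow> 0" by simp
  have le: "L2_dist M (\<lambda>\<omega>. a n \<omega> *\<^sub>R f n \<omega>) (\<lambda>\<omega>. \<alpha> \<omega> *\<^sub>R g \<omega>) \<le>
      2 * (B\<^sup>2 * L2_dist M (f n) g) + 2 * L2_dist M (\<lambda>\<omega>. a n \<omega> *\<^sub>R g \<omega>) (\<lambda>\<omega>. \<alpha> \<omega> *\<^sub>R g \<omega>)" for n
    using L2_dist_triangle[OF Laf(1)[of n] Laf(2)[of n] Laf(3)] 1[of n] by linarith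
  from null_sequence_dominated[OF L2_dist_nonneg le lim] show ?thesis
    using Laf by (simp add: L2_lim_def)
qed

text \<open>
The representing \<open>V\<close> is the \<open>L\<^sup>2\<close>-limit, perhaps outside \<open>S\<close>, of a minimising sequence for
\<open>E G\<^sup>2 - 2 l G\<close>. Such a sequence is Cauchy by the parallelogram law, and the vanishing of the first
variation at the limit is the claim.
\<close>

lemma (in prob_space) L2_riesz:
  fixes S :: "('a \<Rightarrow> real) set" and l :: "('a \<Rightarrow> real) \<Rightarrow> real"
  assumes L: "\<And>G. G \<in> S \<Longrightarrow> L2 M G" and zero: "(\<lambda>_. 0) \<in> S"
    and lin: "\<And>G H a b. G \<in> S \<Longrightarrow> H \<in> S \<Longrightarrow> (\<lambda>\<omega>. a * G \<omega> + b * H \<omega>) \<in> S"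
      "\<And>G H a b. G \<in> S \<Longrightarrow> H \<in> S \<Longrightarrow> l (\<lambda>\<omega>. a * G \<omega> + b * H \<omega>) = a * l G + b * l H"
    and bound: "\<And>G. G \<in> S \<Longrightarrow> \<bar>l G\<bar> \<le> c * sqrt (expectation (\<lambda>\<omega>. (G \<omega>)\<^sup>2))"
  obtains V where "L2 M V" "\<And>G. G \<in> S \<Longrightarrow> expectation (\<lambda>\<omega>. G \<omega> * V \<omega>) = l G"
proof -
  define Q where "Q G = expectation (\<lambda>\<omega>. (G \<omega>)\<^sup>2)" for G :: "'a \<Rightarrow> real"
  define B where "B G H = expectation (\<lambda>\<omega>. G \<omega> * H \<omega>)" for G H :: "'a \<Rightarrow> real"
  define J where "J G = Q G - 2 * l G" for G
  have Q0: "0 \<le> Q G" for G unfolding Q_def by (rule Bochner_Integration.integral_nonneg) simp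
  have Qlin: "Q (\<lambda>\<omega>. a * G \<omega> + b * H \<omega>) = a\<^sup>2 * Q G + 2 * a * b * B G H + b\<^sup>2 * Q H"
    if "L2 M G" "L2 M H" for a b G H
  proof -
    have "(a * G \<omega> + b * H \<omega>)\<^sup>2 = a\<^sup>2 * (G \<omega>)\<^sup>2 + 2 * a * b * (G \<omega> * H \<omega>) + b\<^sup>2 * (H \<omega>)\<^sup>2" for \<omega>
      by (simp add: power2_eq_square algebra_simps)
    then show ?thesis unfolding Q_def B_def
      using L2_real_integrable[OF that(1)] L2_real_integrable[OF that(2)] L2_mult_integrable[OF that] by simp
  qed
  have Jlow: "- c\<^sup>2 \<le> J G" if "G \<in> S" for G
  proof -
    have "J G \<ge> (sqrt (Q G))\<^sup>2 - 2 * (c * sqrt (Q G))"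
      using bound[OF that] Q0[of G] unfolding J_def Q_def by simp
    moreover have "0 \<le> (sqrt (Q G) - c)\<^sup>2" by simp
    ultimately show ?thesis by (simp add: power2_diff mult_ac)
  qed
  define m where "m = Inf (J ` S)"
  have bdd: "bdd_below (J ` S)" by (rule bdd_belowI2[OF Jlow])
  have mle: "m \<le> J G" if "G \<in> S" for G unfolding m_def by (rule cINF_lower[OF bdd that])
  have "\<exists>G\<in>S. J G < m + 1 / real (Suc n)" for n
    using cInf_lessD[of "J ` S" "m + 1 / real (Suc n)"] zero unfolding m_def by auto
  then obtain G where GS: "\<And>n. G n \<in> S" and GJ: "\<And>n. J (G n) < m + 1 / real (Suc n)" by metis
  have LG: "L2 M (G n)" for n by (rule L[OF GS])
  have par: "L2_dist M (G n) (G k) \<le> 2 / real (Suc n) + 2 / real (Suc k)" for n k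
  proof -
    let ?A = "\<lambda>\<omega>. (1/2) * G n \<omega> + (1/2) * G k \<omega>"
    have "L2_dist M (G n) (G k) = Q (\<lambda>\<omega>. 1 * G n \<omega> + (-1) * G k \<omega>)"
      by (simp add: L2_dist_def Q_def)
    also have "\<dots> = Q (G n) - 2 * B (G n) (G k) + Q (G k)"
      unfolding Qlin[OF LG LG] by simp
    also have "\<dots> = 2 * J (G n) + 2 * J (G k) - 4 * J ?A"
      unfolding J_def Qlin[OF LG LG] lin(2)[OF GS GS] by (simp add: power2_eq_square field_simps)
    also have "\<dots> \<le> 2 * J (G n) + 2 * J (G k) - 4 * m" using mle[OF lin(1)[OF GS GS], of "1/2" n "1/2" k] by linarith
    also have "\<dots> \<le> 2 * (1 / real (Suc n)) + 2 * (1 / real (Suc k))" using GJ[of n] GJ[of k] by linarith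
    finally show ?thesis by simp
  qed
  obtain V where V: "L2_lim M G V"
  proof (rule L2_complete[OF LG])
    fix e :: real assume "e > 0"
    then obtain N :: nat where N: "4 / e < real N" using reals_Archimedean2 by blast
    have "L2_dist M (G n) (G k) < e" if "N \<le> n" "N \<le> k" for n k
    proof -
      have "4 / e < real (Suc n)" "4 / e < real (Suc k)" using N that by auto
      then have "4 / real (Suc n) < e" "4 / real (Suc k) < e"
        using \<open>e > 0\<close> by (simp_all add: pos_divide_less_eq mult.commute del: of_nat_Suc)
      then show ?thesis using par[of n k] by simp
    qed
    then show "\<exists>N. \<forall>n\<ge>N. \<forall>k\<ge>N. L2_dist M (G n) (G k) < e" by (intro exI allI impI)
  qed (rule that)
  have LV: "L2 M V" using V by (simp add: L2_lim_def)
  have "B H V = l H" if H: "H \<in> S" for H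
  proof -
    have Bl: "(\<lambda>n. B (G n) H) \<longlonglongrightarrow> B V H"
      using L2_lim_inner[OF V L2_lim_const[OF L[OF H]]] by (simp add: B_def)
    have q: "0 \<le> 2 * t * (B V H - l H) + t\<^sup>2 * Q H" for t
    proof -
      have z: "(\<lambda>n. 1 / real (Suc n) + 2 * t * (B (G n) H - l H) + t\<^sup>2 * Q H) \<longlonglongrightarrow> 0 + 2 * t * (B V H - l H) + t\<^sup>2 * Q H"
        by (intro tendsto_intros LIMSEQ_Suc[OF lim_1_over_n] Bl)
      have "0 \<le> 1 / real (Suc n) + 2 * t * (B (G n) H - l H) + t\<^sup>2 * Q H" for n
      proof -
        have "m \<le> J (\<lambda>\<omega>. 1 * G n \<omega> + t * H \<omega>)" by (rule mle[OF lin(1)[OF GS H]])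
        also have "\<dots> = J (G n) + 2 * t * (B (G n) H - l H) + t\<^sup>2 * Q H"
          unfolding J_def Qlin[OF LG L[OF H]] lin(2)[OF GS H] by (simp add: algebra_simps)
        finally show ?thesis using GJ[of n] by simp
      qed
      then have "0 \<le> 0 + 2 * t * (B V H - l H) + t\<^sup>2 * Q H"
        by (intro LIMSEQ_le_const[OF z]) blast
      then show ?thesis by simp
    qed
    have "B V H - l H = 0"
    proof (rule ccontr)
      define D where "D = B V H - l H"
      assume "B V H - l H \<noteq> 0"
      then have D: "D \<noteq> 0" by (simp add: D_def)
      \<comment> \<open>The step \<open>t = - e\<close> makes the quadratic negative; the summand \<open>1\<close> covers \<open>Q H = 0\<close>.\<close>
      define e where "e = D / (Q H + 1)"
      have p: "Q H + 1 > 0" using Q0[of H] by simp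
      have De: "D = e * (Q H + 1)" using p by (simp add: e_def)
      then have e: "e \<noteq> 0" using D by auto
      have "2 * (- e) * D + (- e)\<^sup>2 * Q H = e\<^sup>2 * (Q H - 2 * (Q H + 1))"
        unfolding De by (simp add: power2_eq_square algebra_simps)
      also have "\<dots> < 0" using e Q0[of H] by (intro mult_pos_neg) auto
      finally show False using q[of "- e"] by (simp add: D_def)
    qed
    then show ?thesis by (simp add: B_def mult.commute)
  qed
  then show ?thesis using that[OF LV] by (simp add: B_def)
qed

lemma (in prob_space) expectation_mult_tendsto:
  fixes a :: "nat \<Rightarrow> 'a \<Rightarrow> real"
  assumes Y: "integrable M Y" and m: "\<And>n. a n \<in> borel_measurable M" and b: "\<And>n \<omega>. \<bar>a n \<omega>\<bar> \<le> B"
    and l: "\<And>\<omega>. (\<lambda>n. a n \<omega>) \<longlonglongrightarrow> \<alpha> \<omega>"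
  shows "(\<lambda>n. expectation (\<lambda>\<omega>. a n \<omega> * Y \<omega>)) \<longlonglongrightarrow> expectation (\<lambda>\<omega>. \<alpha> \<omega> * Y \<omega>)"
proof (rule integral_dominated_convergence[where w = "\<lambda>\<omega>. B * \<bar>Y \<omega>\<bar>"])
  have [measurable]: "Y \<in> borel_measurable M" using Y by auto
  have "\<alpha> \<in> borel_measurable M" by (rule borel_measurable_LIMSEQ_real[OF l m])
  then show "(\<lambda>\<omega>. \<alpha> \<omega> * Y \<omega>) \<in> borel_measurable M" by simp
  show "(\<lambda>\<omega>. a n \<omega> * Y \<omega>) \<in> borel_measurable M" for n using m by simp
  show "integrable M (\<lambda>\<omega>. B * \<bar>Y \<omega>\<bar>)" using Y by auto
  show "AE \<omega> in M. (\<lambda>n. a n \<omega> * Y \<omega>) \<longlonglongrightarrow> \<alpha> \<omega> * Y \<omega>"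
    by (intro AE_I2 tendsto_mult tendsto_const l)
  show "AE \<omega> in M. norm (a n \<omega> * Y \<omega>) \<le> B * \<bar>Y \<omega>\<bar>" for n
    by (intro AE_I2) (simp add: abs_mult mult_right_mono b)
qed

section \<open>Integration by parts and the Poincare inequality for cylinders\<close>

context isonormal_process
begin

lemma X_L2: "L2 M (X \<phi>)"
  using X_square_integrable[of \<phi>] by (simp add: L2_def)

lemma cyl_fun_measurable:
  assumes "Cb_infinity n f" shows "(\<lambda>\<omega>. f (\<lambda>i. X (\<phi> i) \<omega>)) \<in> borel_measurable M"
proof -
  have "(\<lambda>\<omega> i. X (\<phi> i) \<omega>) \<in> borel_measurable M"
    by (rule measurable_coordinatewise_then_product) simp
  from measurable_compose[OF this borel_measurable_continuous_onI[OF Cb_infinity_continuous[OF assms]]]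
  show ?thesis .
qed

lemma cyl_rv_measurable: "smooth_cylinder C \<Longrightarrow> cyl_rv X C \<in> borel_measurable M"
  by (cases C) (simp add: smooth_cylinder_def cyl_rv_def cyl_fun_measurable)

lemma cyl_rv_bounded: "smooth_cylinder C \<Longrightarrow> \<exists>B. \<forall>\<omega>. \<bar>cyl_rv X C \<omega>\<bar> \<le> B"
proof -
  assume C: "smooth_cylinder C"
  obtain n f \<phi> where nf: "C = (n, f, \<phi>)" by (cases C)
  obtain B where "\<forall>x. \<bar>f x\<bar> \<le> B"
    using Cb_infinity_bounded[of n f] C by (auto simp: nf smooth_cylinder_def)
  then show ?thesis by (intro exI[of _ B]) (simp add: nf cyl_rv_def)
qed

lemma cyl_rv_L2: "smooth_cylinder C \<Longrightarrow> L2 M (cyl_rv X C)"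
  using cyl_rv_bounded[of C] L2_bounded[OF cyl_rv_measurable[of C]] by auto

lemma cyl_grad_measurable: "smooth_cylinder C \<Longrightarrow> cyl_grad X C \<in> borel_measurable M"
  by (cases C) (auto simp: smooth_cylinder_def cyl_grad_def intro!: borel_measurable_sum
      borel_measurable_scaleR cyl_fun_measurable Cb_infinity_partial)

lemma cyl_grad_bounded:
  assumes "smooth_cylinder C" shows "\<exists>B. \<forall>\<omega>. norm (cyl_grad X C \<omega>) \<le> B"
proof -
  obtain n f \<phi> where C: "C = (n, f, \<phi>)" by (cases C)
  have f: "Cb_infinity n f" using assms by (simp add: C smooth_cylinder_def)
  obtain B where B: "B \<ge> 0" "\<And>x. \<bar>f x\<bar> \<le> B" "\<And>i x. i < n \<Longrightarrow> \<bar>partial i f x\<bar> \<le> B"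
    by (rule Cb_infinity_bounds[OF f]) (rule that)
  have "norm (cyl_grad X C \<omega>) \<le> (\<Sum>i<n. B * norm (\<phi> i))" for \<omega>
    unfolding C cyl_grad_def prod.case
    by (rule order_trans[OF norm_sum], rule sum_mono) (simp add: B(3) mult_right_mono)
  then show ?thesis by (intro exI allI)
qed

lemma cyl_grad_L2: "smooth_cylinder C \<Longrightarrow> L2 M (cyl_grad X C)"
  using cyl_grad_bounded[of C] L2_bounded[OF cyl_grad_measurable[of C]] by auto

lemma C1_limit_L2:
  assumes "C1_limit n f g" "\<And>m. Cb_infinity n (f m)"
  shows "L2_lim M (\<lambda>m. cyl_rv X (n, f m, \<phi>)) (cyl_rv X (n, g, \<phi>))"
    and "L2_lim M (\<lambda>m. cyl_grad X (n, f m, \<phi>)) (cyl_grad X (n, g, \<phi>))"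
proof -
  obtain B where B: "\<And>m x. \<bar>f m x\<bar> \<le> B" "\<And>m i x. i < n \<Longrightarrow> \<bar>partial i (f m) x\<bar> \<le> B"
    using assms(1) unfolding C1_limit_def by blast
  have l: "\<And>x. (\<lambda>m. f m x) \<longlonglongrightarrow> g x" "\<And>i x. i < n \<Longrightarrow> (\<lambda>m. partial i (f m) x) \<longlonglongrightarrow> partial i g x"
    using assms(1) unfolding C1_limit_def by blast+
  show "L2_lim M (\<lambda>m. cyl_rv X (n, f m, \<phi>)) (cyl_rv X (n, g, \<phi>))"
    unfolding cyl_rv_def prod.case
    by (rule L2_lim_bounded_convergence[OF cyl_fun_measurable[OF assms(2)] B(1) l(1)])
  show "L2_lim M (\<lambda>m. cyl_grad X (n, f m, \<phi>)) (cyl_grad X (n, g, \<phi>))"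
    unfolding cyl_grad_def prod.case
  proof (rule L2_lim_sum, rule L2_lim_scaleR_vector)
    fix i assume "i \<in> {..<n}"
    then have i: "i < n" by simp
    show "L2_lim M (\<lambda>m \<omega>. partial i (f m) (\<lambda>j. X (\<phi> j) \<omega>)) (\<lambda>\<omega>. partial i g (\<lambda>j. X (\<phi> j) \<omega>))"
      by (rule L2_lim_bounded_convergence[OF cyl_fun_measurable[OF Cb_infinity_partial[OF assms(2) i]] B(2)[OF i] l(2)[OF i]])
  qed
qed

lemma wave_AE:
  fixes n :: nat
  shows "AE \<omega> in M. (\<Sum>j<n. t j * X (\<phi> j) \<omega>) = X (\<Sum>j<n. t j *\<^sub>R \<phi> j) \<omega>"
  using X_linear_sum[of t \<phi> n] by eventually_elim simp

lemma cyl_grad_wave: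
  "cyl_grad X (n, \<lambda>x. c * cos ((\<Sum>j<n. t j * x j) + b), \<phi>) \<omega> =
    (- (c * sin ((\<Sum>j<n. t j * X (\<phi> j) \<omega>) + b))) *\<^sub>R (\<Sum>j<n. t j *\<^sub>R \<phi> j)"
proof -
  have "partial i (\<lambda>x. c * cos ((\<Sum>j<n. t j * x j) + b)) x = - (c * sin ((\<Sum>j<n. t j * x j) + b)) * t i"
    if "i < n" for i x
  proof -
    have "has_partial i (\<lambda>x. c * cos ((\<Sum>j<n. t j * x j) + b)) (\<lambda>x. - (c * sin ((\<Sum>j<n. t j * x j) + b)) * t i)"
      by (rule has_partial_chain[OF has_partial_linear[OF that]]) (auto intro!: derivative_eq_intros)
    from has_partial_imp_partial[OF this] show ?thesis by simp
  qed
  then show ?thesis by (simp add: cyl_grad_def scaleR_sum_right)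
qed

text \<open>
Both sides are linear in the cylinder and continuous under \<open>C1_limit\<close>, so plane waves suffice; there
the claim is \<open>expectation_X_cos\<close>.
\<close>

lemma integration_by_parts:
  assumes "smooth_cylinder C"
  shows "expectation (\<lambda>\<omega>. cyl_rv X C \<omega> * X h \<omega>) = expectation (\<lambda>\<omega>. cyl_grad X C \<omega> \<bullet> h)"
proof -
  obtain n f \<phi> where C: "C = (n, f, \<phi>)" by (cases C)
  have f: "Cb_infinity n f" using assms by (simp add: C smooth_cylinder_def)
  from Cb_infinity_imp_wave_closure[OF f]
  have "expectation (\<lambda>\<omega>. cyl_rv X (n, f, \<phi>) \<omega> * X h \<omega>) = expectation (\<lambda>\<omega>. cyl_grad X (n, f, \<phi>) \<omega> \<bullet> h)"
  proof (induction rule: wave_closure.induct)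
    case (wave c t b)
    let ?\<psi> = "\<Sum>j<n. t j *\<^sub>R \<phi> j"
    have "expectation (\<lambda>\<omega>. cyl_rv X (n, \<lambda>x. c * cos ((\<Sum>j<n. t j * x j) + b), \<phi>) \<omega> * X h \<omega>) =
        expectation (\<lambda>\<omega>. c * (X h \<omega> * cos (X ?\<psi> \<omega> + b)))"
    proof (rule integral_cong_AE)
      show "AE \<omega> in M. cyl_rv X (n, \<lambda>x. c * cos ((\<Sum>j<n. t j * x j) + b), \<phi>) \<omega> * X h \<omega> =
          c * (X h \<omega> * cos (X ?\<psi> \<omega> + b))"
        using wave_AE[where t = t and \<phi> = \<phi> and n = n] by eventually_elim (simp add: cyl_rv_def)
    qed (simp_all add: cyl_rv_def)
    also have "\<dots> = expectation (\<lambda>\<omega>. (- (c * sin (X ?\<psi> \<omega> + b))) * (?\<psi> \<bullet> h))"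
      by (simp add: expectation_X_cos)
    also have "\<dots> = expectation (\<lambda>\<omega>. cyl_grad X (n, \<lambda>x. c * cos ((\<Sum>j<n. t j * x j) + b), \<phi>) \<omega> \<bullet> h)"
    proof (rule integral_cong_AE)
      show "AE \<omega> in M. (- (c * sin (X ?\<psi> \<omega> + b))) * (?\<psi> \<bullet> h) =
          cyl_grad X (n, \<lambda>x. c * cos ((\<Sum>j<n. t j * x j) + b), \<phi>) \<omega> \<bullet> h"
        using wave_AE[where t = t and \<phi> = \<phi> and n = n]
        by eventually_elim (simp only: cyl_grad_wave inner_scaleR_left)
    qed (simp_all add: cyl_grad_wave)
    finally show ?case .
  next
    case (add f g)
    note Cf = wave_closure_Cb_infinity[OF add.hyps(1)] and Cg = wave_closure_Cb_infinity[OF add.hyps(2)]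
    have sm: "smooth_cylinder (n, f, \<phi>)" "smooth_cylinder (n, g, \<phi>)"
      using Cf Cg by (simp_all add: smooth_cylinder_def)
    have gr: "cyl_grad X (n, \<lambda>x. f x + g x, \<phi>) \<omega> = cyl_grad X (n, f, \<phi>) \<omega> + cyl_grad X (n, g, \<phi>) \<omega>" for \<omega>
      by (simp add: cyl_grad_def partial_add[OF Cf Cg] scaleR_add_left sum.distrib)
    have rv: "cyl_rv X (n, \<lambda>x. f x + g x, \<phi>) \<omega> = cyl_rv X (n, f, \<phi>) \<omega> + cyl_rv X (n, g, \<phi>) \<omega>" for \<omega>
      by (simp add: cyl_rv_def)
    show ?case
      unfolding gr rv distrib_right inner_add_left
      by (simp add: add.IH L2_mult_integrable[OF cyl_rv_L2 X_L2] L2_imp_integrable[OF L2_inner_const[OF cyl_grad_L2]] sm)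
  next
    case (limit f g)
    note Cf = wave_closure_Cb_infinity[OF limit.hyps(1)]
    have 1: "(\<lambda>m. expectation (\<lambda>\<omega>. cyl_rv X (n, f m, \<phi>) \<omega> * X h \<omega>)) \<longlonglongrightarrow>
        expectation (\<lambda>\<omega>. cyl_rv X (n, g, \<phi>) \<omega> * X h \<omega>)"
      using L2_lim_inner[OF C1_limit_L2(1)[OF limit.hyps(2) Cf] L2_lim_const[OF X_L2]] by simp
    have one: "L2_lim M (\<lambda>_ _. 1 :: real) (\<lambda>_. 1)" by (rule L2_lim_const) (simp add: L2_def)
    have "(\<lambda>m. expectation (\<lambda>\<omega>. cyl_grad X (n, f m, \<phi>) \<omega> \<bullet> h)) \<longlonglongrightarrow>
        expectation (\<lambda>\<omega>. cyl_grad X (n, g, \<phi>) \<omega> \<bullet> h)"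
      using L2_lim_inner[OF L2_lim_inner_const[OF C1_limit_L2(2)[OF limit.hyps(2) Cf]] one] by simp
    then show ?case unfolding limit.IH[symmetric] by (rule LIMSEQ_unique[OF 1])
  qed
  then show ?thesis by (simp add: C)
qed

end

context isonormal_process
begin

lemma cyl_rv_add: "cyl_rv X (n, \<lambda>x. f x + g x, \<phi>) = (\<lambda>\<omega>. cyl_rv X (n, f, \<phi>) \<omega> + cyl_rv X (n, g, \<phi>) \<omega>)"
  by (simp add: cyl_rv_def)

lemma cyl_grad_add:
  assumes "Cb_infinity n f" "Cb_infinity n g"
  shows "cyl_grad X (n, \<lambda>x. f x + g x, \<phi>) = (\<lambda>\<omega>. cyl_grad X (n, f, \<phi>) \<omega> + cyl_grad X (n, g, \<phi>) \<omega>)"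
  by (rule ext) (simp add: cyl_grad_def partial_add[OF assms] scaleR_add_left sum.distrib)

text \<open>
Lists of amplitude, frequency and phase: sums of functions are concatenations, and positions in
the list serve as indices for \<open>poincare_trig\<close>.
\<close>

definition wave_sum :: "nat \<Rightarrow> (real \<times> (nat \<Rightarrow> real) \<times> real) list \<Rightarrow> (nat \<Rightarrow> real) \<Rightarrow> real" where
  "wave_sum n L x = (\<Sum>(c, t, b)\<leftarrow>L. c * cos ((\<Sum>j<n. t j * x j) + b))"

lemma wave_sum_Cons: "wave_sum n ((c, t, b) # L) = (\<lambda>x. c * cos ((\<Sum>j<n. t j * x j) + b) + wave_sum n L x)"
  by (rule ext) (simp add: wave_sum_def)

lemma wave_sum_append: "wave_sum n (L @ L') = (\<lambda>x. wave_sum n L x + wave_sum n L' x)"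
  by (rule ext) (simp add: wave_sum_def)

lemma Cb_infinity_wave_sum: "Cb_infinity n (wave_sum n L)"
proof (induction L)
  case Nil
  have "wave_sum n [] = (\<lambda>_. 0)" by (rule ext) (simp add: wave_sum_def)
  then show ?case by (simp add: Cb_infinity_const)
next
  case (Cons w L)
  obtain c t b where w: "w = (c, t, b)" by (cases w)
  show ?case unfolding w wave_sum_Cons
    by (rule Cb_infinity_add[OF Cb_infinity_wave Cons])
qed

lemma poincare_wave_sum:
  "expectation (\<lambda>\<omega>. (cyl_rv X (n, wave_sum n L, \<phi>) \<omega>)\<^sup>2) - (expectation (cyl_rv X (n, wave_sum n L, \<phi>)))\<^sup>2
    \<le> expectation (\<lambda>\<omega>. (norm (cyl_grad X (n, wave_sum n L, \<phi>) \<omega>))\<^sup>2)"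
proof -
  define a t b where "a k = fst (L ! k)" and "t k = fst (snd (L ! k))" and "b k = snd (snd (L ! k))" for k
  define \<psi> where "\<psi> k = (\<Sum>j<n. t k j *\<^sub>R \<phi> j)" for k
  let ?I = "{..<length L}" and ?C = "(n, wave_sum n L, \<phi>)"
  have sm: "smooth_cylinder ?C" by (simp add: smooth_cylinder_def Cb_infinity_wave_sum)
  have rv: "cyl_rv X ?C \<omega> = (\<Sum>k\<in>?I. a k * cos ((\<Sum>j<n. t k j * X (\<phi> j) \<omega>) + b k))" for \<omega>
    by (simp add: cyl_rv_def wave_sum_def sum_list_sum_nth atLeast0LessThan a_def t_def b_def case_prod_beta)
  have grL: "cyl_grad X ?C \<omega> = (\<Sum>(c, t, b)\<leftarrow>L. (- (c * sin ((\<Sum>j<n. t j * X (\<phi> j) \<omega>) + b))) *\<^sub>R (\<Sum>j<n. t j *\<^sub>R \<phi> j))" for \<omega>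
  proof (induction L)
    case Nil
    have "wave_sum n [] = (\<lambda>_. 0)" by (rule ext) (simp add: wave_sum_def)
    moreover have "partial i (\<lambda>_. 0) = (\<lambda>_. 0)" for i
      by (rule has_partial_imp_partial[OF has_partial_const])
    ultimately show ?case by (simp add: cyl_grad_def)
  next
    case (Cons w L)
    obtain c t b where w: "w = (c, t, b)" by (cases w)
    show ?case
      unfolding w wave_sum_Cons cyl_grad_add[OF Cb_infinity_wave Cb_infinity_wave_sum] cyl_grad_wave Cons
      by simp
  qed
  have gr: "cyl_grad X ?C \<omega> = - (\<Sum>k\<in>?I. (a k * sin ((\<Sum>j<n. t k j * X (\<phi> j) \<omega>) + b k)) *\<^sub>R \<psi> k)" for \<omega>
    unfolding grL
    by (simp add: sum_list_sum_nth atLeast0LessThan a_def t_def b_def \<psi>_def case_prod_beta sum_negf)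
  have AE: "AE \<omega> in M. \<forall>k\<in>?I. (\<Sum>j<n. t k j * X (\<phi> j) \<omega>) = X (\<psi> k) \<omega>"
    unfolding \<psi>_def by (intro AE_finite_allI wave_AE) simp
  have [measurable]: "cyl_rv X ?C \<in> borel_measurable M" "cyl_grad X ?C \<in> borel_measurable M"
    using cyl_rv_measurable[OF sm] cyl_grad_measurable[OF sm] .
  have 1: "expectation (\<lambda>\<omega>. (cyl_rv X ?C \<omega>)\<^sup>2) = expectation (\<lambda>\<omega>. (\<Sum>k\<in>?I. a k * cos (X (\<psi> k) \<omega> + b k))\<^sup>2)"
    by (rule integral_cong_AE) (use AE in \<open>auto simp: rv elim!: eventually_mono\<close>)
  have 2: "expectation (cyl_rv X ?C) = expectation (\<lambda>\<omega>. \<Sum>k\<in>?I. a k * cos (X (\<psi> k) \<omega> + b k))"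
    by (rule integral_cong_AE) (use AE in \<open>auto simp: rv elim!: eventually_mono\<close>)
  have 3: "expectation (\<lambda>\<omega>. (norm (cyl_grad X ?C \<omega>))\<^sup>2) =
      expectation (\<lambda>\<omega>. (norm (\<Sum>k\<in>?I. (a k * sin (X (\<psi> k) \<omega> + b k)) *\<^sub>R \<psi> k))\<^sup>2)"
    by (rule integral_cong_AE) (use AE in \<open>auto simp: gr elim!: eventually_mono\<close>)
  show ?thesis unfolding 1 2 3 by (rule poincare_trig) simp
qed

text \<open>
The Poincare inequality is not linear in the variable, so the induction over \<open>wave_closure\<close> has to
produce approximations; the inequality is passed on afterwards.
\<close>

lemma wave_sum_dense:
  assumes "wave_closure n f" "\<epsilon> > 0"
  shows "\<exists>L. L2_dist M (cyl_rv X (n, wave_sum n L, \<phi>)) (cyl_rv X (n, f, \<phi>)) < \<epsilon> \<and>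
    L2_dist M (cyl_grad X (n, wave_sum n L, \<phi>)) (cyl_grad X (n, f, \<phi>)) < \<epsilon>"
  using assms
proof (induction arbitrary: \<epsilon> rule: wave_closure.induct)
  case (wave c t b)
  have "wave_sum n [(c, t, b)] = (\<lambda>x. c * cos ((\<Sum>j<n. t j * x j) + b))"
    by (rule ext) (simp add: wave_sum_def)
  then show ?case using wave by (intro exI[of _ "[(c, t, b)]"]) (simp add: L2_dist_def)
next
  case (add f g)
  note Cf = wave_closure_Cb_infinity[OF add.hyps(1)] and Cg = wave_closure_Cb_infinity[OF add.hyps(2)]
  have e: "0 < \<epsilon> / 4" using add.prems by simp
  obtain L where L: "L2_dist M (cyl_rv X (n, wave_sum n L, \<phi>)) (cyl_rv X (n, f, \<phi>)) < \<epsilon> / 4"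
    "L2_dist M (cyl_grad X (n, wave_sum n L, \<phi>)) (cyl_grad X (n, f, \<phi>)) < \<epsilon> / 4" using add.IH(1)[OF e] by blast
  obtain L' where L': "L2_dist M (cyl_rv X (n, wave_sum n L', \<phi>)) (cyl_rv X (n, g, \<phi>)) < \<epsilon> / 4"
    "L2_dist M (cyl_grad X (n, wave_sum n L', \<phi>)) (cyl_grad X (n, g, \<phi>)) < \<epsilon> / 4" using add.IH(2)[OF e] by blast
  have sm: "smooth_cylinder (n, f, \<phi>)" "smooth_cylinder (n, g, \<phi>)" "smooth_cylinder (n, wave_sum n L, \<phi>)"
    "smooth_cylinder (n, wave_sum n L', \<phi>)"
    using Cf Cg by (simp_all add: smooth_cylinder_def Cb_infinity_wave_sum)
  note G = cyl_grad_add[OF Cf Cg] cyl_grad_add[OF Cb_infinity_wave_sum Cb_infinity_wave_sum]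
  have "L2_dist M (cyl_rv X (n, wave_sum n (L @ L'), \<phi>)) (cyl_rv X (n, \<lambda>x. f x + g x, \<phi>)) < \<epsilon>"
    using L2_dist_add[OF sm(3,1,4,2)[THEN cyl_rv_L2]] L(1) L'(1)
    unfolding wave_sum_append cyl_rv_add by linarith
  moreover have "L2_dist M (cyl_grad X (n, wave_sum n (L @ L'), \<phi>)) (cyl_grad X (n, \<lambda>x. f x + g x, \<phi>)) < \<epsilon>"
    using L2_dist_add[OF sm(3,1,4,2)[THEN cyl_grad_L2]] L(2) L'(2)
    unfolding wave_sum_append G by linarith
  ultimately show ?case by (intro exI conjI)
next
  case (limit f g)
  note Cf = wave_closure_Cb_infinity[OF limit.hyps(1)]
  have e: "0 < \<epsilon> / 4" using limit.prems by simp
  have l: "L2_lim M (\<lambda>m. cyl_rv X (n, f m, \<phi>)) (cyl_rv X (n, g, \<phi>))"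
    "L2_lim M (\<lambda>m. cyl_grad X (n, f m, \<phi>)) (cyl_grad X (n, g, \<phi>))"
    by (rule C1_limit_L2[OF limit.hyps(2) Cf])+
  have "\<forall>\<^sub>F m in sequentially. L2_dist M (cyl_rv X (n, f m, \<phi>)) (cyl_rv X (n, g, \<phi>)) < \<epsilon> / 4 \<and>
      L2_dist M (cyl_grad X (n, f m, \<phi>)) (cyl_grad X (n, g, \<phi>)) < \<epsilon> / 4"
    using l e unfolding L2_lim_def by (intro eventually_conj order_tendstoD(2)[of _ 0]) auto
  then obtain m where m: "L2_dist M (cyl_rv X (n, f m, \<phi>)) (cyl_rv X (n, g, \<phi>)) < \<epsilon> / 4"
      "L2_dist M (cyl_grad X (n, f m, \<phi>)) (cyl_grad X (n, g, \<phi>)) < \<epsilon> / 4"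
    by (auto simp: eventually_sequentially)
  obtain L where L: "L2_dist M (cyl_rv X (n, wave_sum n L, \<phi>)) (cyl_rv X (n, f m, \<phi>)) < \<epsilon> / 4"
    "L2_dist M (cyl_grad X (n, wave_sum n L, \<phi>)) (cyl_grad X (n, f m, \<phi>)) < \<epsilon> / 4" using limit.IH[OF e] by blast
  have sm: "smooth_cylinder (n, f m, \<phi>)" "smooth_cylinder (n, g, \<phi>)" "smooth_cylinder (n, wave_sum n L, \<phi>)"
    using Cf limit.hyps(3) by (simp_all add: smooth_cylinder_def Cb_infinity_wave_sum)
  show ?case
    using L2_dist_triangle[OF sm(3,1,2)[THEN cyl_rv_L2]] L2_dist_triangle[OF sm(3,1,2)[THEN cyl_grad_L2]] L m
    by (intro exI[of _ L] conjI) linarith+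
qed

lemma poincare_cylinder:
  assumes "smooth_cylinder C"
  shows "expectation (\<lambda>\<omega>. (cyl_rv X C \<omega>)\<^sup>2) - (expectation (cyl_rv X C))\<^sup>2
    \<le> expectation (\<lambda>\<omega>. (norm (cyl_grad X C \<omega>))\<^sup>2)"
proof -
  obtain n f \<phi> where C: "C = (n, f, \<phi>)" by (cases C)
  have f: "Cb_infinity n f" using assms by (simp add: C smooth_cylinder_def)
  have "\<forall>m. \<exists>L. L2_dist M (cyl_rv X (n, wave_sum n L, \<phi>)) (cyl_rv X (n, f, \<phi>)) < 1 / real (Suc m) \<and>
    L2_dist M (cyl_grad X (n, wave_sum n L, \<phi>)) (cyl_grad X (n, f, \<phi>)) < 1 / real (Suc m)"
    by (intro allI wave_sum_dense Cb_infinity_imp_wave_closure f) simp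
  then obtain L where L: "\<And>m. L2_dist M (cyl_rv X (n, wave_sum n (L m), \<phi>)) (cyl_rv X (n, f, \<phi>)) < 1 / real (Suc m)"
    "\<And>m. L2_dist M (cyl_grad X (n, wave_sum n (L m), \<phi>)) (cyl_grad X (n, f, \<phi>)) < 1 / real (Suc m)" by metis
  have sm: "smooth_cylinder (n, f, \<phi>)" "\<And>m. smooth_cylinder (n, wave_sum n (L m), \<phi>)"
    using f by (simp_all add: smooth_cylinder_def Cb_infinity_wave_sum)
  have z: "(\<lambda>m. 1 / real (Suc m)) \<longlonglongrightarrow> 0" by (rule LIMSEQ_Suc[OF lim_1_over_n])
  have 1: "L2_lim M (\<lambda>m. cyl_rv X (n, wave_sum n (L m), \<phi>)) (cyl_rv X (n, f, \<phi>))"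
    unfolding L2_lim_def
    using null_sequence_dominated[OF L2_dist_nonneg less_imp_le[OF L(1)] z] sm by (simp add: cyl_rv_L2)
  have 2: "L2_lim M (\<lambda>m. cyl_grad X (n, wave_sum n (L m), \<phi>)) (cyl_grad X (n, f, \<phi>))"
    unfolding L2_lim_def
    using null_sequence_dominated[OF L2_dist_nonneg less_imp_le[OF L(2)] z] sm by (simp add: cyl_grad_L2)
  show ?thesis unfolding C by (rule poincare_limit[OF 1 2 poincare_wave_sum])
qed

section \<open>Random variables orthogonal to all plane waves\<close>

text \<open>
Orthogonality of \<open>Y * W\<close> to all waves, unlike the single equation \<open>E (Y * W) = 0\<close>, is preserved when \<open>W\<close>
is multiplied by a wave. So \<open>W\<close> can be built up, one factor and one limit at a time, to the indicator
of a cylinder set.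
\<close>

definition annihilates :: "('a \<Rightarrow> real) \<Rightarrow> ('a \<Rightarrow> real) \<Rightarrow> bool" where
  "annihilates Y W \<longleftrightarrow> W \<in> borel_measurable M \<and> (\<exists>B. \<forall>\<omega>. \<bar>W \<omega>\<bar> \<le> B) \<and>
     (\<forall>\<psi> b. expectation (\<lambda>\<omega>. Y \<omega> * W \<omega> * cos (X \<psi> \<omega> + b)) = 0)"

lemma annihilatesI:
  assumes "W \<in> borel_measurable M" "\<And>\<omega>. \<bar>W \<omega>\<bar> \<le> B"
    "\<And>\<psi> b. expectation (\<lambda>\<omega>. Y \<omega> * W \<omega> * cos (X \<psi> \<omega> + b)) = 0"
  shows "annihilates Y W"
  unfolding annihilates_def using assms by (intro conjI allI exI[of _ B]) simp_all

lemma integrable_mult_bounded: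
  assumes "integrable M Y" "W \<in> borel_measurable M" "\<And>\<omega>. \<bar>W \<omega>\<bar> \<le> B"
  shows "integrable M (\<lambda>\<omega>. Y \<omega> * W \<omega> :: real)"
proof (rule Bochner_Integration.integrable_bound)
  show "integrable M (\<lambda>\<omega>. B * Y \<omega>)" using assms(1) by simp
  show "(\<lambda>\<omega>. Y \<omega> * W \<omega>) \<in> borel_measurable M" using assms(1,2) by simp
  have "0 \<le> B" using order_trans[OF abs_ge_zero assms(3)] .
  then show "AE \<omega> in M. norm (Y \<omega> * W \<omega>) \<le> norm (B * Y \<omega>)"
    using assms(3) by (simp add: abs_mult mult.commute mult_right_mono)
qed

lemma annihilates_cos:
  assumes Y: "integrable M Y" and W: "annihilates Y W"
  shows "annihilates Y (\<lambda>\<omega>. W \<omega> * cos (c * X \<phi> \<omega> + d))"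
proof -
  have [measurable]: "Y \<in> borel_measurable M" "W \<in> borel_measurable M" using Y W by (auto simp: annihilates_def)
  obtain B where B: "\<And>\<omega>. \<bar>W \<omega>\<bar> \<le> B" using W by (auto simp: annihilates_def)
  have B0: "0 \<le> B" using order_trans[OF abs_ge_zero B] .
  have Wc: "\<bar>W \<omega> * cos z\<bar> \<le> B" for \<omega> z
    using mult_mono[OF B abs_cos_le_one B0 abs_ge_zero] by (simp add: abs_mult)
  have "expectation (\<lambda>\<omega>. Y \<omega> * (W \<omega> * cos (c * X \<phi> \<omega> + d)) * cos (X \<psi> \<omega> + b)) = 0" for \<psi> b
  proof -
    let ?p = "1 *\<^sub>R \<psi> + c *\<^sub>R \<phi>" and ?m = "1 *\<^sub>R \<psi> + (- c) *\<^sub>R \<phi>"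
    have int: "integrable M (\<lambda>\<omega>. Y \<omega> * (W \<omega> * cos (X \<theta> \<omega> + e)))" for \<theta> e
      by (rule integrable_mult_bounded[OF Y _ Wc]) simp
    have "expectation (\<lambda>\<omega>. Y \<omega> * (W \<omega> * cos (c * X \<phi> \<omega> + d)) * cos (X \<psi> \<omega> + b)) =
        expectation (\<lambda>\<omega>. (Y \<omega> * (W \<omega> * cos (X ?m \<omega> + (b - d))) + Y \<omega> * (W \<omega> * cos (X ?p \<omega> + (b + d)))) / 2)"
    proof (rule integral_cong_AE)
      show "AE \<omega> in M. Y \<omega> * (W \<omega> * cos (c * X \<phi> \<omega> + d)) * cos (X \<psi> \<omega> + b) =
        (Y \<omega> * (W \<omega> * cos (X ?m \<omega> + (b - d))) + Y \<omega> * (W \<omega> * cos (X ?p \<omega> + (b + d)))) / 2"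
        using X_linear[of 1 \<psi> c \<phi>] X_linear[of 1 \<psi> "- c" \<phi>]
      proof eventually_elim
        case (elim \<omega>)
        have "cos (X \<psi> \<omega> + b) * cos (c * X \<phi> \<omega> + d) = (cos (X ?m \<omega> + (b - d)) + cos (X ?p \<omega> + (b + d))) / 2"
          unfolding elim cos_times_cos by (simp add: algebra_simps)
        then have "Y \<omega> * W \<omega> * (cos (X \<psi> \<omega> + b) * cos (c * X \<phi> \<omega> + d)) =
            Y \<omega> * W \<omega> * ((cos (X ?m \<omega> + (b - d)) + cos (X ?p \<omega> + (b + d))) / 2)" by (simp only:)
        then show ?case by (simp add: algebra_simps del: scaleR_one)
      qed
    qed auto
    also have "\<dots> = 0"
      using W int unfolding annihilates_def by (simp add: mult.assoc del: scaleR_one)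
    finally show ?thesis .
  qed
  then show ?thesis by (rule annihilatesI[OF _ Wc, rotated]) simp
qed

lemma annihilates_add:
  assumes Y: "integrable M Y" and "annihilates Y V" "annihilates Y W"
  shows "annihilates Y (\<lambda>\<omega>. V \<omega> + W \<omega>)"
proof -
  have [measurable]: "Y \<in> borel_measurable M" "V \<in> borel_measurable M" "W \<in> borel_measurable M"
    using assms by (auto simp: annihilates_def)
  obtain A B where AB: "\<And>\<omega>. \<bar>V \<omega>\<bar> \<le> A" "\<And>\<omega>. \<bar>W \<omega>\<bar> \<le> B" using assms by (auto simp: annihilates_def)
  have "\<bar>V \<omega> + W \<omega>\<bar> \<le> A + B" for \<omega> by (rule order_trans[OF abs_triangle_ineq add_mono[OF AB]])
  moreover have "expectation (\<lambda>\<omega>. Y \<omega> * (V \<omega> + W \<omega>) * cos (X \<psi> \<omega> + b)) = 0" for \<psi> b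
  proof -
    have "integrable M (\<lambda>\<omega>. Y \<omega> * V \<omega>)" "integrable M (\<lambda>\<omega>. Y \<omega> * W \<omega>)"
      by (rule integrable_mult_bounded[OF Y _ AB(1)] integrable_mult_bounded[OF Y _ AB(2)]; simp)+
    from this[THEN integrable_mult_bounded[where W = "\<lambda>\<omega>. cos (X \<psi> \<omega> + b)" and B = 1]]
    have "integrable M (\<lambda>\<omega>. Y \<omega> * V \<omega> * cos (X \<psi> \<omega> + b))" "integrable M (\<lambda>\<omega>. Y \<omega> * W \<omega> * cos (X \<psi> \<omega> + b))"
      by simp_all
    then show ?thesis using assms(2,3) unfolding annihilates_def
      by (simp add: distrib_left distrib_right)
  qed
  ultimately show ?thesis by (auto simp: annihilates_def)
qed

lemma annihilates_trig:
  assumes Y: "integrable M Y" and a: "trig_fun a"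
  shows "annihilates Y W \<Longrightarrow> annihilates Y (\<lambda>\<omega>. W \<omega> * a (X \<phi> \<omega>))"
  using a
proof (induction arbitrary: W)
  case (const c)
  obtain B where B: "\<And>\<omega>. \<bar>W \<omega>\<bar> \<le> B" using const by (auto simp: annihilates_def)
  have "\<bar>W \<omega> * c\<bar> \<le> B * \<bar>c\<bar>" for \<omega> using mult_right_mono[OF B] by (simp add: abs_mult)
  moreover have "expectation (\<lambda>\<omega>. Y \<omega> * (W \<omega> * c) * cos (X \<psi> \<omega> + b)) = 0" for \<psi> b
  proof -
    have "expectation (\<lambda>\<omega>. Y \<omega> * (W \<omega> * c) * cos (X \<psi> \<omega> + b)) =
        expectation (\<lambda>\<omega>. c * (Y \<omega> * W \<omega> * cos (X \<psi> \<omega> + b)))" by (simp add: mult_ac)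
    then show ?thesis using const by (simp add: annihilates_def)
  qed
  ultimately show ?case using const by (auto simp: annihilates_def)
next
  case (sin c)
  show ?case using annihilates_cos[OF Y sin, of c \<phi> "- (pi / 2)"] by (simp add: cos_diff)
next
  case (cos c)
  show ?case using annihilates_cos[OF Y cos, of c \<phi> 0] by simp
next
  case (add a b)
  show ?case using annihilates_add[OF Y add.IH(1)[OF add.prems] add.IH(2)[OF add.prems]]
    by (simp add: distrib_left)
next
  case (mult a b)
  show ?case using mult.IH(2)[OF mult.IH(1)[OF mult.prems]] by (simp add: mult.assoc)
qed

lemma annihilates_limit:
  assumes Y: "integrable M Y" and W: "\<And>n. annihilates Y (W n)" "\<And>n \<omega>. \<bar>W n \<omega>\<bar> \<le> B" "\<And>\<omega>. (\<lambda>n. W n \<omega>) \<longlonglongrightarrow> V \<omega>"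
  shows "annihilates Y V"
proof -
  have Wm [measurable]: "W n \<in> borel_measurable M" for n using W(1) by (auto simp: annihilates_def)
  have [measurable]: "Y \<in> borel_measurable M" using Y by auto
  have Vm [measurable]: "V \<in> borel_measurable M" by (rule borel_measurable_LIMSEQ_real[OF W(3) Wm])
  have VB: "\<bar>V \<omega>\<bar> \<le> B" for \<omega>
    by (rule LIMSEQ_le_const2[OF tendsto_rabs[OF W(3)]]) (intro exI allI impI W(2))
  have "expectation (\<lambda>\<omega>. Y \<omega> * V \<omega> * cos (X \<psi> \<omega> + b)) = 0" for \<psi> b
  proof -
    have "(\<lambda>n. expectation (\<lambda>\<omega>. Y \<omega> * W n \<omega> * cos (X \<psi> \<omega> + b))) \<longlonglongrightarrow>
        expectation (\<lambda>\<omega>. Y \<omega> * V \<omega> * cos (X \<psi> \<omega> + b))"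
    proof (rule integral_dominated_convergence[where w = "\<lambda>\<omega>. B * \<bar>Y \<omega>\<bar>"])
      show "integrable M (\<lambda>\<omega>. B * \<bar>Y \<omega>\<bar>)" using Y by auto
      show "AE \<omega> in M. (\<lambda>n. Y \<omega> * W n \<omega> * cos (X \<psi> \<omega> + b)) \<longlonglongrightarrow> Y \<omega> * V \<omega> * cos (X \<psi> \<omega> + b)"
        by (intro AE_I2 tendsto_intros W(3))
      show "AE \<omega> in M. norm (Y \<omega> * W n \<omega> * cos (X \<psi> \<omega> + b)) \<le> B * \<bar>Y \<omega>\<bar>" for n
      proof (rule AE_I2)
        fix \<omega>
        have "\<bar>W n \<omega>\<bar> * \<bar>cos (X \<psi> \<omega> + b)\<bar> \<le> B * 1"
          by (intro mult_mono W(2) abs_cos_le_one order_trans[OF abs_ge_zero W(2)] abs_ge_zero)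
        from mult_left_mono[OF this abs_ge_zero[of "Y \<omega>"]]
        show "norm (Y \<omega> * W n \<omega> * cos (X \<psi> \<omega> + b)) \<le> B * \<bar>Y \<omega>\<bar>" by (simp add: abs_mult mult_ac)
      qed
    qed auto
    moreover have "expectation (\<lambda>\<omega>. Y \<omega> * W n \<omega> * cos (X \<psi> \<omega> + b)) = 0" for n
      using W(1) by (auto simp: annihilates_def)
    ultimately show ?thesis by (simp add: LIMSEQ_const_iff)
  qed
  then show ?thesis using VB by (auto simp: annihilates_def)
qed

text \<open>
Bernstein sums in a sine approximate \<open>a\<close> folded by \<open>K sin (x/K)\<close>, and then \<open>K \<rightarrow> \<infinity>\<close>.
\<close>

lemma annihilates_continuous:
  assumes Y: "integrable M Y" and W: "annihilates Y W" and a: "continuous_on UNIV a" "\<And>x. \<bar>a x\<bar> \<le> A"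
  shows "annihilates Y (\<lambda>\<omega>. W \<omega> * a (X \<phi> \<omega>))"
proof -
  obtain B where B: "\<And>\<omega>. \<bar>W \<omega>\<bar> \<le> B" using W by (auto simp: annihilates_def)
  have A0: "0 \<le> A" using order_trans[OF abs_ge_zero a(2)] .
  have B0: "0 \<le> B" using order_trans[OF abs_ge_zero B] .
  have WA: "\<bar>W \<omega> * z\<bar> \<le> B * A" if "\<bar>z\<bar> \<le> A" for \<omega> z
    unfolding abs_mult by (intro mult_mono B that B0 abs_ge_zero)
  have folded: "annihilates Y (\<lambda>\<omega>. W \<omega> * a (K * sin (X \<phi> \<omega> / K)))" if K: "K > 0" for K
  proof (rule annihilates_limit[OF Y])
    show "annihilates Y (\<lambda>\<omega>. W \<omega> * bernstein_sine K N a (X \<phi> \<omega>))" for N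
      by (rule annihilates_trig[OF Y trig_fun_bernstein_sine W])
    show "\<bar>W \<omega> * bernstein_sine K N a (X \<phi> \<omega>)\<bar> \<le> B * A" for N \<omega>
      by (rule WA[OF bernstein_sine_bound[OF a(2)]])
    show "(\<lambda>N. W \<omega> * bernstein_sine K N a (X \<phi> \<omega>)) \<longlonglongrightarrow> W \<omega> * a (K * sin (X \<phi> \<omega> / K))" for \<omega>
      by (rule tendsto_mult[OF tendsto_const bernstein_sine_tendsto[OF a(1)]])
  qed
  show ?thesis
  proof (rule annihilates_limit[OF Y])
    show "annihilates Y (\<lambda>\<omega>. W \<omega> * a (real (Suc m) * sin (X \<phi> \<omega> / real (Suc m))))" for m
      by (rule folded) simp
    show "\<bar>W \<omega> * a (real (Suc m) * sin (X \<phi> \<omega> / real (Suc m)))\<bar> \<le> B * A" for m \<omega>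
      by (rule WA[OF a(2)])
    show "(\<lambda>m. W \<omega> * a (real (Suc m) * sin (X \<phi> \<omega> / real (Suc m)))) \<longlonglongrightarrow> W \<omega> * a (X \<phi> \<omega>)" for \<omega>
    proof (rule tendsto_mult[OF tendsto_const])
      have "isCont a (X \<phi> \<omega>)" using a(1) continuous_on_eq_continuous_at[of UNIV a] by auto
      from isCont_tendsto_compose[OF this scaled_sin_tendsto]
      show "(\<lambda>m. a (real (Suc m) * sin (X \<phi> \<omega> / real (Suc m)))) \<longlonglongrightarrow> a (X \<phi> \<omega>)" .
    qed
  qed
qed

text \<open>
The indicator of a half line is a bounded limit of steepening ramps.
\<close>

lemma annihilates_greater:
  assumes Y: "integrable M Y" and W: "annihilates Y W"
  shows "annihilates Y (\<lambda>\<omega>. W \<omega> * indicator {c<..} (X \<phi> \<omega>))"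
proof -
  obtain B where B: "\<And>\<omega>. \<bar>W \<omega>\<bar> \<le> B" using W by (auto simp: annihilates_def)
  have B0: "0 \<le> B" using order_trans[OF abs_ge_zero B] .
  let ?a = "\<lambda>m x. min 1 (max 0 (real m * (x - c)))"
  show ?thesis
  proof (rule annihilates_limit[OF Y])
    show "annihilates Y (\<lambda>\<omega>. W \<omega> * ?a m (X \<phi> \<omega>))" for m
      by (rule annihilates_continuous[OF Y W, where A = 1]) (auto intro!: continuous_intros)
    show "\<bar>W \<omega> * ?a m (X \<phi> \<omega>)\<bar> \<le> B * 1" for m \<omega>
      unfolding abs_mult by (intro mult_mono B B0) auto
    show "(\<lambda>m. W \<omega> * ?a m (X \<phi> \<omega>)) \<longlonglongrightarrow> W \<omega> * indicator {c<..} (X \<phi> \<omega>)" for \<omega>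
    proof (rule tendsto_mult[OF tendsto_const], cases "X \<phi> \<omega> > c")
      case True
      obtain N :: nat where N: "1 / (X \<phi> \<omega> - c) < real N" using reals_Archimedean2 by blast
      have "?a m (X \<phi> \<omega>) = 1" if "N \<le> m" for m
      proof -
        have "1 / (X \<phi> \<omega> - c) < real m" using N that by simp
        then have "1 < real m * (X \<phi> \<omega> - c)" using True by (simp add: pos_divide_less_eq)
        then show ?thesis by simp
      qed
      then have "\<forall>\<^sub>F m in sequentially. ?a m (X \<phi> \<omega>) = 1" unfolding eventually_sequentially by blast
      then show "(\<lambda>m. ?a m (X \<phi> \<omega>)) \<longlonglongrightarrow> indicator {c<..} (X \<phi> \<omega>)"
        using True by (simp add: tendsto_eventually)
    next
      case False
      then have "?a m (X \<phi> \<omega>) = 0" for m by (simp add: mult_nonneg_nonpos)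
      then show "(\<lambda>m. ?a m (X \<phi> \<omega>)) \<longlonglongrightarrow> indicator {c<..} (X \<phi> \<omega>)" using False by simp
    qed
  qed
qed

definition cyl_set :: "('h \<times> real) list \<Rightarrow> 'a set" where
  "cyl_set L = {\<omega> \<in> space M. \<forall>(\<phi>, c)\<in>set L. c < X \<phi> \<omega>}"

lemma cyl_set_measurable [measurable]: "cyl_set L \<in> sets M"
proof (induction L)
  case (Cons w L)
  obtain \<phi> c where w: "w = (\<phi>, c)" by (cases w)
  have "cyl_set (w # L) = {\<omega> \<in> space M. c < X \<phi> \<omega>} \<inter> cyl_set L"
    by (auto simp: w cyl_set_def)
  then show ?case using Cons by simp
qed (simp add: cyl_set_def)

lemma sets_eq_cyl_sets: "sets M = sigma_sets (space M) (range cyl_set)"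
proof
  show "sigma_sets (space M) (range cyl_set) \<subseteq> sets M"
    by (intro sets.sigma_sets_subset) auto
  let ?N = "sigma (space M) (range cyl_set)"
  have sub: "range cyl_set \<subseteq> Pow (space M)" by (auto simp: cyl_set_def)
  have "X \<phi> \<in> borel_measurable ?N" for \<phi>
  proof (rule borel_measurableI_greater)
    fix c
    have "{\<omega> \<in> space ?N. c < X \<phi> \<omega>} = cyl_set [(\<phi>, c)]"
      unfolding space_measure_of[OF sub] by (simp add: cyl_set_def)
    then show "{\<omega> \<in> space ?N. c < X \<phi> \<omega>} \<in> sets ?N"
      by (auto simp: sets_measure_of[OF sub])
  qed
  then have "X \<phi> -` B \<inter> space M \<in> sets ?N" if "B \<in> sets borel" for \<phi> B
    using measurable_sets[OF _ that, of "X \<phi>" ?N] by (simp add: space_measure_of[OF sub])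
  then have "sigma_sets (space M) {X \<phi> -` B \<inter> space M |\<phi> B. B \<in> sets borel} \<subseteq> sets ?N"
    using sets.sigma_sets_subset[of "{X \<phi> -` B \<inter> space M |\<phi> B. B \<in> sets borel}" ?N]
    by (auto simp: space_measure_of[OF sub])
  then show "sets M \<subseteq> sigma_sets (space M) (range cyl_set)"
    unfolding generated by (simp add: sets_measure_of[OF sub])
qed

text \<open>
The cylinder sets form an intersection-stable generator because the \<open>\<sigma>\<close>-algebra is generated by \<open>X\<close>;
Dynkin's argument extends \<open>E (Y 1\<^sub>A) = 0\<close> from them to all events.
\<close>

lemma orthogonal_to_waves_imp_zero:
  assumes Y: "integrable M Y"
    and zero: "\<And>\<psi> b. expectation (\<lambda>\<omega>. Y \<omega> * cos (X \<psi> \<omega> + b)) = 0"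
  shows "AE \<omega> in M. Y \<omega> = 0"
proof -
  have [measurable]: "Y \<in> borel_measurable M" using Y by auto
  have one: "annihilates Y (\<lambda>_. 1)" using zero by (auto simp: annihilates_def)
  have ind: "annihilates Y (\<lambda>\<omega>. \<Prod>(\<phi>, c)\<leftarrow>L. indicator {c<..} (X \<phi> \<omega>))" for L
  proof (induction L)
    case Nil then show ?case using one by simp
  next
    case (Cons w L)
    obtain \<phi> c where w: "w = (\<phi>, c)" by (cases w)
    show ?case using annihilates_greater[OF Y Cons, of c \<phi>] by (simp add: w mult.commute)
  qed
  have prod: "(\<Prod>(\<phi>, c)\<leftarrow>L. indicator {c<..} (X \<phi> \<omega>)) = (indicator (cyl_set L) \<omega> :: real)" if "\<omega> \<in> space M" for L \<omega>
    by (induction L) (use that in \<open>auto simp: cyl_set_def indicator_def split: if_splits\<close>)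
  have cyl: "expectation (\<lambda>\<omega>. Y \<omega> * indicator (cyl_set L) \<omega>) = 0" for L
  proof -
    have X0: "AE \<omega> in M. X 0 \<omega> = 0" using X_linear[of 0 0 0 0] by simp
    have "expectation (\<lambda>\<omega>. Y \<omega> * (\<Prod>(\<phi>, c)\<leftarrow>L. indicator {c<..} (X \<phi> \<omega>)) * cos (X 0 \<omega> + 0)) = 0"
      using ind[of L] unfolding annihilates_def by blast
    moreover have "expectation (\<lambda>\<omega>. Y \<omega> * (\<Prod>(\<phi>, c)\<leftarrow>L. indicator {c<..} (X \<phi> \<omega>)) * cos (X 0 \<omega> + 0)) =
        expectation (\<lambda>\<omega>. Y \<omega> * indicator (cyl_set L) \<omega>)"
    proof (intro integral_cong_AE)
      have [measurable]: "(\<lambda>\<omega>. \<Prod>(\<phi>, c)\<leftarrow>L. indicator {c<..} (X \<phi> \<omega>) :: real) \<in> borel_measurable M"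
        using ind[of L] by (simp add: annihilates_def)
      show "(\<lambda>\<omega>. Y \<omega> * (\<Prod>(\<phi>, c)\<leftarrow>L. indicator {c<..} (X \<phi> \<omega>)) * cos (X 0 \<omega> + 0)) \<in> borel_measurable M"
        by measurable
      show "AE \<omega> in M. Y \<omega> * (\<Prod>(\<phi>, c)\<leftarrow>L. indicator {c<..} (X \<phi> \<omega>)) * cos (X 0 \<omega> + 0) = Y \<omega> * indicator (cyl_set L) \<omega>"
        using X0 AE_space by eventually_elim (simp add: prod)
    qed simp
    ultimately show ?thesis by simp
  qed
  have all: "expectation (\<lambda>\<omega>. Y \<omega> * indicator A \<omega>) = 0" if "A \<in> sets M" for A
  proof -
    have "Int_stable (range cyl_set)"
    proof (rule Int_stableI)
      fix A B assume "A \<in> range cyl_set" "B \<in> range cyl_set"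
      then obtain L L' where "A = cyl_set L" "B = cyl_set L'" by blast
      then have "A \<inter> B = cyl_set (L @ L')" by (auto simp: cyl_set_def)
      then show "A \<inter> B \<in> range cyl_set" by simp
    qed
    moreover have "range cyl_set \<subseteq> Pow (space M)" by (auto simp: cyl_set_def)
    moreover have "A \<in> sigma_sets (space M) (range cyl_set)" using that sets_eq_cyl_sets by simp
    ultimately show ?thesis
    proof (induction rule: sigma_sets_induct_disjoint)
      case (basic A) then show ?case using cyl by auto
    next
      case empty then show ?case by simp
    next
      case (compl A)
      then have [measurable]: "A \<in> sets M" by (simp add: sets_eq_cyl_sets)
      have "expectation (\<lambda>\<omega>. Y \<omega> * indicator (space M - A) \<omega>) = expectation (\<lambda>\<omega>. Y \<omega> * indicator (cyl_set []) \<omega> - Y \<omega> * indicator A \<omega>)"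
        by (intro Bochner_Integration.integral_cong refl) (auto simp: cyl_set_def indicator_def)
      also have "\<dots> = 0"
        using compl cyl[of "[]"] integrable_real_mult_indicator[OF _ Y] sets_eq_cyl_sets by simp
      finally show ?case .
    next
      case (union A)
      then have [measurable]: "A i \<in> sets M" for i by (auto simp: sets_eq_cyl_sets)
      have "(\<integral>\<omega>\<in>(\<Union>i. A i). Y \<omega> \<partial>M) = (\<Sum>i. \<integral>\<omega>\<in>A i. Y \<omega> \<partial>M)"
        using union(1) integrable_real_mult_indicator[OF _ Y]
        by (intro lebesgue_integral_countable_add) (auto simp: set_integrable_def disjoint_family_on_def mult.commute)
      then show ?case using union(3) by (simp add: set_lebesgue_integral_def mult.commute)
    qed
  qed
  show ?thesis
    by (rule density_unique_real[OF Y, of "\<lambda>_. 0"]) (use all in \<open>auto simp: set_lebesgue_integral_def mult.commute\<close>)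
qed

end

section \<open>Closability and the Malliavin derivative\<close>

context isonormal_process
begin

text \<open>
The closure, in \<open>L\<^sup>2(\<Omega>) \<times> L\<^sup>2(\<Omega>; H)\<close>, of the graph of the gradient on smooth cylinders.
\<close>

definition malliavin_graph :: "('a \<Rightarrow> real) \<Rightarrow> ('a \<Rightarrow> 'h) \<Rightarrow> bool" where
  "malliavin_graph F Y \<longleftrightarrow> (\<exists>C. (\<forall>n. smooth_cylinder (C n)) \<and>
     L2_lim M (\<lambda>n. cyl_rv X (C n)) F \<and> L2_lim M (\<lambda>n. cyl_grad X (C n)) Y)"

lemma malliavin_graphE:
  assumes "malliavin_graph F Y"
  obtains C where "\<And>n. smooth_cylinder (C n)" "L2_lim M (\<lambda>n. cyl_rv X (C n)) F"
    "L2_lim M (\<lambda>n. cyl_grad X (C n)) Y"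
  using assms unfolding malliavin_graph_def by auto

lemma malliavin_graph_L2:
  assumes "malliavin_graph F Y" shows "L2 M F" "L2 M Y"
  using assms unfolding malliavin_graph_def L2_lim_def by auto

lemma malliavin_graph_add:
  assumes "malliavin_graph F Y" "malliavin_graph G W"
  shows "malliavin_graph (\<lambda>\<omega>. a * F \<omega> + b * G \<omega>) (\<lambda>\<omega>. a *\<^sub>R Y \<omega> + b *\<^sub>R W \<omega>)"
proof -
  obtain C where C: "\<And>n. smooth_cylinder (C n)" "L2_lim M (\<lambda>n. cyl_rv X (C n)) F"
    "L2_lim M (\<lambda>n. cyl_grad X (C n)) Y" by (rule malliavin_graphE[OF assms(1)]) (rule that)
  obtain D where D: "\<And>n. smooth_cylinder (D n)" "L2_lim M (\<lambda>n. cyl_rv X (D n)) G"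
    "L2_lim M (\<lambda>n. cyl_grad X (D n)) W" by (rule malliavin_graphE[OF assms(2)]) (rule that)
  have "\<exists>E. smooth_cylinder E \<and> cyl_rv X E = (\<lambda>\<omega>. a * cyl_rv X (C n) \<omega> + b * cyl_rv X (D n) \<omega>) \<and>
      cyl_grad X E = (\<lambda>\<omega>. a *\<^sub>R cyl_grad X (C n) \<omega> + b *\<^sub>R cyl_grad X (D n) \<omega>)" for n
    by (rule smooth_cylinder_add[OF C(1) D(1), where X = X]) (intro exI conjI)
  then obtain E where E: "\<And>n. smooth_cylinder (E n)"
    "\<And>n. cyl_rv X (E n) = (\<lambda>\<omega>. a * cyl_rv X (C n) \<omega> + b * cyl_rv X (D n) \<omega>)"
    "\<And>n. cyl_grad X (E n) = (\<lambda>\<omega>. a *\<^sub>R cyl_grad X (C n) \<omega> + b *\<^sub>R cyl_grad X (D n) \<omega>)" by metis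
  have "L2_lim M (\<lambda>n. cyl_rv X (E n)) (\<lambda>\<omega>. a * F \<omega> + b * G \<omega>)"
    using L2_lim_add[OF L2_lim_scaleR[OF C(2), of a] L2_lim_scaleR[OF D(2), of b]] by (simp add: E)
  moreover have "L2_lim M (\<lambda>n. cyl_grad X (E n)) (\<lambda>\<omega>. a *\<^sub>R Y \<omega> + b *\<^sub>R W \<omega>)"
    using L2_lim_add[OF L2_lim_scaleR[OF C(3), of a] L2_lim_scaleR[OF D(3), of b]] by (simp add: E)
  ultimately show ?thesis unfolding malliavin_graph_def using E(1) by (intro exI[of _ E] conjI allI)
qed

lemma malliavin_graph_const: "malliavin_graph (\<lambda>_. c) (\<lambda>_. 0)"
proof -
  let ?C = "(0 :: nat, \<lambda>_ :: nat \<Rightarrow> real. c, \<lambda>_ :: nat. 0 :: 'h)"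
  have sm: "smooth_cylinder ?C" by (simp add: smooth_cylinder_def Cb_infinity_const)
  have rv: "cyl_rv X ?C = (\<lambda>_. c)" and gr: "cyl_grad X ?C = (\<lambda>_. 0)"
    by (simp_all add: cyl_rv_def cyl_grad_def)
  show ?thesis unfolding malliavin_graph_def
    by (intro exI[of _ "\<lambda>_. ?C"] conjI allI sm; unfold rv gr; rule L2_lim_const; simp add: L2_def)
qed

text \<open>
Let \<open>C n \<rightarrow> 0\<close> with gradients tending to \<open>W\<close>. For a bounded cylinder \<open>G\<close>, integration by parts of \<open>C n * G\<close>
gives \<open>E (G (\<nabla>(C n) \<bullet> h)) = E (C n (G X h - \<nabla>G \<bullet> h)) \<rightarrow> 0\<close>. With the waves as \<open>G\<close> this shows \<open>W \<bullet> h = 0\<close> almost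
surely, for all \<open>h\<close> in a countable dense set.
\<close>

lemma malliavin_closable_zero:
  assumes "malliavin_graph (\<lambda>_. 0) W" shows "AE \<omega> in M. W \<omega> = 0"
proof -
  obtain C where C: "\<And>n. smooth_cylinder (C n)" "L2_lim M (\<lambda>n. cyl_rv X (C n)) (\<lambda>_. 0)"
    "L2_lim M (\<lambda>n. cyl_grad X (C n)) W" by (rule malliavin_graphE[OF assms]) (rule that)
  have LW: "L2 M W" using malliavin_graph_L2[OF assms] by simp
  have zero: "expectation (\<lambda>\<omega>. (W \<omega> \<bullet> h) * cos (X \<psi> \<omega> + b)) = 0" for h \<psi> b
  proof -
    let ?G = "(1 :: nat, \<lambda>x. 1 * cos ((\<Sum>j<1::nat. 1 * x j) + b), \<lambda>_ :: nat. \<psi>)"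
    have sm: "smooth_cylinder ?G" using Cb_infinity_wave[of 1 1 "\<lambda>_. 1" b] by (simp add: smooth_cylinder_def)
    have rvG: "cyl_rv X ?G = (\<lambda>\<omega>. cos (X \<psi> \<omega> + b))" by (simp add: cyl_rv_def)
    let ?R = "\<lambda>\<omega>. cyl_rv X ?G \<omega> * X h \<omega> - cyl_grad X ?G \<omega> \<bullet> h"
    have LR: "L2 M ?R"
      by (rule L2_diff[OF L2_real_mult_bounded[OF X_L2 cyl_rv_measurable[OF sm], of 1]
            L2_inner_const[OF cyl_grad_L2[OF sm]]]) (simp only: rvG abs_cos_le_one)
    have eq: "expectation (\<lambda>\<omega>. (cyl_grad X (C n) \<omega> \<bullet> h) * cyl_rv X ?G \<omega>) = expectation (\<lambda>\<omega>. cyl_rv X (C n) \<omega> * ?R \<omega>)" for n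
    proof -
      obtain E where E: "smooth_cylinder E" "cyl_rv X E = (\<lambda>\<omega>. cyl_rv X (C n) \<omega> * cyl_rv X ?G \<omega>)"
        "cyl_grad X E = (\<lambda>\<omega>. cyl_rv X ?G \<omega> *\<^sub>R cyl_grad X (C n) \<omega> + cyl_rv X (C n) \<omega> *\<^sub>R cyl_grad X ?G \<omega>)"
        by (rule smooth_cylinder_mult[OF C(1) sm, where X = X]) (rule that)
      have i1: "integrable M (\<lambda>\<omega>. (cyl_grad X (C n) \<omega> \<bullet> h) * cyl_rv X ?G \<omega>)"
        by (rule L2_mult_integrable[OF L2_inner_const[OF cyl_grad_L2[OF C(1)]] cyl_rv_L2[OF sm]])
      have i2: "integrable M (\<lambda>\<omega>. cyl_rv X (C n) \<omega> * (cyl_grad X ?G \<omega> \<bullet> h))"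
        by (rule L2_mult_integrable[OF cyl_rv_L2[OF C(1)] L2_inner_const[OF cyl_grad_L2[OF sm]]])
      have i3: "integrable M (\<lambda>\<omega>. cyl_rv X (C n) \<omega> * (cyl_rv X ?G \<omega> * X h \<omega>))"
        by (rule L2_mult_integrable[OF cyl_rv_L2[OF C(1)] L2_real_mult_bounded[OF X_L2 cyl_rv_measurable[OF sm], of 1]])
          (simp only: rvG abs_cos_le_one)
      have "expectation (\<lambda>\<omega>. cyl_rv X (C n) \<omega> * (cyl_rv X ?G \<omega> * X h \<omega>)) = expectation (\<lambda>\<omega>. cyl_rv X E \<omega> * X h \<omega>)"
        by (simp add: E(2) mult.assoc)
      also have "\<dots> = expectation (\<lambda>\<omega>. cyl_grad X E \<omega> \<bullet> h)" by (rule integration_by_parts[OF E(1)])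
      also have "\<dots> = expectation (\<lambda>\<omega>. (cyl_grad X (C n) \<omega> \<bullet> h) * cyl_rv X ?G \<omega> + cyl_rv X (C n) \<omega> * (cyl_grad X ?G \<omega> \<bullet> h))"
        by (simp add: E(3) inner_add_left mult.commute)
      also have "\<dots> = expectation (\<lambda>\<omega>. (cyl_grad X (C n) \<omega> \<bullet> h) * cyl_rv X ?G \<omega>) + expectation (\<lambda>\<omega>. cyl_rv X (C n) \<omega> * (cyl_grad X ?G \<omega> \<bullet> h))"
        by (rule Bochner_Integration.integral_add[OF i1 i2])
      finally show ?thesis unfolding right_diff_distrib Bochner_Integration.integral_diff[OF i3 i2] by linarith
    qed
    have l1: "(\<lambda>n. expectation (\<lambda>\<omega>. (cyl_grad X (C n) \<omega> \<bullet> h) * cyl_rv X ?G \<omega>)) \<longlonglongrightarrow> expectation (\<lambda>\<omega>. (W \<omega> \<bullet> h) * cyl_rv X ?G \<omega>)"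
      using L2_lim_inner[OF L2_lim_inner_const[OF C(3)] L2_lim_const[OF cyl_rv_L2[OF sm]]]
      unfolding inner_real_def .
    have l2: "(\<lambda>n. expectation (\<lambda>\<omega>. cyl_rv X (C n) \<omega> * ?R \<omega>)) \<longlonglongrightarrow> expectation (\<lambda>\<omega>. 0 * ?R \<omega>)"
      using L2_lim_inner[OF C(2) L2_lim_const[OF LR]] unfolding inner_real_def .
    have z: "expectation (\<lambda>\<omega>. 0 * ?R \<omega>) = 0"
      unfolding mult_zero_left by (rule Bochner_Integration.integral_zero)
    show ?thesis
      using LIMSEQ_unique[OF l1 l2[folded eq]] unfolding z unfolding rvG .
  qed
  have AEh: "AE \<omega> in M. W \<omega> \<bullet> h = 0" for h
    by (rule orthogonal_to_waves_imp_zero[OF L2_imp_integrable[OF L2_inner_const[OF LW]] zero])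
  obtain D :: "'h set" where D: "countable D" "\<And>U. open U \<Longrightarrow> U \<noteq> {} \<Longrightarrow> \<exists>d\<in>D. d \<in> U"
    by (rule countable_dense_setE) (rule that)
  have "AE \<omega> in M. \<forall>h\<in>D. W \<omega> \<bullet> h = 0" using AEh by (simp add: AE_ball_countable[OF D(1)])
  then show ?thesis
  proof eventually_elim
    case (elim \<omega>)
    show ?case
    proof (rule ccontr)
      assume nz: "W \<omega> \<noteq> 0"
      have o: "open {h. 0 < W \<omega> \<bullet> h}" by (intro open_Collect_less continuous_intros)
      have "W \<omega> \<in> {h. 0 < W \<omega> \<bullet> h}" using nz by simp
      then have ne: "{h. 0 < W \<omega> \<bullet> h} \<noteq> {}" by (metis empty_iff)
      obtain d where "d \<in> D" "0 < W \<omega> \<bullet> d" using D(2)[OF o ne] by auto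
      then show False using elim by simp
    qed
  qed
qed

lemma malliavin_graph_unique:
  assumes "malliavin_graph F Y" "malliavin_graph F Y'" shows "AE \<omega> in M. Y \<omega> = Y' \<omega>"
proof -
  have "malliavin_graph (\<lambda>\<omega>. 1 * F \<omega> + (-1) * F \<omega>) (\<lambda>\<omega>. 1 *\<^sub>R Y \<omega> + (-1) *\<^sub>R Y' \<omega>)"
    by (rule malliavin_graph_add[OF assms])
  then have "malliavin_graph (\<lambda>_. 0) (\<lambda>\<omega>. Y \<omega> - Y' \<omega>)" by simp
  from malliavin_closable_zero[OF this] show ?thesis by eventually_elim simp
qed

lemma poincare_malliavin:
  assumes "malliavin_graph F Y"
  shows "expectation (\<lambda>\<omega>. (F \<omega>)\<^sup>2) - (expectation F)\<^sup>2 \<le> expectation (\<lambda>\<omega>. (norm (Y \<omega>))\<^sup>2)"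
proof -
  obtain C where C: "\<And>n. smooth_cylinder (C n)" "L2_lim M (\<lambda>n. cyl_rv X (C n)) F"
    "L2_lim M (\<lambda>n. cyl_grad X (C n)) Y" by (rule malliavin_graphE[OF assms]) (rule that)
  show ?thesis by (rule poincare_limit[OF C(2,3) poincare_cylinder[OF C(1)]])
qed

lemma tensor_norm_cyl_deriv:
  "tensor_norm 1 (\<lambda>hs. cyl_deriv X C \<omega> hs - cyl_deriv X C' \<omega> hs) = norm (cyl_grad X C \<omega> - cyl_grad X C' \<omega>)"
proof -
  have "(\<Sum>hs\<in>{hs. set hs \<subseteq> B \<and> length hs = 1}. (cyl_deriv X C \<omega> hs - cyl_deriv X C' \<omega> hs)\<^sup>2) =
      (\<Sum>hs\<in>{hs. set hs \<subseteq> B \<and> length hs = 1}. ((cyl_grad X C \<omega> - cyl_grad X C' \<omega>) \<bullet> hd hs)\<^sup>2)" for B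
    by (rule sum.cong) (auto simp: length_Suc_conv cyl_deriv_singleton inner_diff_left)
  then have "tensor_norm 1 (\<lambda>hs. cyl_deriv X C \<omega> hs - cyl_deriv X C' \<omega> hs) =
      tensor_norm 1 (\<lambda>hs. (cyl_grad X C \<omega> - cyl_grad X C' \<omega>) \<bullet> hd hs)"
    unfolding tensor_norm_def by simp
  then show ?thesis by (simp only: tensor_norm_1)
qed

lemma powr_2_eq: "0 \<le> x \<Longrightarrow> x powr 2 = (x :: real)\<^sup>2"
  by simp

lemma sobolev_dist_pow_1_2:
  assumes "smooth_cylinder C" "smooth_cylinder C'"
  shows "sobolev_dist_pow M X 1 2 C C' =
    ennreal (L2_dist M (cyl_rv X C) (cyl_rv X C')) + ennreal (L2_dist M (cyl_grad X C) (cyl_grad X C'))"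
proof -
  have "sobolev_dist_pow M X 1 2 C C' =
    (\<integral>\<^sup>+\<omega>. ennreal ((norm (cyl_rv X C \<omega> - cyl_rv X C' \<omega>))\<^sup>2) \<partial>M) +
    (\<integral>\<^sup>+\<omega>. ennreal ((norm (cyl_grad X C \<omega> - cyl_grad X C' \<omega>))\<^sup>2) \<partial>M)"
    unfolding sobolev_dist_pow_def by (simp add: tensor_norm_cyl_deriv[simplified] powr_2_eq)
  then show ?thesis
    by (simp only: L2_dist_nn_integral[OF cyl_rv_L2[OF assms(1)] cyl_rv_L2[OF assms(2)]]
        L2_dist_nn_integral[OF cyl_grad_L2[OF assms(1)] cyl_grad_L2[OF assms(2)]])
qed

lemma L2_lim_cyl_rv_iff:
  assumes "\<And>n. smooth_cylinder (C n)"
  shows "L2_lim M (\<lambda>n. cyl_rv X (C n)) F \<longleftrightarrow> F \<in> borel_measurable M \<and>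
    (\<lambda>n. \<integral>\<^sup>+\<omega>. ennreal ((cyl_rv X (C n) \<omega> - F \<omega>)\<^sup>2) \<partial>M) \<longlonglongrightarrow> 0"
  using L2_lim_iff_nn_integral[of M "\<lambda>n. cyl_rv X (C n)" F, OF cyl_rv_L2[OF assms]] by simp

lemma sobolev_space_mono:
  assumes "F \<in> sobolev_space M X 3 2" shows "F \<in> sobolev_space M X 1 2"
proof -
  obtain C :: "nat \<Rightarrow> 'h cylinder" where C: "F \<in> borel_measurable M" "\<forall>n. smooth_cylinder (C n)"
    "\<forall>e>0. \<exists>N. \<forall>m\<ge>N. \<forall>n\<ge>N. sobolev_dist_pow M X 3 2 (C m) (C n) < e"
    "(\<lambda>n. \<integral>\<^sup>+\<omega>. ennreal (\<bar>cyl_rv X (C n) \<omega> - F \<omega>\<bar> powr 2) \<partial>M) \<longlonglongrightarrow> 0"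
    using assms unfolding sobolev_space_def mem_Collect_eq by (elim conjE exE)
  have "sobolev_dist_pow M X 1 2 (C m) (C n) \<le> sobolev_dist_pow M X 3 2 (C m) (C n)" for m n
    unfolding sobolev_dist_pow_def by (intro add_left_mono sum_mono2) auto
  note less = le_less_trans[OF this]
  have "\<forall>e>0. \<exists>N. \<forall>m\<ge>N. \<forall>n\<ge>N. sobolev_dist_pow M X 1 2 (C m) (C n) < e"
  proof (intro allI impI)
    fix e :: ennreal assume "0 < e"
    with C(3) obtain N where "\<forall>m\<ge>N. \<forall>n\<ge>N. sobolev_dist_pow M X 3 2 (C m) (C n) < e" by presburger
    then show "\<exists>N. \<forall>m\<ge>N. \<forall>n\<ge>N. sobolev_dist_pow M X 1 2 (C m) (C n) < e"
      by (intro exI[of _ N] allI impI less) simp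
  qed
  with C show ?thesis unfolding sobolev_space_def mem_Collect_eq by (intro conjI exI[of _ C])
qed

lemma sobolev_space_imp_graph:
  assumes "F \<in> sobolev_space M X 1 2" shows "\<exists>Y. malliavin_graph F Y"
proof -
  obtain C where C: "\<And>n. smooth_cylinder (C n)"
    and Cau: "\<And>e. e > 0 \<Longrightarrow> \<exists>N. \<forall>m\<ge>N. \<forall>n\<ge>N. sobolev_dist_pow M X 1 2 (C m) (C n) < e"
    and lim: "(\<lambda>n. \<integral>\<^sup>+\<omega>. ennreal (\<bar>cyl_rv X (C n) \<omega> - F \<omega>\<bar> powr 2) \<partial>M) \<longlonglongrightarrow> 0"
    and F: "F \<in> borel_measurable M"
    using assms unfolding sobolev_space_def by auto
  have 1: "L2_lim M (\<lambda>n. cyl_rv X (C n)) F"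
    using lim F by (simp add: L2_lim_cyl_rv_iff[OF C] powr_2_eq)
  obtain Y where Y: "L2_lim M (\<lambda>n. cyl_grad X (C n)) Y"
  proof (rule L2_complete[OF cyl_grad_L2[OF C]])
    fix e :: real assume e: "e > 0"
    then obtain N where N: "\<forall>m\<ge>N. \<forall>n\<ge>N. sobolev_dist_pow M X 1 2 (C m) (C n) < ennreal e"
      using Cau[of "ennreal e"] by auto
    have "L2_dist M (cyl_grad X (C m)) (cyl_grad X (C n)) < e" if "N \<le> m" "N \<le> n" for m n
    proof -
      have "ennreal (L2_dist M (cyl_grad X (C m)) (cyl_grad X (C n))) \<le> sobolev_dist_pow M X 1 2 (C m) (C n)"
        unfolding sobolev_dist_pow_1_2[OF C C] by simp
      also have "\<dots> < ennreal e" using N that by blast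
      finally show ?thesis by (simp add: ennreal_less_iff L2_dist_nonneg)
    qed
    then show "\<exists>N. \<forall>m\<ge>N. \<forall>n\<ge>N. L2_dist M (cyl_grad X (C m)) (cyl_grad X (C n)) < e" by (intro exI allI impI)
  qed (rule that)
  show ?thesis unfolding malliavin_graph_def by (intro exI[of _ Y] exI[of _ C] conjI allI C 1 Y)
qed

lemma graph_imp_sobolev_space:
  assumes "malliavin_graph F Y" shows "F \<in> sobolev_space M X 1 2"
proof -
  obtain C where C: "\<And>n. smooth_cylinder (C n)" "L2_lim M (\<lambda>n. cyl_rv X (C n)) F"
    "L2_lim M (\<lambda>n. cyl_grad X (C n)) Y" by (rule malliavin_graphE[OF assms]) (rule that)
  have F: "L2 M F" and Y: "L2 M Y" using malliavin_graph_L2[OF assms] .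
  have lim: "(\<lambda>n. \<integral>\<^sup>+\<omega>. ennreal (\<bar>cyl_rv X (C n) \<omega> - F \<omega>\<bar> powr 2) \<partial>M) \<longlonglongrightarrow> 0"
    using C(2) by (simp add: L2_lim_cyl_rv_iff[OF C(1)] powr_2_eq)
  define d where "d n = L2_dist M (cyl_rv X (C n)) F + L2_dist M (cyl_grad X (C n)) Y" for n
  have "d \<longlonglongrightarrow> 0 + 0" unfolding d_def using C(2,3) unfolding L2_lim_def by (intro tendsto_add) auto
  then have d: "d \<longlonglongrightarrow> 0" by simp
  have Cau: "\<exists>N. \<forall>m\<ge>N. \<forall>n\<ge>N. sobolev_dist_pow M X 1 2 (C m) (C n) < e" if e: "e > 0" for e
  proof -
    obtain r where r: "0 < r" "ennreal r \<le> e"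
    proof (cases e)
      case (real s) then show ?thesis using that[of s] e by (auto simp: ennreal_less_zero_iff)
    next
      case top then show ?thesis using that[of 1] by simp
    qed
    have "\<forall>\<^sub>F n in sequentially. d n < r / 4" using order_tendstoD(2)[OF d, of "r / 4"] r by simp
    then obtain N where N: "\<And>n. n \<ge> N \<Longrightarrow> d n < r / 4" by (auto simp: eventually_sequentially)
    have "sobolev_dist_pow M X 1 2 (C m) (C n) < e" if "N \<le> m" "N \<le> n" for m n
    proof -
      have "L2_dist M (cyl_rv X (C m)) (cyl_rv X (C n)) + L2_dist M (cyl_grad X (C m)) (cyl_grad X (C n)) < r"
        using L2_dist_triangle[OF cyl_rv_L2[OF C(1)[of m]] F cyl_rv_L2[OF C(1)[of n]]]
          L2_dist_triangle[OF cyl_grad_L2[OF C(1)[of m]] Y cyl_grad_L2[OF C(1)[of n]]]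
          N[OF that(1)] N[OF that(2)] unfolding d_def L2_dist_commute[of M F] L2_dist_commute[of M Y] by linarith
      then have "sobolev_dist_pow M X 1 2 (C m) (C n) < ennreal r"
        unfolding sobolev_dist_pow_1_2[OF C(1) C(1)]
        by (simp add: ennreal_plus[symmetric] L2_dist_nonneg ennreal_less_iff del: ennreal_plus)
      then show ?thesis using r(2) by (rule less_le_trans)
    qed
    then show ?thesis by (intro exI allI impI)
  qed
  show ?thesis unfolding sobolev_space_def mem_Collect_eq
    by (intro conjI exI[of _ C] allI impI C(1) Cau lim L2_measurable[OF F])
qed

lemma malliavin_D_graph:
  assumes "F \<in> sobolev_space M X 1 2" shows "malliavin_graph F (malliavin_D M X F)"
proof -
  have F: "F \<in> borel_measurable M" using assms by (simp add: sobolev_space_def)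
  have eq: "Y \<in> borel_measurable M \<and>
     (\<exists>C :: nat \<Rightarrow> 'h cylinder.
        (\<forall>n. smooth_cylinder (C n)) \<and>
        (\<lambda>n. \<integral>\<^sup>+\<omega>. ennreal ((cyl_rv X (C n) \<omega> - F \<omega>)\<^sup>2) \<partial>M) \<longlonglongrightarrow> 0 \<and>
        (\<lambda>n. \<integral>\<^sup>+\<omega>. ennreal ((norm (cyl_grad X (C n) \<omega> - Y \<omega>))\<^sup>2) \<partial>M) \<longlonglongrightarrow> 0) \<longleftrightarrow> malliavin_graph F Y" for Y
  proof -
    have "L2_lim M (\<lambda>n. cyl_grad X (C n)) Y \<longleftrightarrow> Y \<in> borel_measurable M \<and>
      (\<lambda>n. \<integral>\<^sup>+\<omega>. ennreal ((norm (cyl_grad X (C n) \<omega> - Y \<omega>))\<^sup>2) \<partial>M) \<longlonglongrightarrow> 0"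
      if "\<And>n. smooth_cylinder (C n)" for C
      by (rule L2_lim_iff_nn_integral[OF cyl_grad_L2[OF that]])
    with F show ?thesis unfolding malliavin_graph_def by (auto simp: L2_lim_cyl_rv_iff)
  qed
  show ?thesis
    unfolding malliavin_D_def eq by (rule someI_ex[OF sobolev_space_imp_graph[OF assms]])
qed

lemma malliavin_D_AE:
  assumes "malliavin_graph F Y" shows "AE \<omega> in M. malliavin_D M X F \<omega> = Y \<omega>"
  by (rule malliavin_graph_unique[OF malliavin_D_graph[OF graph_imp_sobolev_space[OF assms]] assms])

section \<open>The divergence\<close>

text \<open>
The Riesz representation of \<open>G \<mapsto> E \<langle>D G, u\<rangle>\<close> on \<open>\<bbbD>\<^sup>1\<^sup>,\<^sup>2\<close>; this functional is linear because \<open>D G\<close> is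
almost surely unique. It shows that the choice in \<open>divergence\<close> is made from a nonempty set.
\<close>

lemma divergence_exists:
  assumes u: "u \<in> dom_divergence M X"
  shows "\<exists>V. V \<in> borel_measurable M \<and> integrable M (\<lambda>\<omega>. (V \<omega>)\<^sup>2) \<and>
     (\<forall>G\<in>sobolev_space M X 1 2. (\<integral>\<omega>. G \<omega> * V \<omega> \<partial>M) = (\<integral>\<omega>. malliavin_D M X G \<omega> \<bullet> u \<omega> \<partial>M))"
proof -
  have Lu: "L2 M u" using u by (simp add: dom_divergence_def L2_def)
  obtain c where c: "\<And>G. G \<in> sobolev_space M X 1 2 \<Longrightarrow>
      \<bar>\<integral>\<omega>. malliavin_D M X G \<omega> \<bullet> u \<omega> \<partial>M\<bar> \<le> c * sqrt (\<integral>\<omega>. (G \<omega>)\<^sup>2 \<partial>M)"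
    using u unfolding dom_divergence_def by auto
  have g: "malliavin_graph (\<lambda>\<omega>. a * G \<omega> + b * H \<omega>) (\<lambda>\<omega>. a *\<^sub>R malliavin_D M X G \<omega> + b *\<^sub>R malliavin_D M X H \<omega>)"
    if "G \<in> sobolev_space M X 1 2" "H \<in> sobolev_space M X 1 2" for G H a b
    by (rule malliavin_graph_add[OF malliavin_D_graph[OF that(1)] malliavin_D_graph[OF that(2)]])
  obtain V where V: "L2 M V" "\<And>G. G \<in> sobolev_space M X 1 2 \<Longrightarrow>
      expectation (\<lambda>\<omega>. G \<omega> * V \<omega>) = (\<integral>\<omega>. malliavin_D M X G \<omega> \<bullet> u \<omega> \<partial>M)"
  proof (rule L2_riesz[where S = "sobolev_space M X 1 2" and c = c and
        l = "\<lambda>G. \<integral>\<omega>. malliavin_D M X G \<omega> \<bullet> u \<omega> \<partial>M"])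
    show "L2 M G" if "G \<in> sobolev_space M X 1 2" for G
      by (rule malliavin_graph_L2(1)[OF malliavin_D_graph[OF that]])
    show "(\<lambda>_. 0) \<in> sobolev_space M X 1 2" by (rule graph_imp_sobolev_space[OF malliavin_graph_const])
    fix G H a b assume GH: "G \<in> sobolev_space M X 1 2" "H \<in> sobolev_space M X 1 2"
    show "(\<lambda>\<omega>. a * G \<omega> + b * H \<omega>) \<in> sobolev_space M X 1 2" by (rule graph_imp_sobolev_space[OF g[OF GH]])
    note L = malliavin_graph_L2(2)[OF malliavin_D_graph]
    have "(\<integral>\<omega>. malliavin_D M X (\<lambda>\<omega>. a * G \<omega> + b * H \<omega>) \<omega> \<bullet> u \<omega> \<partial>M) =
        (\<integral>\<omega>. a * (malliavin_D M X G \<omega> \<bullet> u \<omega>) + b * (malliavin_D M X H \<omega> \<bullet> u \<omega>) \<partial>M)"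
    proof (rule integral_cong_AE)
      note [measurable] = L2_measurable[OF L[OF GH(1)]] L2_measurable[OF L[OF GH(2)]] L2_measurable[OF Lu]
        L2_measurable[OF L[OF graph_imp_sobolev_space[OF g[OF GH, of a b]]]]
      show "(\<lambda>\<omega>. malliavin_D M X (\<lambda>\<omega>. a * G \<omega> + b * H \<omega>) \<omega> \<bullet> u \<omega>) \<in> borel_measurable M" by measurable
      show "(\<lambda>\<omega>. a * (malliavin_D M X G \<omega> \<bullet> u \<omega>) + b * (malliavin_D M X H \<omega> \<bullet> u \<omega>)) \<in> borel_measurable M" by measurable
      show "AE \<omega> in M. malliavin_D M X (\<lambda>\<omega>. a * G \<omega> + b * H \<omega>) \<omega> \<bullet> u \<omega> =
          a * (malliavin_D M X G \<omega> \<bullet> u \<omega>) + b * (malliavin_D M X H \<omega> \<bullet> u \<omega>)"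
        using malliavin_D_AE[OF g[OF GH, of a b]] by eventually_elim (simp add: inner_add_left)
    qed
    also have "\<dots> = a * (\<integral>\<omega>. malliavin_D M X G \<omega> \<bullet> u \<omega> \<partial>M) + b * (\<integral>\<omega>. malliavin_D M X H \<omega> \<bullet> u \<omega> \<partial>M)"
      using L2_inner_integrable[OF L[OF GH(1)] Lu] L2_inner_integrable[OF L[OF GH(2)] Lu] by simp
    finally show "(\<integral>\<omega>. malliavin_D M X (\<lambda>\<omega>. a * G \<omega> + b * H \<omega>) \<omega> \<bullet> u \<omega> \<partial>M) =
      a * (\<integral>\<omega>. malliavin_D M X G \<omega> \<bullet> u \<omega> \<partial>M) + b * (\<integral>\<omega>. malliavin_D M X H \<omega> \<bullet> u \<omega> \<partial>M)" .
  qed (rule c, assumption, rule that)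
  show ?thesis
    by (intro exI[of _ V] conjI ballI L2_measurable[OF V(1)] L2_real_integrable[OF V(1)] V(2))
qed

lemma divergence_duality:
  assumes "u \<in> dom_divergence M X"
  shows "L2 M (divergence M X u)"
    and "malliavin_graph G Y \<Longrightarrow> expectation (\<lambda>\<omega>. G \<omega> * divergence M X u \<omega>) = expectation (\<lambda>\<omega>. Y \<omega> \<bullet> u \<omega>)"
proof -
  note * = someI_ex[OF divergence_exists[OF assms], folded divergence_def]
  show "L2 M (divergence M X u)" using * by (simp add: L2_def)
  assume G: "malliavin_graph G Y"
  have [measurable]: "u \<in> borel_measurable M" using assms by (simp add: dom_divergence_def)
  note S = graph_imp_sobolev_space[OF G]
  note [measurable] = L2_measurable[OF malliavin_graph_L2(2)[OF G]] L2_measurable[OF malliavin_graph_L2(2)[OF malliavin_D_graph[OF S]]]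
  have "expectation (\<lambda>\<omega>. G \<omega> * divergence M X u \<omega>) = expectation (\<lambda>\<omega>. malliavin_D M X G \<omega> \<bullet> u \<omega>)"
    using * S by blast
  also have "\<dots> = expectation (\<lambda>\<omega>. Y \<omega> \<bullet> u \<omega>)"
  proof (rule integral_cong_AE)
    show "AE \<omega> in M. malliavin_D M X G \<omega> \<bullet> u \<omega> = Y \<omega> \<bullet> u \<omega>"
      using malliavin_D_AE[OF G] by eventually_elim simp
  qed measurable
  finally show "expectation (\<lambda>\<omega>. G \<omega> * divergence M X u \<omega>) = expectation (\<lambda>\<omega>. Y \<omega> \<bullet> u \<omega>)" .
qed

end

section \<open>The chain rule and its dual form\<close>

context isonormal_process
begin

lemma malliavin_graph_AE:
  assumes "malliavin_graph F Y"
  obtains C where "\<And>n. smooth_cylinder (C n)" "L2_lim M (\<lambda>n. cyl_rv X (C n)) F"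
    "L2_lim M (\<lambda>n. cyl_grad X (C n)) Y" "AE \<omega> in M. (\<lambda>n. cyl_rv X (C n) \<omega>) \<longlonglongrightarrow> F \<omega>"
proof -
  obtain C where C: "\<And>n. smooth_cylinder (C n)" "L2_lim M (\<lambda>n. cyl_rv X (C n)) F"
    "L2_lim M (\<lambda>n. cyl_grad X (C n)) Y" by (rule malliavin_graphE[OF assms]) (rule that)
  obtain r where r: "strict_mono r" "AE \<omega> in M. (\<lambda>n. cyl_rv X (C (r n)) \<omega>) \<longlonglongrightarrow> F \<omega>"
    by (rule L2_lim_AE_subseq[OF C(2)]) (rule that)
  show ?thesis
    by (rule that[OF C(1) L2_lim_subseq[OF C(2) r(1)] L2_lim_subseq[OF C(3) r(1)] r(2)])
qed

text \<open>
Along a subsequence the approximating cylinders converge almost surely, and then so do the bounded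
coefficients in the gradient of the product.
\<close>

lemma malliavin_chain_rule:
  assumes F: "malliavin_graph F Y" and G: "malliavin_graph G W"
    and a: "trig_fun a" "trig_fun a'" "\<And>x. (a has_real_derivative a' x) (at x)"
    and b: "trig_fun b" "trig_fun b'" "\<And>x. (b has_real_derivative b' x) (at x)"
  shows "malliavin_graph (\<lambda>\<omega>. a (F \<omega>) * b (G \<omega>))
    (\<lambda>\<omega>. (a' (F \<omega>) * b (G \<omega>)) *\<^sub>R Y \<omega> + (a (F \<omega>) * b' (G \<omega>)) *\<^sub>R W \<omega>)"
proof -
  obtain C where C: "\<And>n. smooth_cylinder (C n)" "L2_lim M (\<lambda>n. cyl_rv X (C n)) F"
    "L2_lim M (\<lambda>n. cyl_grad X (C n)) Y" "AE \<omega> in M. (\<lambda>n. cyl_rv X (C n) \<omega>) \<longlonglongrightarrow> F \<omega>"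
    by (rule malliavin_graph_AE[OF F]) (rule that)
  obtain D where D: "\<And>n. smooth_cylinder (D n)" "L2_lim M (\<lambda>n. cyl_rv X (D n)) G"
    "L2_lim M (\<lambda>n. cyl_grad X (D n)) W" "AE \<omega> in M. (\<lambda>n. cyl_rv X (D n) \<omega>) \<longlonglongrightarrow> G \<omega>"
    by (rule malliavin_graph_AE[OF G]) (rule that)
  have "\<exists>E. smooth_cylinder E \<and> cyl_rv X E = (\<lambda>\<omega>. a (cyl_rv X (C n) \<omega>) * b (cyl_rv X (D n) \<omega>)) \<and>
    cyl_grad X E = (\<lambda>\<omega>. (a' (cyl_rv X (C n) \<omega>) * b (cyl_rv X (D n) \<omega>)) *\<^sub>R cyl_grad X (C n) \<omega>
       + (a (cyl_rv X (C n) \<omega>) * b' (cyl_rv X (D n) \<omega>)) *\<^sub>R cyl_grad X (D n) \<omega>)" for n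
    by (rule smooth_cylinder_trig_product[OF C(1) D(1) a(1) b(1) a(3) b(3), where X = X]) (intro exI conjI)
  then obtain E where E: "\<And>n. smooth_cylinder (E n)"
    "\<And>n. cyl_rv X (E n) = (\<lambda>\<omega>. a (cyl_rv X (C n) \<omega>) * b (cyl_rv X (D n) \<omega>))"
    "\<And>n. cyl_grad X (E n) = (\<lambda>\<omega>. (a' (cyl_rv X (C n) \<omega>) * b (cyl_rv X (D n) \<omega>)) *\<^sub>R cyl_grad X (C n) \<omega>
       + (a (cyl_rv X (C n) \<omega>) * b' (cyl_rv X (D n) \<omega>)) *\<^sub>R cyl_grad X (D n) \<omega>)" by metis
  have cont: "isCont c x" if "trig_fun c" for c x
    using trig_fun_deriv[OF that] by (auto intro: DERIV_isCont)
  have meas: "(\<lambda>\<omega>. c (H \<omega>)) \<in> borel_measurable M" if "trig_fun c" "H \<in> borel_measurable M" for c H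
    using measurable_compose[OF that(2) borel_measurable_continuous_onI[of c]]
      cont[OF that(1)] by (simp add: continuous_at_imp_continuous_on)
  note mF = L2_measurable[OF malliavin_graph_L2(1)[OF F]] and mG = L2_measurable[OF malliavin_graph_L2(1)[OF G]]
  note mC = cyl_rv_measurable[OF C(1)] and mD = cyl_rv_measurable[OF D(1)]
  have prod: "L2_lim M (\<lambda>n \<omega>. (c (cyl_rv X (C n) \<omega>) * d (cyl_rv X (D n) \<omega>)) *\<^sub>R f n \<omega>) (\<lambda>\<omega>. (c (F \<omega>) * d (G \<omega>)) *\<^sub>R g \<omega>)"
    if c: "trig_fun c" and d: "trig_fun d" and l: "L2_lim M f g" for c d and f :: "nat \<Rightarrow> 'a \<Rightarrow> 'c::{real_inner, second_countable_topology}" and g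
  proof -
    obtain A B where AB: "\<And>x. \<bar>c x\<bar> \<le> A" "\<And>x. \<bar>d x\<bar> \<le> B"
      using trig_fun_bounded[OF c] trig_fun_bounded[OF d] by blast
    have cd: "\<bar>c x * d y\<bar> \<le> A * B" for x y
      unfolding abs_mult by (intro mult_mono AB abs_ge_zero order_trans[OF abs_ge_zero AB(1)])
    show ?thesis
    proof (rule L2_lim_mult_bounded[OF l, where B = "A * B"])
      show "(\<lambda>\<omega>. c (cyl_rv X (C n) \<omega>) * d (cyl_rv X (D n) \<omega>)) \<in> borel_measurable M" for n
        by (intro borel_measurable_times meas[OF c mC] meas[OF d mD])
      show "(\<lambda>\<omega>. c (F \<omega>) * d (G \<omega>)) \<in> borel_measurable M"
        by (intro borel_measurable_times meas[OF c mF] meas[OF d mG])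
      show "AE \<omega> in M. (\<lambda>n. c (cyl_rv X (C n) \<omega>) * d (cyl_rv X (D n) \<omega>)) \<longlonglongrightarrow> c (F \<omega>) * d (G \<omega>)"
        using C(4) D(4)
      proof eventually_elim
        case (elim \<omega>)
        show ?case
          by (rule tendsto_mult[OF isCont_tendsto_compose[OF cont[OF c] elim(1)]
                isCont_tendsto_compose[OF cont[OF d] elim(2)]])
      qed
    qed (rule cd)+
  qed
  have one: "L2_lim M (\<lambda>_ _. 1 :: real) (\<lambda>_. 1)" by (rule L2_lim_const) (simp add: L2_def)
  have "L2_lim M (\<lambda>n. cyl_rv X (E n)) (\<lambda>\<omega>. a (F \<omega>) * b (G \<omega>))"
    using prod[OF a(1) b(1) one] by (simp add: E)
  moreover have "L2_lim M (\<lambda>n. cyl_grad X (E n))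
      (\<lambda>\<omega>. (a' (F \<omega>) * b (G \<omega>)) *\<^sub>R Y \<omega> + (a (F \<omega>) * b' (G \<omega>)) *\<^sub>R W \<omega>)"
    unfolding E(3) by (rule L2_lim_add[OF prod[OF a(2) b(1) C(3)] prod[OF a(1) b(2) D(3)]])
  ultimately show ?thesis unfolding malliavin_graph_def using E(1) by (intro exI[of _ E] conjI allI)
qed

end

lemma (in isonormal_process) integrable_bounded_mult:
  assumes "integrable M Y" "W \<in> borel_measurable M" "\<And>\<omega>. \<bar>W \<omega>\<bar> \<le> B"
  shows "integrable M (\<lambda>\<omega>. W \<omega> * Y \<omega> :: real)"
  using integrable_mult_bounded[OF assms] by (simp add: mult.commute)

text \<open>
The situation of the theorem with versions fixed: \<open>F\<close> has the duality property of \<open>\<delta>(u)\<close>, \<open>Y\<close> is \<open>D F\<close>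
and \<open>T\<close> is \<open>D\<^sub>u F\<close>.
\<close>

locale divergence_pair = isonormal_process M X
  for M :: "'a measure" and X :: "'h::{real_inner, complete_space, second_countable_topology} \<Rightarrow> 'a \<Rightarrow> real" +
  fixes u :: "'a \<Rightarrow> 'h" and F T :: "'a \<Rightarrow> real" and Y :: "'a \<Rightarrow> 'h"
  assumes u: "L2 M u"
    and duality: "malliavin_graph G W \<Longrightarrow> expectation (\<lambda>\<omega>. G \<omega> * F \<omega>) = expectation (\<lambda>\<omega>. W \<omega> \<bullet> u \<omega>)"
    and F: "malliavin_graph F Y"
    and T: "L2 M T" "T = (\<lambda>\<omega>. u \<omega> \<bullet> Y \<omega>)"
begin

lemma F_L2: "L2 M F" using malliavin_graph_L2[OF F] by simp

lemma FT_integrable: "integrable M (\<lambda>\<omega>. F \<omega> * T \<omega>)"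
  by (rule L2_mult_integrable[OF F_L2 T(1)])

lemmas [measurable] = L2_measurable[OF F_L2] L2_measurable[OF T(1)] L2_measurable[OF u]

text \<open>
The product \<open>a(F) G\<close> can fall outside \<open>\<bbbD>\<^sup>1\<^sup>,\<^sup>2\<close>, as \<open>G D F\<close> is only integrable. The chain rule is therefore
applied to \<open>a(F) K sin (G/K)\<close>, and \<open>K \<rightarrow> \<infinity>\<close> is taken in the dual identity, where \<open>G F\<close>, \<open>G T\<close> and \<open>u \<bullet> W\<close>
are integrable.
\<close>

lemma duality_trig:
  assumes G: "malliavin_graph G W" and a: "trig_fun a" "trig_fun a'" "\<And>x. (a has_real_derivative a' x) (at x)"
  shows "expectation (\<lambda>\<omega>. a (F \<omega>) * (G \<omega> * F \<omega>)) =
    expectation (\<lambda>\<omega>. a' (F \<omega>) * (G \<omega> * T \<omega>)) + expectation (\<lambda>\<omega>. a (F \<omega>) * (u \<omega> \<bullet> W \<omega>))"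
proof -
  have LG: "L2 M G" "L2 M W" using malliavin_graph_L2[OF G] by auto
  have LY: "L2 M Y" using malliavin_graph_L2[OF F] by simp
  note [measurable] = L2_measurable[OF LG(1)] L2_measurable[OF LG(2)] L2_measurable[OF LY]
  have meas: "c \<in> borel_measurable borel" if "trig_fun c" for c
    using trig_fun_deriv[OF that] by (intro borel_measurable_continuous_onI continuous_at_imp_continuous_on) (auto intro: DERIV_isCont)
  note [measurable] = meas[OF a(1)] meas[OF a(2)]
  obtain A where A: "\<And>x. \<bar>a x\<bar> \<le> A" using trig_fun_bounded[OF a(1)] by blast
  obtain A' where A': "\<And>x. \<bar>a' x\<bar> \<le> A'" using trig_fun_bounded[OF a(2)] by blast
  have A0: "0 \<le> A" "0 \<le> A'" using order_trans[OF abs_ge_zero A] order_trans[OF abs_ge_zero A'] .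
  define K where "K m = real (Suc m)" for m
  have K: "K m > 0" for m by (simp add: K_def)
  define s where "s m x = K m * sin (x / K m)" for m x
  define c where "c m x = cos (x / K m)" for m x
  have st: "trig_fun (s m)" "trig_fun (c m)" for m
    unfolding s_def[abs_def] c_def[abs_def] by (rule trig_fun_scaled_sin)+
  have sd: "(s m has_real_derivative c m x) (at x)" for m x
    unfolding s_def[abs_def] c_def by (rule DERIV_scaled_sin) (use K[of m] in simp)
  note [measurable] = meas[OF st(1)] meas[OF st(2)]
  have sle: "\<bar>s m x\<bar> \<le> \<bar>x\<bar>" and cle: "\<bar>c m x\<bar> \<le> 1" for m x
    unfolding s_def c_def by (rule abs_scaled_sin_le[OF K]) simp
  have slim: "(\<lambda>m. s m x) \<longlonglongrightarrow> x" and clim: "(\<lambda>m. c m x) \<longlonglongrightarrow> 1" for x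
    unfolding s_def c_def K_def by (rule scaled_sin_tendsto scaled_cos_tendsto)+
  have i1: "integrable M (\<lambda>\<omega>. G \<omega> * F \<omega>)" "integrable M (\<lambda>\<omega>. G \<omega> * T \<omega>)" "integrable M (\<lambda>\<omega>. u \<omega> \<bullet> W \<omega>)"
    by (intro L2_mult_integrable L2_inner_integrable LG F_L2 T u)+
  have i2: "integrable M (\<lambda>\<omega>. u \<omega> \<bullet> Y \<omega>)" by (rule L2_inner_integrable[OF u LY])
  have ac: "\<bar>a (F \<omega>) * c m (G \<omega>)\<bar> \<le> A * 1" for m \<omega>
    unfolding abs_mult by (intro mult_mono A cle A0) auto
  have eq: "expectation (\<lambda>\<omega>. a (F \<omega>) * s m (G \<omega>) * F \<omega>) =
      expectation (\<lambda>\<omega>. a' (F \<omega>) * s m (G \<omega>) * T \<omega>) + expectation (\<lambda>\<omega>. a (F \<omega>) * c m (G \<omega>) * (u \<omega> \<bullet> W \<omega>))" for m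
  proof -
    have "expectation (\<lambda>\<omega>. a (F \<omega>) * s m (G \<omega>) * F \<omega>) =
        expectation (\<lambda>\<omega>. ((a' (F \<omega>) * s m (G \<omega>)) *\<^sub>R Y \<omega> + (a (F \<omega>) * c m (G \<omega>)) *\<^sub>R W \<omega>) \<bullet> u \<omega>)"
      by (rule duality[OF malliavin_chain_rule[OF F G a st sd]])
    also have "\<dots> = expectation (\<lambda>\<omega>. a' (F \<omega>) * s m (G \<omega>) * T \<omega> + a (F \<omega>) * c m (G \<omega>) * (u \<omega> \<bullet> W \<omega>))"
      by (simp add: inner_add_left T(2) inner_commute[of "u _"])
    also have "\<dots> = expectation (\<lambda>\<omega>. a' (F \<omega>) * s m (G \<omega>) * T \<omega>) + expectation (\<lambda>\<omega>. a (F \<omega>) * c m (G \<omega>) * (u \<omega> \<bullet> W \<omega>))"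
    proof (rule Bochner_Integration.integral_add)
      obtain B where B: "\<And>x. \<bar>s m x\<bar> \<le> B" using trig_fun_bounded[OF st(1)] by blast
      have "\<bar>a' (F \<omega>) * s m (G \<omega>)\<bar> \<le> A' * B" for \<omega>
        unfolding abs_mult by (intro mult_mono A' B A0) auto
      from integrable_mult_bounded[OF L2_imp_integrable[OF T(1)] _ this]
      show "integrable M (\<lambda>\<omega>. a' (F \<omega>) * s m (G \<omega>) * T \<omega>)" by (simp add: mult.commute)
      from integrable_mult_bounded[OF i1(3) _ ac]
      show "integrable M (\<lambda>\<omega>. a (F \<omega>) * c m (G \<omega>) * (u \<omega> \<bullet> W \<omega>))" by (simp add: mult.commute)
    qed
    finally show ?thesis .
  qed
  have dom: "(\<lambda>m. expectation (\<lambda>\<omega>. e (F \<omega>) * s m (G \<omega>) * H \<omega>)) \<longlonglongrightarrow> expectation (\<lambda>\<omega>. e (F \<omega>) * (G \<omega> * H \<omega>))"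
    if e: "\<And>x. \<bar>e x\<bar> \<le> D" "e \<in> borel_measurable borel" and H: "integrable M (\<lambda>\<omega>. G \<omega> * H \<omega>)" "H \<in> borel_measurable M" for e D H
  proof (rule integral_dominated_convergence[where w = "\<lambda>\<omega>. D * \<bar>G \<omega> * H \<omega>\<bar>"])
    note [measurable] = e(2) H(2)
    show "(\<lambda>\<omega>. e (F \<omega>) * (G \<omega> * H \<omega>)) \<in> borel_measurable M" by measurable
    show "(\<lambda>\<omega>. e (F \<omega>) * s m (G \<omega>) * H \<omega>) \<in> borel_measurable M" for m by measurable
    show "integrable M (\<lambda>\<omega>. D * \<bar>G \<omega> * H \<omega>\<bar>)" using H(1) by auto
    show "AE \<omega> in M. (\<lambda>m. e (F \<omega>) * s m (G \<omega>) * H \<omega>) \<longlonglongrightarrow> e (F \<omega>) * (G \<omega> * H \<omega>)"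
      unfolding mult.assoc by (intro AE_I2 tendsto_mult tendsto_const slim)
    show "AE \<omega> in M. norm (e (F \<omega>) * s m (G \<omega>) * H \<omega>) \<le> D * \<bar>G \<omega> * H \<omega>\<bar>" for m
    proof (rule AE_I2)
      fix \<omega>
      have "\<bar>e (F \<omega>)\<bar> * \<bar>s m (G \<omega>)\<bar> * \<bar>H \<omega>\<bar> \<le> D * \<bar>G \<omega>\<bar> * \<bar>H \<omega>\<bar>"
        by (intro mult_mono e sle mult_nonneg_nonneg order_trans[OF abs_ge_zero e(1)] abs_ge_zero order_refl)
      then show "norm (e (F \<omega>) * s m (G \<omega>) * H \<omega>) \<le> D * \<bar>G \<omega> * H \<omega>\<bar>" by (simp add: abs_mult mult.assoc)
    qed
  qed
  have l1: "(\<lambda>m. expectation (\<lambda>\<omega>. a (F \<omega>) * s m (G \<omega>) * F \<omega>)) \<longlonglongrightarrow> expectation (\<lambda>\<omega>. a (F \<omega>) * (G \<omega> * F \<omega>))"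
    by (rule dom[OF A _ i1(1)]) measurable
  have l2: "(\<lambda>m. expectation (\<lambda>\<omega>. a' (F \<omega>) * s m (G \<omega>) * T \<omega>)) \<longlonglongrightarrow> expectation (\<lambda>\<omega>. a' (F \<omega>) * (G \<omega> * T \<omega>))"
    by (rule dom[OF A' _ i1(2)]) measurable
  have l3: "(\<lambda>m. expectation (\<lambda>\<omega>. a (F \<omega>) * c m (G \<omega>) * (u \<omega> \<bullet> W \<omega>))) \<longlonglongrightarrow> expectation (\<lambda>\<omega>. a (F \<omega>) * (u \<omega> \<bullet> W \<omega>))"
  proof (rule expectation_mult_tendsto[OF i1(3) _ ac])
    show "(\<lambda>m. a (F \<omega>) * c m (G \<omega>)) \<longlonglongrightarrow> a (F \<omega>)" for \<omega>
      using tendsto_mult[OF tendsto_const clim, of "a (F \<omega>)"] by simp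
  qed measurable
  show ?thesis
    by (rule LIMSEQ_unique[OF l1]) (unfold eq, rule tendsto_add[OF l2 l3])
qed

lemma duality_limit:
  assumes G: "malliavin_graph G W"
    and eq: "\<And>n. expectation (\<lambda>\<omega>. a n (F \<omega>) * (G \<omega> * F \<omega>)) =
      expectation (\<lambda>\<omega>. a' n (F \<omega>) * (G \<omega> * T \<omega>)) + expectation (\<lambda>\<omega>. a n (F \<omega>) * (u \<omega> \<bullet> W \<omega>))"
    and m: "\<And>n. a n \<in> borel_measurable borel" "\<And>n. a' n \<in> borel_measurable borel"
    and b: "\<And>n x. \<bar>a n x\<bar> \<le> A" "\<And>n x. \<bar>a' n x\<bar> \<le> A'"
    and l: "\<And>x. (\<lambda>n. a n x) \<longlonglongrightarrow> f x" "\<And>x. (\<lambda>n. a' n x) \<longlonglongrightarrow> f' x"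
  shows "expectation (\<lambda>\<omega>. f (F \<omega>) * (G \<omega> * F \<omega>)) =
    expectation (\<lambda>\<omega>. f' (F \<omega>) * (G \<omega> * T \<omega>)) + expectation (\<lambda>\<omega>. f (F \<omega>) * (u \<omega> \<bullet> W \<omega>))"
proof -
  have LG: "L2 M G" "L2 M W" using malliavin_graph_L2[OF G] by auto
  note [measurable] = m
  have i: "integrable M (\<lambda>\<omega>. G \<omega> * F \<omega>)" "integrable M (\<lambda>\<omega>. G \<omega> * T \<omega>)" "integrable M (\<lambda>\<omega>. u \<omega> \<bullet> W \<omega>)"
    by (intro L2_mult_integrable L2_inner_integrable LG F_L2 T u)+
  have t: "(\<lambda>n. expectation (\<lambda>\<omega>. a n (F \<omega>) * H \<omega>)) \<longlonglongrightarrow> expectation (\<lambda>\<omega>. f (F \<omega>) * H \<omega>)"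
    "(\<lambda>n. expectation (\<lambda>\<omega>. a' n (F \<omega>) * H \<omega>)) \<longlonglongrightarrow> expectation (\<lambda>\<omega>. f' (F \<omega>) * H \<omega>)"
    if "integrable M H" for H
    by (rule expectation_mult_tendsto[OF that _ b(1) l(1)] expectation_mult_tendsto[OF that _ b(2) l(2)], measurable)+
  show ?thesis
    by (rule LIMSEQ_unique[OF t(1)[OF i(1)]]) (unfold eq, rule tendsto_add[OF t(2)[OF i(2)] t(1)[OF i(3)]])
qed

text \<open>
The identity is stable under bounded convergence of \<open>f\<close> and \<open>f'\<close>, hence extends from trigonometric
polynomials first to \<open>f (K sin (x/K))\<close> and then to \<open>f\<close>.
\<close>

lemma duality_C1:
  assumes G: "malliavin_graph G W"
    and f: "\<And>x. (f has_real_derivative f' x) (at x)" "continuous_on UNIV f'"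
    and b: "\<And>x. \<bar>f x\<bar> \<le> A" "\<And>x. \<bar>f' x\<bar> \<le> A'"
  shows "expectation (\<lambda>\<omega>. f (F \<omega>) * (G \<omega> * F \<omega>)) =
    expectation (\<lambda>\<omega>. f' (F \<omega>) * (G \<omega> * T \<omega>)) + expectation (\<lambda>\<omega>. f (F \<omega>) * (u \<omega> \<bullet> W \<omega>))"
proof -
  have cf: "continuous_on UNIV f" using f(1) by (auto intro: continuous_at_imp_continuous_on DERIV_isCont)
  note [measurable] = borel_measurable_continuous_onI[OF cf] borel_measurable_continuous_onI[OF f(2)]
  have tm: "c \<in> borel_measurable borel" if "trig_fun c" for c
    using trig_fun_deriv[OF that] by (intro borel_measurable_continuous_onI continuous_at_imp_continuous_on) (auto intro: DERIV_isCont)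
  have folded: "expectation (\<lambda>\<omega>. f (K * sin (F \<omega> / K)) * (G \<omega> * F \<omega>)) =
    expectation (\<lambda>\<omega>. f' (K * sin (F \<omega> / K)) * cos (F \<omega> / K) * (G \<omega> * T \<omega>)) +
    expectation (\<lambda>\<omega>. f (K * sin (F \<omega> / K)) * (u \<omega> \<bullet> W \<omega>))" if K: "K > 0" for K
  proof (rule duality_limit[OF G, where a = "\<lambda>N. bernstein_sine K N f" and a' = "\<lambda>N. bernstein_sine_deriv K N f"])
    fix N
    obtain d where d: "trig_fun d" "\<And>x. (bernstein_sine K N f has_real_derivative d x) (at x)"
      using trig_fun_deriv[OF trig_fun_bernstein_sine[of K N f]] by blast
    have "d = bernstein_sine_deriv K N f"
      by (rule ext) (rule DERIV_unique[OF d(2) bernstein_sine_has_derivative[OF K]])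
    then have td: "trig_fun (bernstein_sine_deriv K N f)" using d(1) by simp
    show "expectation (\<lambda>\<omega>. bernstein_sine K N f (F \<omega>) * (G \<omega> * F \<omega>)) =
      expectation (\<lambda>\<omega>. bernstein_sine_deriv K N f (F \<omega>) * (G \<omega> * T \<omega>)) +
      expectation (\<lambda>\<omega>. bernstein_sine K N f (F \<omega>) * (u \<omega> \<bullet> W \<omega>))"
      by (rule duality_trig[OF G trig_fun_bernstein_sine td bernstein_sine_has_derivative[OF K]])
    show "bernstein_sine K N f \<in> borel_measurable borel" by (rule tm[OF trig_fun_bernstein_sine])
    show "bernstein_sine_deriv K N f \<in> borel_measurable borel" by (rule tm[OF td])
    show "\<bar>bernstein_sine K N f x\<bar> \<le> A" for x by (rule bernstein_sine_bound[OF b(1)])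
    show "\<bar>bernstein_sine_deriv K N f x\<bar> \<le> A'" for x by (rule bernstein_sine_deriv_bound[OF f(1) K b(2)])
  next
    fix x
    show "(\<lambda>N. bernstein_sine K N f x) \<longlonglongrightarrow> f (K * sin (x / K))" by (rule bernstein_sine_tendsto[OF cf])
    show "(\<lambda>N. bernstein_sine_deriv K N f x) \<longlonglongrightarrow> f' (K * sin (x / K)) * cos (x / K)"
      by (rule bernstein_sine_deriv_tendsto[OF f(1) K f(2)])
  qed
  show ?thesis
  proof (rule duality_limit[OF G folded])
    show "0 < real (Suc m)" for m by simp
    show "(\<lambda>x. f (real (Suc m) * sin (x / real (Suc m)))) \<in> borel_measurable borel" for m by measurable
    show "(\<lambda>x. f' (real (Suc m) * sin (x / real (Suc m))) * cos (x / real (Suc m))) \<in> borel_measurable borel" for m by measurable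
    show "\<bar>f (real (Suc m) * sin (x / real (Suc m)))\<bar> \<le> A" for m x by (rule b)
    show "\<bar>f' (real (Suc m) * sin (x / real (Suc m))) * cos (x / real (Suc m))\<bar> \<le> A' * 1" for m x
      unfolding abs_mult by (intro mult_mono b abs_cos_le_one order_trans[OF abs_ge_zero b(2)] abs_ge_zero)
    have iso: "isCont f x" "isCont f' x" for x
      using cf f(2) continuous_on_eq_continuous_at[of UNIV] by auto
    show "(\<lambda>m. f (real (Suc m) * sin (x / real (Suc m)))) \<longlonglongrightarrow> f x" for x
      by (rule isCont_tendsto_compose[OF iso(1) scaled_sin_tendsto])
    show "(\<lambda>m. f' (real (Suc m) * sin (x / real (Suc m))) * cos (x / real (Suc m))) \<longlonglongrightarrow> f' x" for x
      using tendsto_mult[OF isCont_tendsto_compose[OF iso(2) scaled_sin_tendsto] scaled_cos_tendsto, of x x] by simp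
  qed
qed

text \<open>
Membership in \<open>\<bbbD>\<^sup>1\<^sup>,\<^sup>2\<close> only provides second moments. Take \<open>G = F\<close> and \<open>f = sqrt (1 + s\<^sup>2)\<close> with \<open>s = K sin (x/K)\<close>
in the dual chain rule: as \<open>\<bar>f'\<bar> \<le> 1\<close> and \<open>f(x) \<le> 1 + \<bar>x\<bar>\<close>, \<open>E f(F) F\<^sup>2 \<le> 2 E \<bar>F T\<bar> + E \<bar>T\<bar>\<close> for all \<open>K\<close>. Since
\<open>f(x) \<rightarrow> sqrt (1 + x\<^sup>2) \<ge> \<bar>x\<bar>\<close>, Fatou's lemma bounds the third absolute moment.
\<close>

lemma cube_integrable: "integrable M (\<lambda>\<omega>. (F \<omega>) ^ 3)"
proof -
  define s where "s m x = real (Suc m) * sin (x / real (Suc m))" for m x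
  define r where "r m x = sqrt (1 + (s m x)\<^sup>2)" for m x
  define r' where "r' m x = s m x / r m x * cos (x / real (Suc m))" for m x
  have sle: "\<bar>s m x\<bar> \<le> \<bar>x\<bar>" for m x unfolding s_def by (rule abs_scaled_sin_le) simp
  have sb: "\<bar>s m x\<bar> \<le> real (Suc m)" for m x
    unfolding s_def abs_mult using mult_left_mono[OF abs_sin_le_one, of "real (Suc m)"] by simp
  have r1: "1 \<le> r m x" for m x unfolding r_def by simp
  have rne: "r m x \<noteq> 0" for m x using r1[of m x] by auto
  have sr: "\<bar>s m x\<bar> \<le> r m x" for m x unfolding r_def by (rule real_le_rsqrt) simp
  have rle: "r m x \<le> 1 + \<bar>s m x\<bar>" for m x
    unfolding r_def by (rule real_le_lsqrt) (auto simp: power2_sum)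
  have dr: "(r m has_real_derivative r' m x) (at x)" for m x
  proof -
    have ds: "(s m has_real_derivative cos (x / real (Suc m))) (at x)"
      unfolding s_def[abs_def] by (rule DERIV_scaled_sin) simp
    have p: "0 < 1 + (s m x)\<^sup>2" by (simp add: add_pos_nonneg)
    have "((\<lambda>x. 1 + (s m x)\<^sup>2) has_real_derivative 2 * s m x * cos (x / real (Suc m))) (at x)"
      by (auto intro!: derivative_eq_intros ds)
    from DERIV_chain2[OF DERIV_real_sqrt[OF p] this]
    have "(r m has_real_derivative inverse (sqrt (1 + (s m x)\<^sup>2)) / 2 * (2 * s m x * cos (x / real (Suc m)))) (at x)"
      unfolding r_def[abs_def] .
    moreover have "inverse (sqrt (1 + (s m x)\<^sup>2)) / 2 * (2 * s m x * cos (x / real (Suc m))) = r' m x"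
      unfolding r'_def r_def by (simp add: field_simps)
    ultimately show ?thesis by simp
  qed
  have r'b: "\<bar>r' m x\<bar> \<le> 1 * 1" for m x
    unfolding r'_def abs_mult
  proof (rule mult_mono)
    show "\<bar>s m x / r m x\<bar> \<le> 1" using sr[of m x] r1[of m x] by (simp add: abs_divide)
  qed auto
  have cs: "continuous_on UNIV (s m)" for m unfolding s_def[abs_def] by (intro continuous_intros) simp
  have cr: "continuous_on UNIV (r m)" for m unfolding r_def[abs_def] by (intro continuous_intros cs)
  have cr': "continuous_on UNIV (r' m)" for m
    unfolding r'_def[abs_def] by (intro continuous_intros cs cr) (simp_all add: rne)
  note [measurable] = borel_measurable_continuous_onI[OF cr] borel_measurable_continuous_onI[OF cr']
  have rb: "\<bar>r m x\<bar> \<le> 1 + real (Suc m)" for m x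
    using r1[of m x] rle[of m x] sb[of m x] by linarith
  have iFT: "integrable M (\<lambda>\<omega>. \<bar>F \<omega> * T \<omega>\<bar>)" using FT_integrable by auto
  have iT: "integrable M (\<lambda>\<omega>. \<bar>T \<omega>\<bar>)" using L2_imp_integrable[OF T(1)] by auto
  define R where "R = expectation (\<lambda>\<omega>. 2 * \<bar>F \<omega> * T \<omega>\<bar> + \<bar>T \<omega>\<bar>)"
  have iFF: "integrable M (\<lambda>\<omega>. F \<omega> * F \<omega>)" by (rule L2_mult_integrable[OF F_L2 F_L2])
  have int_r: "integrable M (\<lambda>\<omega>. r m (F \<omega>) * (F \<omega> * F \<omega>))" for m
    by (rule integrable_bounded_mult[OF iFF _ rb]) measurable
  have le: "expectation (\<lambda>\<omega>. r m (F \<omega>) * (F \<omega> * F \<omega>)) \<le> R" for m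
  proof -
    have i1: "integrable M (\<lambda>\<omega>. r' m (F \<omega>) * (F \<omega> * T \<omega>))"
      by (rule integrable_bounded_mult[OF FT_integrable _ r'b]) measurable
    have i2: "integrable M (\<lambda>\<omega>. r m (F \<omega>) * T \<omega>)"
      by (rule integrable_bounded_mult[OF L2_imp_integrable[OF T(1)] _ rb]) measurable
    have "expectation (\<lambda>\<omega>. r m (F \<omega>) * (F \<omega> * F \<omega>)) =
        expectation (\<lambda>\<omega>. r' m (F \<omega>) * (F \<omega> * T \<omega>)) + expectation (\<lambda>\<omega>. r m (F \<omega>) * T \<omega>)"
      using duality_C1[OF F dr cr' rb r'b] by (simp add: T(2))
    also have "\<dots> = expectation (\<lambda>\<omega>. r' m (F \<omega>) * (F \<omega> * T \<omega>) + r m (F \<omega>) * T \<omega>)"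
      by (rule Bochner_Integration.integral_add[OF i1 i2, symmetric])
    also have "\<dots> \<le> R"
      unfolding R_def
    proof (rule integral_mono)
      show "integrable M (\<lambda>\<omega>. r' m (F \<omega>) * (F \<omega> * T \<omega>) + r m (F \<omega>) * T \<omega>)"
        by (rule Bochner_Integration.integrable_add[OF i1 i2])
      show "integrable M (\<lambda>\<omega>. 2 * \<bar>F \<omega> * T \<omega>\<bar> + \<bar>T \<omega>\<bar>)"
        by (intro Bochner_Integration.integrable_add integrable_mult_right iFT iT)
      fix \<omega>
      have "r' m (F \<omega>) * (F \<omega> * T \<omega>) \<le> 1 * \<bar>F \<omega> * T \<omega>\<bar>"
        using order_trans[OF abs_ge_self, of "r' m (F \<omega>) * (F \<omega> * T \<omega>)"] mult_right_mono[OF r'b[of m "F \<omega>"], of "\<bar>F \<omega> * T \<omega>\<bar>"]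
        by (simp add: abs_mult)
      moreover have "r m (F \<omega>) * T \<omega> \<le> (1 + \<bar>F \<omega>\<bar>) * \<bar>T \<omega>\<bar>"
      proof -
        have "r m (F \<omega>) * T \<omega> \<le> r m (F \<omega>) * \<bar>T \<omega>\<bar>"
          using r1[of m "F \<omega>"] by (intro mult_left_mono) auto
        also have "\<dots> \<le> (1 + \<bar>F \<omega>\<bar>) * \<bar>T \<omega>\<bar>"
          using rle[of m "F \<omega>"] sle[of m "F \<omega>"] by (intro mult_right_mono) auto
        finally show ?thesis .
      qed
      ultimately show "r' m (F \<omega>) * (F \<omega> * T \<omega>) + r m (F \<omega>) * T \<omega> \<le> 2 * \<bar>F \<omega> * T \<omega>\<bar> + \<bar>T \<omega>\<bar>"
        by (simp add: abs_mult algebra_simps)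
    qed
    finally show ?thesis .
  qed
  have nn: "(\<integral>\<^sup>+\<omega>. ennreal (r m (F \<omega>) * (F \<omega> * F \<omega>)) \<partial>M) \<le> ennreal R" for m
  proof -
    have "0 \<le> r m (F \<omega>) * (F \<omega> * F \<omega>)" for \<omega> using r1[of m "F \<omega>"] by simp
    then show ?thesis using le[of m] by (simp add: nn_integral_eq_integral[OF int_r] ennreal_leI)
  qed
  have lim: "(\<lambda>m. r m x) \<longlonglongrightarrow> sqrt (1 + x\<^sup>2)" for x
    unfolding r_def s_def by (intro tendsto_intros scaled_sin_tendsto)
  have "(\<integral>\<^sup>+\<omega>. ennreal (norm ((F \<omega>) ^ 3)) \<partial>M) \<le> (\<integral>\<^sup>+\<omega>. liminf (\<lambda>m. ennreal (r m (F \<omega>) * (F \<omega> * F \<omega>))) \<partial>M)"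
  proof (rule nn_integral_mono)
    fix \<omega>
    have "(\<lambda>m. ennreal (r m (F \<omega>) * (F \<omega> * F \<omega>))) \<longlonglongrightarrow> ennreal (sqrt (1 + (F \<omega>)\<^sup>2) * (F \<omega> * F \<omega>))"
      by (intro tendsto_ennrealI tendsto_mult tendsto_const lim)
    then have "liminf (\<lambda>m. ennreal (r m (F \<omega>) * (F \<omega> * F \<omega>))) = ennreal (sqrt (1 + (F \<omega>)\<^sup>2) * (F \<omega> * F \<omega>))"
      by (rule lim_imp_Liminf[OF sequentially_bot])
    moreover have "norm ((F \<omega>) ^ 3) \<le> sqrt (1 + (F \<omega>)\<^sup>2) * (F \<omega> * F \<omega>)"
    proof -
      have "\<bar>F \<omega>\<bar> \<le> sqrt (1 + (F \<omega>)\<^sup>2)" by (rule real_le_rsqrt) simp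
      from mult_right_mono[OF this, of "F \<omega> * F \<omega>"] show ?thesis
        by (simp add: power3_eq_cube abs_mult mult.assoc)
    qed
    ultimately show "ennreal (norm ((F \<omega>) ^ 3)) \<le> liminf (\<lambda>m. ennreal (r m (F \<omega>) * (F \<omega> * F \<omega>)))"
      by (simp add: ennreal_leI)
  qed
  also have "\<dots> \<le> liminf (\<lambda>m. \<integral>\<^sup>+\<omega>. ennreal (r m (F \<omega>) * (F \<omega> * F \<omega>)) \<partial>M)"
    by (rule nn_integral_liminf) measurable
  also have "\<dots> \<le> ennreal R"
    by (rule Liminf_le) (simp_all add: nn)
  finally have "(\<integral>\<^sup>+\<omega>. ennreal (norm ((F \<omega>) ^ 3)) \<partial>M) < \<infinity>" by (simp add: le_less_trans)
  then show ?thesis by (intro integrableI_bounded) auto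
qed

text \<open>
The dual chain rule with \<open>G = F\<close> and \<open>f(x) = K sin (x/K)\<close>, in the limit \<open>K \<rightarrow> \<infinity>\<close>.
\<close>

lemma expectation_cube: "expectation (\<lambda>\<omega>. (F \<omega>) ^ 3) = 2 * expectation (\<lambda>\<omega>. F \<omega> * T \<omega>)"
proof -
  define s where "s m x = real (Suc m) * sin (x / real (Suc m))" for m x
  define c where "c m x = cos (x / real (Suc m))" for m x
  have sle: "\<bar>s m x\<bar> \<le> \<bar>x\<bar>" for m x unfolding s_def by (rule abs_scaled_sin_le) simp
  have sb: "\<bar>s m x\<bar> \<le> real (Suc m)" for m x
    unfolding s_def abs_mult using mult_left_mono[OF abs_sin_le_one, of "real (Suc m)"] by simp
  have ds: "(s m has_real_derivative c m x) (at x)" for m x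
    unfolding s_def[abs_def] c_def by (rule DERIV_scaled_sin) simp
  have cb: "\<bar>c m x\<bar> \<le> 1" for m x unfolding c_def by simp
  have cs: "continuous_on UNIV (s m)" and cc: "continuous_on UNIV (c m)" for m
    unfolding s_def[abs_def] c_def[abs_def] by (intro continuous_intros; simp)+
  note [measurable] = borel_measurable_continuous_onI[OF cs] borel_measurable_continuous_onI[OF cc]
  have slim: "(\<lambda>m. s m x) \<longlonglongrightarrow> x" and clim: "(\<lambda>m. c m x) \<longlonglongrightarrow> 1" for x
    unfolding s_def c_def by (rule scaled_sin_tendsto scaled_cos_tendsto)+
  have eq: "expectation (\<lambda>\<omega>. s m (F \<omega>) * (F \<omega> * F \<omega>)) =
      expectation (\<lambda>\<omega>. c m (F \<omega>) * (F \<omega> * T \<omega>)) + expectation (\<lambda>\<omega>. s m (F \<omega>) * T \<omega>)" for m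
    using duality_C1[OF F ds cc sb cb] by (simp add: T(2))
  have dom: "(\<lambda>m. expectation (\<lambda>\<omega>. s m (F \<omega>) * H \<omega>)) \<longlonglongrightarrow> expectation (\<lambda>\<omega>. F \<omega> * H \<omega>)"
    if H: "integrable M (\<lambda>\<omega>. F \<omega> * H \<omega>)" and [measurable]: "H \<in> borel_measurable M" for H
  proof (rule integral_dominated_convergence[where w = "\<lambda>\<omega>. \<bar>F \<omega> * H \<omega>\<bar>"])
    show "integrable M (\<lambda>\<omega>. \<bar>F \<omega> * H \<omega>\<bar>)" using H by auto
    show "AE \<omega> in M. (\<lambda>m. s m (F \<omega>) * H \<omega>) \<longlonglongrightarrow> F \<omega> * H \<omega>"
      by (intro AE_I2 tendsto_mult tendsto_const slim)
    show "AE \<omega> in M. norm (s m (F \<omega>) * H \<omega>) \<le> \<bar>F \<omega> * H \<omega>\<bar>" for m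
      by (intro AE_I2) (simp add: abs_mult mult_right_mono sle)
  qed measurable
  have l1: "(\<lambda>m. expectation (\<lambda>\<omega>. s m (F \<omega>) * (F \<omega> * F \<omega>))) \<longlonglongrightarrow> expectation (\<lambda>\<omega>. F \<omega> * (F \<omega> * F \<omega>))"
    by (rule dom) (use cube_integrable in \<open>simp_all add: power3_eq_cube mult.assoc\<close>)
  have l2: "(\<lambda>m. expectation (\<lambda>\<omega>. c m (F \<omega>) * (F \<omega> * T \<omega>))) \<longlonglongrightarrow> expectation (\<lambda>\<omega>. 1 * (F \<omega> * T \<omega>))"
    by (rule expectation_mult_tendsto[OF FT_integrable _ cb clim]) measurable
  have l3: "(\<lambda>m. expectation (\<lambda>\<omega>. s m (F \<omega>) * T \<omega>)) \<longlonglongrightarrow> expectation (\<lambda>\<omega>. F \<omega> * T \<omega>)"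
    by (rule dom[OF FT_integrable]) measurable
  have "expectation (\<lambda>\<omega>. F \<omega> * (F \<omega> * F \<omega>)) = expectation (\<lambda>\<omega>. 1 * (F \<omega> * T \<omega>)) + expectation (\<lambda>\<omega>. F \<omega> * T \<omega>)"
    by (rule LIMSEQ_unique[OF l1]) (unfold eq, rule tendsto_add[OF l2 l3])
  then show ?thesis by (simp add: power3_eq_cube mult.assoc)
qed

end

section \<open>Stein's equation\<close>

abbreviation gauss :: "real \<Rightarrow> real" where "gauss \<equiv> std_normal_density"

lemma gauss_pos: "0 < gauss x"
  by (simp add: normal_density_pos)

lemma gauss_integrable: "integrable lborel gauss"
  using integrable_std_normal_moment[of 0] by simp

lemma gauss_integral: "(\<integral>x. gauss x \<partial>lborel) = 1"
  by (rule integral_normal_density) simp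

lemma gauss_DERIV: "(gauss has_real_derivative - x * gauss x) (at x)"
  unfolding std_normal_density_def[abs_def]
  by (auto intro!: derivative_eq_intros simp: field_simps)

lemma gauss_minus: "gauss (- x) = gauss x"
  by (simp add: std_normal_density_def)

lemma gauss_mult_integrable:
  assumes "q \<in> borel_measurable borel" "\<And>x. \<bar>q x\<bar> \<le> B"
  shows "integrable lborel (\<lambda>x. q x * gauss x)"
proof (rule Bochner_Integration.integrable_bound)
  show "integrable lborel (\<lambda>x. B * gauss x)" by (intro integrable_mult_right gauss_integrable)
  show "(\<lambda>x. q x * gauss x) \<in> borel_measurable lborel" using assms(1) by simp
  have "0 \<le> B" using order_trans[OF abs_ge_zero assms(2)] .
  then show "AE x in lborel. norm (q x * gauss x) \<le> norm (B * gauss x)"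
    using gauss_pos by (intro AE_I2) (simp add: abs_mult assms(2) mult_right_mono less_imp_le)
qed

definition gauss_tail :: "real \<Rightarrow> real" where
  "gauss_tail x = (\<integral>y. indicator {x..} y * gauss y \<partial>lborel)"

lemma gauss_set_integrable: "A \<in> sets borel \<Longrightarrow> integrable lborel (\<lambda>y. indicator A y * gauss y)"
  by (rule gauss_mult_integrable[where B = 1]) (auto simp: indicator_def)

lemma gauss_lower_tail: "(\<integral>y. indicator {..x} y * gauss y \<partial>lborel) = gauss_tail (- x)"
proof -
  have "(\<integral>y. indicator {..x} y * gauss y \<partial>lborel) = (\<integral>y. indicator {..x} (- y) * gauss (- y) \<partial>lborel)"
    using lborel_integral_real_affine[of "-1" "\<lambda>y. indicator {..x} y * gauss y" 0] by simp
  also have "\<dots> = gauss_tail (- x)"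
    unfolding gauss_tail_def gauss_minus
    by (intro Bochner_Integration.integral_cong refl) (auto simp: indicator_def)
  finally show ?thesis .
qed

lemma gauss_tail_0: "gauss_tail 0 = 1 / 2"
proof -
  have "1 = (\<integral>y. gauss y \<partial>lborel)" by (rule gauss_integral[symmetric])
  also have "\<dots> = (\<integral>y. indicator {0..} y * gauss y + indicator {..0} y * gauss y \<partial>lborel)"
  proof (rule integral_cong_AE)
    show "AE x in lborel. gauss x = indicator {0..} x * gauss x + indicator {..0} x * gauss x"
      using AE_lborel_singleton[of 0] by eventually_elim (auto simp: indicator_def)
  qed auto
  also have "\<dots> = gauss_tail 0 + gauss_tail (- 0)"
    by (subst Bochner_Integration.integral_add) (simp_all add: gauss_set_integrable gauss_lower_tail, simp add: gauss_tail_def)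
  finally show ?thesis by simp
qed

text \<open>
For \<open>x, t \<ge> 0\<close> the density at \<open>x + t\<close> is at most \<open>exp (- x\<^sup>2/2)\<close> times the density at \<open>t\<close>.
\<close>

lemma gauss_tail_le:
  assumes "0 \<le> x" shows "gauss_tail x \<le> sqrt (pi / 2) * gauss x"
proof -
  have "gauss_tail x = (\<integral>t. indicator {x..} (x + t) * gauss (x + t) \<partial>lborel)"
    using lborel_integral_real_affine[of 1 "\<lambda>y. indicator {x..} y * gauss y" x] by (simp add: gauss_tail_def)
  also have "\<dots> \<le> (\<integral>t. (sqrt (2 * pi) * gauss x) * (indicator {0..} t * gauss t) \<partial>lborel)"
  proof (rule integral_mono)
    show "integrable lborel (\<lambda>t. indicator {x..} (x + t) * gauss (x + t))"
      using lborel_integrable_real_affine[OF gauss_set_integrable[of "{x..}"], of 1 x] by simp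
    show "integrable lborel (\<lambda>t. (sqrt (2 * pi) * gauss x) * (indicator {0..} t * gauss t))"
      by (intro integrable_mult_right gauss_set_integrable) simp
    fix t :: real
    show "indicator {x..} (x + t) * gauss (x + t) \<le> (sqrt (2 * pi) * gauss x) * (indicator {0..} t * gauss t)"
    proof (cases "0 \<le> t")
      case True
      have "- (x + t)\<^sup>2 / 2 \<le> - x\<^sup>2 / 2 + - t\<^sup>2 / 2"
        using mult_nonneg_nonneg[OF assms True] by (simp add: power2_sum field_simps)
      then have "exp (- (x + t)\<^sup>2 / 2) \<le> exp (- x\<^sup>2 / 2) * exp (- t\<^sup>2 / 2)"
        by (simp add: exp_add[symmetric])
      then have "1 / sqrt (2 * pi) * exp (- (x + t)\<^sup>2 / 2) \<le> 1 / sqrt (2 * pi) * (exp (- x\<^sup>2 / 2) * exp (- t\<^sup>2 / 2))"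
        by (intro mult_left_mono) auto
      then show ?thesis using True by (simp add: std_normal_density_def mult.assoc)
    qed (simp add: indicator_def)
  qed
  also have "\<dots> = sqrt (2 * pi) * gauss x * (1 / 2)"
    unfolding integral_mult_right_zero using gauss_tail_0 by (simp add: gauss_tail_def)
  also have "sqrt (2 * pi) = 2 * sqrt (pi / 2)"
  proof -
    have "sqrt (2 * pi) = sqrt (4 * (pi / 2))" by simp
    also have "\<dots> = sqrt 4 * sqrt (pi / 2)" by (rule real_sqrt_mult)
    finally show ?thesis by simp
  qed
  finally show ?thesis by simp
qed

text \<open>
Replace \<open>x\<close> by the larger \<open>y\<close> under the integral, where \<open>y * gauss y\<close> has the primitive \<open>- gauss y\<close>.
\<close>

lemma mult_gauss_tail_le:
  assumes "0 \<le> x" shows "x * gauss_tail x \<le> gauss x"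
proof -
  have nn: "(\<integral>\<^sup>+y. ennreal (y * gauss y) * indicator {x..} y \<partial>lborel) = ennreal (0 - (- gauss x))"
  proof (rule nn_integral_FTC_atLeast)
    show "((\<lambda>y. - gauss y) has_real_derivative y * gauss y) (at y)" for y
      using DERIV_minus[OF gauss_DERIV[of y]] by simp
    show "0 \<le> y * gauss y" if "x \<le> y" for y using that assms gauss_pos[of y] by simp
    have "eventually (\<lambda>y::real. y \<le> y\<^sup>2 / 2) at_top"
      using eventually_ge_at_top[of 2]
    proof eventually_elim
      case (elim y)
      then show ?case using mult_right_mono[of 2 y y] by (simp add: power2_eq_square)
    qed
    from filterlim_at_top_mono[OF filterlim_ident this]
    have "LIM y at_top. - (y\<^sup>2 / 2 :: real) :> at_bot" unfolding filterlim_uminus_at_top .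
    from filterlim_compose[OF exp_at_bot this]
    have "((\<lambda>y :: real. 1 / sqrt (2 * pi) * exp (- (y\<^sup>2 / 2))) \<longlongrightarrow> 1 / sqrt (2 * pi) * 0) at_top"
      by (intro tendsto_mult tendsto_const)
    then have "(gauss \<longlongrightarrow> 0) at_top" by (simp add: std_normal_density_def[abs_def])
    from tendsto_minus[OF this] show "((\<lambda>y. - gauss y) \<longlongrightarrow> 0) at_top" by simp
  qed simp
  have "ennreal (x * gauss_tail x) = ennreal (\<integral>y. x * (indicator {x..} y * gauss y) \<partial>lborel)"
    by (simp add: gauss_tail_def)
  also have "\<dots> = (\<integral>\<^sup>+y. ennreal (x * (indicator {x..} y * gauss y)) \<partial>lborel)"
  proof (rule nn_integral_eq_integral[symmetric])
    show "integrable lborel (\<lambda>y. x * (indicator {x..} y * gauss y))"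
      by (intro integrable_mult_right gauss_set_integrable) simp
    show "AE y in lborel. 0 \<le> x * (indicator {x..} y * gauss y)"
      using assms gauss_pos by (auto simp: less_imp_le)
  qed
  also have "\<dots> \<le> (\<integral>\<^sup>+y. ennreal (y * gauss y) * indicator {x..} y \<partial>lborel)"
    using gauss_pos by (intro nn_integral_mono) (auto simp: indicator_def less_imp_le intro!: ennreal_leI mult_right_mono)
  finally show ?thesis unfolding nn using gauss_pos[of x] by simp
qed

text \<open>
The solution is \<open>f = H / gauss\<close> with \<open>H(x)\<close> the integral of \<open>(q - c) gauss\<close> over \<open>(-\<infinity>, x]\<close>. As the integral over
the whole line vanishes, \<open>\<bar>H(x)\<bar>\<close> is at most \<open>\<beta>\<close> times the Gaussian tail beyond \<open>\<bar>x\<bar>\<close>. The two tail bounds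
then control \<open>f\<close> and \<open>x f(x)\<close>, and so \<open>f' = x f + q - c\<close>.
\<close>

theorem stein_solution:
  fixes q :: "real \<Rightarrow> real"
  assumes q: "continuous_on UNIV q" and c: "c = (\<integral>x. q x * gauss x \<partial>lborel)" and \<beta>: "\<And>x. \<bar>q x - c\<bar> \<le> \<beta>"
  obtains f f' where "\<And>x. (f has_real_derivative f' x) (at x)" "continuous_on UNIV f'"
    "\<And>x. f' x = x * f x + (q x - c)" "\<And>x. \<bar>f x\<bar> \<le> sqrt (pi / 2) * \<beta>" "\<And>x. \<bar>f' x\<bar> \<le> 2 * \<beta>"
proof -
  define w where "w y = (q y - c) * gauss y" for y
  have [measurable]: "q \<in> borel_measurable borel" by (rule borel_measurable_continuous_onI[OF q])
  have \<beta>0: "0 \<le> \<beta>" using order_trans[OF abs_ge_zero \<beta>] .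
  have wint: "integrable lborel w" unfolding w_def[abs_def] by (rule gauss_mult_integrable[OF _ \<beta>]) simp
  have [measurable]: "w \<in> borel_measurable borel" using wint by auto
  have cg: "isCont gauss x" for x using gauss_DERIV by (rule DERIV_isCont)
  have cq: "isCont q x" for x using q continuous_on_eq_continuous_at[of UNIV q] by auto
  have cw: "isCont w x" for x unfolding w_def[abs_def] by (intro continuous_intros cq cg)
  have wset: "integrable lborel (\<lambda>y. indicator A y * w y)" if "A \<in> sets borel" for A
    using integrable_mult_indicator[OF _ wint, of A] that by simp
  have w0: "(\<integral>y. w y \<partial>lborel) = 0"
  proof -
    have "\<bar>q x\<bar> \<le> \<beta> + \<bar>c\<bar>" for x using \<beta>[of x] by linarith
    then have "integrable lborel (\<lambda>y. q y * gauss y)" by (rule gauss_mult_integrable[rotated]) simp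
    then have "(\<integral>y. w y \<partial>lborel) = (\<integral>y. q y * gauss y \<partial>lborel) - c * (\<integral>y. gauss y \<partial>lborel)"
      unfolding w_def left_diff_distrib using gauss_integrable by simp
    then show ?thesis by (simp add: c[symmetric] gauss_integral)
  qed
  define H where "H x = (\<integral>y. indicator {..x} y * w y \<partial>lborel)" for x
  \<comment> \<open>\<open>H\<close> differs by a constant from any primitive \<open>G\<close> of \<open>w\<close>, and is differentiable for that reason.\<close>
  obtain G where G: "\<And>x. (G has_real_derivative w x) (at x)"
    using einterval_antiderivative[of "- \<infinity>" "\<infinity>" w] cw
    by (auto simp: has_real_derivative_iff_has_vector_derivative)
  have HG: "H b - H a = G b - G a" if "a \<le> b" for a b
  proof -
    have "H b - H a = (\<integral>y. indicator {..b} y * w y - indicator {..a} y * w y \<partial>lborel)"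
      unfolding H_def by (rule Bochner_Integration.integral_diff[symmetric]) (simp_all add: wset)
    also have "\<dots> = (\<integral>y. w y * indicator {a..b} y \<partial>lborel)"
    proof (rule integral_cong_AE)
      show "AE y in lborel. indicator {..b} y * w y - indicator {..a} y * w y = w y * indicator {a..b} y"
        using AE_lborel_singleton[of a] by eventually_elim (use that in \<open>auto simp: indicator_def\<close>)
    qed auto
    also have "\<dots> = G b - G a" by (rule integral_FTC_Icc_real[OF that G cw])
    finally show ?thesis .
  qed
  have HG0: "H x = G x + (H 0 - G 0)" for x
    using HG[of 0 x] HG[of x 0] by (cases "0 \<le> x") auto
  have dH: "(H has_real_derivative w x) (at x)" for x
  proof -
    have H: "H = (\<lambda>x. G x + (H 0 - G 0))" by (rule ext) (rule HG0)
    have "((\<lambda>x. G x + (H 0 - G 0)) has_real_derivative w x + 0) (at x)"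
      by (rule DERIV_add[OF G DERIV_const])
    then show ?thesis by (subst H) simp
  qed
  have wb: "\<bar>\<integral>y. indicator A y * w y \<partial>lborel\<bar> \<le> \<beta> * (\<integral>y. indicator A y * gauss y \<partial>lborel)" if A: "A \<in> sets borel" for A
  proof -
    have "\<bar>\<integral>y. indicator A y * w y \<partial>lborel\<bar> \<le> (\<integral>y. \<bar>indicator A y * w y\<bar> \<partial>lborel)" by (rule integral_abs_bound)
    also have "\<dots> \<le> (\<integral>y. \<beta> * (indicator A y * gauss y) \<partial>lborel)"
    proof (rule integral_mono)
      show "\<bar>indicator A y * w y\<bar> \<le> \<beta> * (indicator A y * gauss y)" for y
        using gauss_pos[of y] \<beta>[of y] by (auto simp: w_def indicator_def abs_mult intro!: mult_right_mono)
    qed (intro integrable_abs wset A integrable_mult_right gauss_set_integrable)+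
    finally show ?thesis by simp
  qed
  have Hb: "\<bar>H x\<bar> \<le> \<beta> * gauss_tail \<bar>x\<bar>" for x
  proof (cases "0 \<le> x")
    case True
    have "(\<integral>y. w y \<partial>lborel) = (\<integral>y. indicator {..x} y * w y + indicator {x..} y * w y \<partial>lborel)"
    proof (rule integral_cong_AE)
      show "AE y in lborel. w y = indicator {..x} y * w y + indicator {x..} y * w y"
        using AE_lborel_singleton[of x] by eventually_elim (auto simp: indicator_def)
    qed auto
    also have "\<dots> = H x + (\<integral>y. indicator {x..} y * w y \<partial>lborel)"
      unfolding H_def by (rule Bochner_Integration.integral_add) (simp_all add: wset)
    finally have "\<bar>H x\<bar> = \<bar>\<integral>y. indicator {x..} y * w y \<partial>lborel\<bar>" using w0 by linarith
    also have "\<dots> \<le> \<beta> * gauss_tail x" unfolding gauss_tail_def by (rule wb) simp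
    finally show ?thesis using True by simp
  next
    case False
    have "\<bar>H x\<bar> \<le> \<beta> * (\<integral>y. indicator {..x} y * gauss y \<partial>lborel)" unfolding H_def by (rule wb) simp
    then show ?thesis using False by (simp add: gauss_lower_tail)
  qed
  have gabs: "gauss \<bar>x\<bar> = gauss x" for x by (simp add: abs_if gauss_minus)
  define f where "f x = H x / gauss x" for x
  define f' where "f' x = x * f x + (q x - c)" for x
  have df: "(f has_real_derivative f' x) (at x)" for x
  proof -
    have "((\<lambda>x. H x / gauss x) has_real_derivative (w x * gauss x - H x * (- x * gauss x)) / (gauss x * gauss x)) (at x)"
      by (rule DERIV_divide[OF dH gauss_DERIV]) (use gauss_pos[of x] in simp)
    moreover have "(w x * gauss x - H x * (- x * gauss x)) / (gauss x * gauss x) = f' x"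
      using gauss_pos[of x] by (simp add: f'_def f_def w_def field_simps)
    ultimately show ?thesis unfolding f_def[abs_def] by simp
  qed
  have fb: "\<bar>f x\<bar> \<le> sqrt (pi / 2) * \<beta>" for x
  proof -
    have "\<bar>H x\<bar> \<le> \<beta> * (sqrt (pi / 2) * gauss x)"
      using order_trans[OF Hb mult_left_mono[OF gauss_tail_le \<beta>0], of x] by (simp add: gabs)
    then show ?thesis unfolding f_def using gauss_pos[of x] by (simp add: abs_divide pos_divide_le_eq mult_ac)
  qed
  have xfb: "\<bar>x * f x\<bar> \<le> \<beta>" for x
  proof -
    have "\<bar>x\<bar> * \<bar>H x\<bar> \<le> \<bar>x\<bar> * (\<beta> * gauss_tail \<bar>x\<bar>)" by (intro mult_left_mono Hb) simp
    also have "\<dots> = \<beta> * (\<bar>x\<bar> * gauss_tail \<bar>x\<bar>)" by simp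
    also have "\<dots> \<le> \<beta> * gauss \<bar>x\<bar>" by (intro mult_left_mono mult_gauss_tail_le \<beta>0) simp
    finally show ?thesis unfolding f_def gabs using gauss_pos[of x] by (simp add: abs_mult abs_divide pos_divide_le_eq)
  qed
  show ?thesis
  proof (rule that[OF df _ f'_def fb])
    have "continuous_on UNIV f" using df by (auto intro: continuous_at_imp_continuous_on DERIV_isCont)
    then show "continuous_on UNIV f'" unfolding f'_def[abs_def] by (intro continuous_intros q)
    show "\<bar>f' x\<bar> \<le> 2 * \<beta>" for x unfolding f'_def using xfb[of x] \<beta>[of x] by linarith
  qed
qed

lemma gauss_mean_bounds:
  assumes "continuous_on UNIV q" "\<And>x. a \<le> q x" "\<And>x. q x \<le> b"
  shows "a \<le> (\<integral>x. q x * gauss x \<partial>lborel)" "(\<integral>x. q x * gauss x \<partial>lborel) \<le> b"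
proof -
  have [measurable]: "q \<in> borel_measurable borel" by (rule borel_measurable_continuous_onI[OF assms(1)])
  have "\<bar>q x\<bar> \<le> \<bar>a\<bar> + \<bar>b\<bar>" for x using assms(2,3)[of x] by linarith
  then have i: "integrable lborel (\<lambda>x. q x * gauss x)" by (rule gauss_mult_integrable[rotated]) simp
  have "(\<integral>x. a * gauss x \<partial>lborel) \<le> (\<integral>x. q x * gauss x \<partial>lborel)" "(\<integral>x. q x * gauss x \<partial>lborel) \<le> (\<integral>x. b * gauss x \<partial>lborel)"
    by (intro integral_mono i integrable_mult_right gauss_integrable mult_right_mono assms less_imp_le[OF gauss_pos])+
  then show "a \<le> (\<integral>x. q x * gauss x \<partial>lborel)" "(\<integral>x. q x * gauss x \<partial>lborel) \<le> b"
    by (simp_all add: gauss_integral)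
qed

section \<open>The second order bound in total variation\<close>

context divergence_pair
begin

text \<open>
The chain of identities described at the beginning. Centering keeps the bound \<open>1\<close>
for \<open>h\<close>, which has values in \<open>[0, 1]\<close>, and doubles the others: \<open>\<beta>\<close> is \<open>1\<close>, then \<open>4\<close> since \<open>\<bar>f'\<bar> \<le> 2\<close>, then \<open>2 sqrt (8\<pi>)\<close> since \<open>\<bar>g\<bar> \<le> 4 sqrt (\<pi>/2) = sqrt (8\<pi>)\<close>.
The term \<open>k'(F) S (1 - T)\<close> is split by \<open>2 \<bar>a b\<bar> \<le> a\<^sup>2 + b\<^sup>2\<close>, which is where the constant \<open>sqrt (32\<pi>)\<close>
appears twice.
\<close>

lemma second_order_stein_bound:
  assumes V: "malliavin_graph T V" and S: "S = (\<lambda>\<omega>. u \<omega> \<bullet> V \<omega>)"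
    and U: "malliavin_graph S U" and R: "R = (\<lambda>\<omega>. u \<omega> \<bullet> U \<omega>)"
    and F2: "expectation (\<lambda>\<omega>. (F \<omega>)\<^sup>2) = 1"
    and h: "continuous_on UNIV h" "\<And>x. 0 \<le> h x" "\<And>x. h x \<le> 1"
  shows "\<bar>expectation (\<lambda>\<omega>. h (F \<omega>)) - (\<integral>x. h x * gauss x \<partial>lborel)\<bar> \<le>
    (8 + sqrt (32 * pi)) * expectation (\<lambda>\<omega>. (norm (V \<omega>))\<^sup>2)
    + sqrt (2 * pi) * \<bar>expectation (\<lambda>\<omega>. (F \<omega>) ^ 3)\<bar>
    + sqrt (32 * pi) * expectation (\<lambda>\<omega>. \<bar>S \<omega>\<bar>\<^sup>2)
    + 4 * pi * expectation (\<lambda>\<omega>. \<bar>R \<omega>\<bar>)"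
proof -
  define c where "c = (\<integral>x. h x * gauss x \<partial>lborel)"
  have "0 \<le> c" "c \<le> 1" unfolding c_def by (rule gauss_mean_bounds[OF h])+
  then have hc: "\<bar>h x - c\<bar> \<le> 1" for x using h(2,3)[of x] by (simp add: abs_le_iff)
  obtain f f' where f: "\<And>x. (f has_real_derivative f' x) (at x)" "continuous_on UNIV f'"
    "\<And>x. f' x = x * f x + (h x - c)" "\<And>x. \<bar>f x\<bar> \<le> sqrt (pi / 2) * 1" "\<And>x. \<bar>f' x\<bar> \<le> 2 * 1"
    by (rule stein_solution[OF h(1) c_def hc]) (rule that)
  define d where "d = (\<integral>x. f' x * gauss x \<partial>lborel)"
  have "- 2 \<le> f' x" "f' x \<le> 2" for x using f(5)[of x] by (simp_all add: abs_le_iff)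
  then have "- 2 \<le> d" "d \<le> 2" unfolding d_def by (rule gauss_mean_bounds[OF f(2)])+
  then have fd: "\<bar>f' x - d\<bar> \<le> 4" for x using f(5)[of x] by (simp add: abs_le_iff)
  obtain g g' where g: "\<And>x. (g has_real_derivative g' x) (at x)" "continuous_on UNIV g'"
    "\<And>x. g' x = x * g x + (f' x - d)" "\<And>x. \<bar>g x\<bar> \<le> sqrt (pi / 2) * 4" "\<And>x. \<bar>g' x\<bar> \<le> 2 * 4"
    by (rule stein_solution[OF f(2) d_def fd]) (rule that)
  define B where "B = sqrt (pi / 2) * 4"
  have cg: "continuous_on UNIV g" using g(1) by (auto intro: continuous_at_imp_continuous_on DERIV_isCont)
  define e where "e = (\<integral>x. g x * gauss x \<partial>lborel)"
  have "- B \<le> g x" "g x \<le> B" for x using g(4)[of x] by (simp_all add: abs_le_iff B_def)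
  then have eB: "- B \<le> e" "e \<le> B" unfolding e_def by (rule gauss_mean_bounds[OF cg])+
  then have ge: "\<bar>g x - e\<bar> \<le> 2 * B" for x using g(4)[of x] unfolding B_def[symmetric] by (simp add: abs_le_iff)
  obtain k k' where k: "\<And>x. (k has_real_derivative k' x) (at x)" "continuous_on UNIV k'"
    "\<And>x. k' x = x * k x + (g x - e)" "\<And>x. \<bar>k x\<bar> \<le> sqrt (pi / 2) * (2 * B)" "\<And>x. \<bar>k' x\<bar> \<le> 2 * (2 * B)"
    by (rule stein_solution[OF cg e_def ge]) (rule that)
  have cf: "continuous_on UNIV f" using f(1) by (auto intro: continuous_at_imp_continuous_on DERIV_isCont)
  have ck: "continuous_on UNIV k" using k(1) by (auto intro: continuous_at_imp_continuous_on DERIV_isCont)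
  have LV: "L2 M V" and LS: "L2 M S" and LU: "L2 M U"
    using malliavin_graph_L2[OF V] malliavin_graph_L2[OF U] by auto
  have iF2: "integrable M (\<lambda>\<omega>. F \<omega> * F \<omega>)" by (rule L2_mult_integrable[OF F_L2 F_L2])
  have iT: "integrable M T" and iF: "integrable M F" and iS: "integrable M S"
    by (rule L2_imp_integrable[OF T(1)] L2_imp_integrable[OF F_L2] L2_imp_integrable[OF LS])+
  have iT2: "integrable M (\<lambda>\<omega>. T \<omega> * T \<omega>)" and iST: "integrable M (\<lambda>\<omega>. S \<omega> * T \<omega>)"
    and iTF: "integrable M (\<lambda>\<omega>. T \<omega> * F \<omega>)" and iSF: "integrable M (\<lambda>\<omega>. S \<omega> * F \<omega>)"
    by (intro L2_mult_integrable T(1) LS F_L2)+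
  have iR: "integrable M R" unfolding R by (rule L2_inner_integrable[OF u LU])
  note [measurable] = borel_measurable_continuous_onI[OF h(1)] borel_measurable_continuous_onI[OF cf]
    borel_measurable_continuous_onI[OF f(2)] borel_measurable_continuous_onI[OF cg] borel_measurable_continuous_onI[OF g(2)]
    borel_measurable_continuous_onI[OF ck] borel_measurable_continuous_onI[OF k(2)] L2_measurable[OF LS]
  have ET: "expectation T = 1"
    using duality[OF F] F2 by (simp add: T(2) power2_eq_square inner_commute)
  have ES: "expectation (\<lambda>\<omega>. (F \<omega>) ^ 3) = 2 * expectation S"
    using duality[OF V] expectation_cube by (simp add: S inner_commute mult.commute)
  have one: "malliavin_graph (\<lambda>_. 1) (\<lambda>_. 0)" by (rule malliavin_graph_const)
  have b: "integrable M (\<lambda>\<omega>. q (F \<omega>) * H \<omega>)"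
    if "continuous_on UNIV q" "\<And>x. \<bar>q x\<bar> \<le> D" "integrable M H" for q :: "real \<Rightarrow> real" and D and H :: "'a \<Rightarrow> real"
  proof (rule integrable_bounded_mult[OF that(3)])
    note [measurable] = borel_measurable_continuous_onI[OF that(1)]
    show "\<bar>q (F \<omega>)\<bar> \<le> D" for \<omega> by (rule that(2))
    show "(\<lambda>\<omega>. q (F \<omega>)) \<in> borel_measurable M" by measurable
  qed
  note ib = b[OF cf f(4)] b[OF f(2,5)] b[OF cg g(4)] b[OF g(2,5)] b[OF ck k(4)] b[OF k(2,5)]
  have id1: "expectation (\<lambda>\<omega>. f (F \<omega>) * F \<omega>) = expectation (\<lambda>\<omega>. f' (F \<omega>) * T \<omega>)"
    using duality_C1[OF one f(1,2,4,5)] by simp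
  have id2: "expectation (\<lambda>\<omega>. g (F \<omega>) * F \<omega>) = expectation (\<lambda>\<omega>. g' (F \<omega>) * T \<omega>)"
    using duality_C1[OF one g(1,2,4,5)] by simp
  have id3: "expectation (\<lambda>\<omega>. g (F \<omega>) * (T \<omega> * F \<omega>)) =
      expectation (\<lambda>\<omega>. g' (F \<omega>) * (T \<omega> * T \<omega>)) + expectation (\<lambda>\<omega>. g (F \<omega>) * S \<omega>)"
    using duality_C1[OF V g(1,2,4,5)] by (simp add: S)
  have id4: "expectation (\<lambda>\<omega>. k (F \<omega>) * (S \<omega> * F \<omega>)) =
      expectation (\<lambda>\<omega>. k' (F \<omega>) * (S \<omega> * T \<omega>)) + expectation (\<lambda>\<omega>. k (F \<omega>) * R \<omega>)"
    using duality_C1[OF U k(1,2,4,5)] by (simp add: R)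
  have step1: "expectation (\<lambda>\<omega>. h (F \<omega>)) - c = expectation (\<lambda>\<omega>. f' (F \<omega>)) - expectation (\<lambda>\<omega>. f' (F \<omega>) * T \<omega>)"
  proof -
    have ih: "integrable M (\<lambda>\<omega>. h (F \<omega>))"
      using b[OF h(1), of 1 "\<lambda>_. 1"] h(2,3) by simp
    have if': "integrable M (\<lambda>\<omega>. f' (F \<omega>))" using ib(2)[of "\<lambda>_. 1"] by simp
    have "expectation (\<lambda>\<omega>. h (F \<omega>)) - c = expectation (\<lambda>\<omega>. h (F \<omega>) - c)" using ih by (simp add: prob_space)
    also have "\<dots> = expectation (\<lambda>\<omega>. f' (F \<omega>) - f (F \<omega>) * F \<omega>)"
      by (simp add: f(3) mult.commute)
    also have "\<dots> = expectation (\<lambda>\<omega>. f' (F \<omega>)) - expectation (\<lambda>\<omega>. f (F \<omega>) * F \<omega>)"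
      by (rule Bochner_Integration.integral_diff[OF if' ib(1)[OF iF]])
    finally show ?thesis unfolding id1 .
  qed
  have step2: "expectation (\<lambda>\<omega>. f' (F \<omega>)) - expectation (\<lambda>\<omega>. f' (F \<omega>) * T \<omega>) =
      expectation (\<lambda>\<omega>. g' (F \<omega>) * (1 - T \<omega>)\<^sup>2) + expectation (\<lambda>\<omega>. g (F \<omega>) * S \<omega>)"
  proof -
    have if': "integrable M (\<lambda>\<omega>. f' (F \<omega>))" and ig': "integrable M (\<lambda>\<omega>. g' (F \<omega>))"
      using ib(2)[of "\<lambda>_. 1"] ib(4)[of "\<lambda>_. 1"] by simp_all
    have "expectation (\<lambda>\<omega>. f' (F \<omega>)) = d + expectation (\<lambda>\<omega>. g' (F \<omega>)) - expectation (\<lambda>\<omega>. g (F \<omega>) * F \<omega>)"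
    proof -
      have "expectation (\<lambda>\<omega>. f' (F \<omega>)) = expectation (\<lambda>\<omega>. (d + g' (F \<omega>)) - g (F \<omega>) * F \<omega>)"
        by (simp add: g(3) mult.commute)
      then show ?thesis using ig' ib(3)[OF iF] by (simp add: prob_space)
    qed
    moreover have "expectation (\<lambda>\<omega>. f' (F \<omega>) * T \<omega>) =
        d + expectation (\<lambda>\<omega>. g' (F \<omega>) * T \<omega>) - expectation (\<lambda>\<omega>. g (F \<omega>) * (T \<omega> * F \<omega>))"
    proof -
      have "f' (F \<omega>) * T \<omega> = (d * T \<omega> + g' (F \<omega>) * T \<omega>) - g (F \<omega>) * (T \<omega> * F \<omega>)" for \<omega>
        unfolding g(3) by (simp add: algebra_simps)
      then show ?thesis using iT ib(4)[OF iT] ib(3)[OF iTF] ET by simp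
    qed
    moreover have "expectation (\<lambda>\<omega>. g' (F \<omega>) * (1 - T \<omega>)\<^sup>2) =
        expectation (\<lambda>\<omega>. g' (F \<omega>)) - 2 * expectation (\<lambda>\<omega>. g' (F \<omega>) * T \<omega>) + expectation (\<lambda>\<omega>. g' (F \<omega>) * (T \<omega> * T \<omega>))"
    proof -
      have "g' (F \<omega>) * (1 - T \<omega>)\<^sup>2 = g' (F \<omega>) - 2 * (g' (F \<omega>) * T \<omega>) + g' (F \<omega>) * (T \<omega> * T \<omega>)" for \<omega>
        by (simp add: power2_eq_square algebra_simps)
      then show ?thesis using ig' ib(4)[OF iT] ib(4)[OF iT2] by simp
    qed
    ultimately show ?thesis using id2 id3 by linarith
  qed
  have step3: "expectation (\<lambda>\<omega>. g (F \<omega>) * S \<omega>) =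
      e * expectation S + expectation (\<lambda>\<omega>. k' (F \<omega>) * (S \<omega> * (1 - T \<omega>))) - expectation (\<lambda>\<omega>. k (F \<omega>) * R \<omega>)"
  proof -
    have "g (F \<omega>) * S \<omega> = (e * S \<omega> + k' (F \<omega>) * S \<omega>) - k (F \<omega>) * (S \<omega> * F \<omega>)" for \<omega>
      unfolding k(3) by (simp add: algebra_simps)
    then have "expectation (\<lambda>\<omega>. g (F \<omega>) * S \<omega>) =
        e * expectation S + expectation (\<lambda>\<omega>. k' (F \<omega>) * S \<omega>) - expectation (\<lambda>\<omega>. k (F \<omega>) * (S \<omega> * F \<omega>))"
      using iS ib(6)[OF iS] ib(5)[OF iSF] by simp
    moreover have "expectation (\<lambda>\<omega>. k' (F \<omega>) * (S \<omega> * (1 - T \<omega>))) =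
        expectation (\<lambda>\<omega>. k' (F \<omega>) * S \<omega>) - expectation (\<lambda>\<omega>. k' (F \<omega>) * (S \<omega> * T \<omega>))"
    proof -
      have "k' (F \<omega>) * (S \<omega> * (1 - T \<omega>)) = k' (F \<omega>) * S \<omega> - k' (F \<omega>) * (S \<omega> * T \<omega>)" for \<omega>
        by (simp add: algebra_simps)
      then show ?thesis using ib(6)[OF iS] ib(6)[OF iST] by simp
    qed
    ultimately show ?thesis using id4 by linarith
  qed
  define v where "v = expectation (\<lambda>\<omega>. (1 - T \<omega>)\<^sup>2)"
  have L1T: "L2 M (\<lambda>\<omega>. 1 - T \<omega>)" by (rule L2_diff[OF _ T(1)]) (simp add: L2_def)
  have i1T: "integrable M (\<lambda>\<omega>. (1 - T \<omega>)\<^sup>2)" by (rule L2_real_integrable[OF L1T])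
  have v: "v \<le> expectation (\<lambda>\<omega>. (norm (V \<omega>))\<^sup>2)"
  proof -
    have "v = expectation (\<lambda>\<omega>. 1 - 2 * T \<omega> + T \<omega> * T \<omega>)"
      unfolding v_def by (simp add: power2_eq_square algebra_simps)
    also have "\<dots> = expectation (\<lambda>\<omega>. (T \<omega>)\<^sup>2) - (expectation T)\<^sup>2"
      using iT iT2 ET by (simp add: prob_space power2_eq_square)
    finally show ?thesis using poincare_malliavin[OF V] by simp
  qed
  have m: "\<bar>expectation (\<lambda>\<omega>. q (F \<omega>) * H \<omega>)\<bar> \<le> D * expectation (\<lambda>\<omega>. \<bar>H \<omega>\<bar>)"
    if "continuous_on UNIV q" "\<And>x. \<bar>q x\<bar> \<le> D" "integrable M H" for q :: "real \<Rightarrow> real" and D and H :: "'a \<Rightarrow> real"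
  proof -
    have "\<bar>expectation (\<lambda>\<omega>. q (F \<omega>) * H \<omega>)\<bar> \<le> expectation (\<lambda>\<omega>. \<bar>q (F \<omega>) * H \<omega>\<bar>)" by (rule integral_abs_bound)
    also have "\<dots> \<le> expectation (\<lambda>\<omega>. D * \<bar>H \<omega>\<bar>)"
      by (intro integral_mono integrable_abs b[OF that] integrable_mult_right that(3))
        (simp add: abs_mult mult_right_mono that(2))
    finally show ?thesis by simp
  qed
  have A: "\<bar>expectation (\<lambda>\<omega>. g' (F \<omega>) * (1 - T \<omega>)\<^sup>2)\<bar> \<le> 8 * v"
    using m[OF g(2,5) i1T] by (simp add: v_def)
  have B: "\<bar>e * expectation S\<bar> \<le> sqrt (2 * pi) * \<bar>expectation (\<lambda>\<omega>. (F \<omega>) ^ 3)\<bar>"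
  proof -
    have "\<bar>e\<bar> * \<bar>expectation S\<bar> \<le> B * \<bar>expectation S\<bar>" using eB by (intro mult_right_mono) auto
    moreover have "B = 2 * sqrt (2 * pi)"
      using real_sqrt_mult[of 4 "pi / 2"] by (simp add: B_def)
    ultimately show ?thesis unfolding ES by (simp add: abs_mult)
  qed
  have C: "\<bar>expectation (\<lambda>\<omega>. k' (F \<omega>) * (S \<omega> * (1 - T \<omega>)))\<bar> \<le> sqrt (32 * pi) * (expectation (\<lambda>\<omega>. \<bar>S \<omega>\<bar>\<^sup>2) + v)"
  proof -
    have iSv: "integrable M (\<lambda>\<omega>. S \<omega> * (1 - T \<omega>))" by (rule L2_mult_integrable[OF LS L1T])
    have iS2: "integrable M (\<lambda>\<omega>. \<bar>S \<omega>\<bar>\<^sup>2)" using L2_real_integrable[OF LS] by simp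
    have "expectation (\<lambda>\<omega>. \<bar>S \<omega> * (1 - T \<omega>)\<bar>) \<le> expectation (\<lambda>\<omega>. (\<bar>S \<omega>\<bar>\<^sup>2 + (1 - T \<omega>)\<^sup>2) / 2)"
    proof (rule integral_mono)
      show "integrable M (\<lambda>\<omega>. (\<bar>S \<omega>\<bar>\<^sup>2 + (1 - T \<omega>)\<^sup>2) / 2)" using iS2 i1T by simp
      show "\<bar>S \<omega> * (1 - T \<omega>)\<bar> \<le> (\<bar>S \<omega>\<bar>\<^sup>2 + (1 - T \<omega>)\<^sup>2) / 2" for \<omega>
        using zero_le_power2[of "\<bar>S \<omega>\<bar> - \<bar>1 - T \<omega>\<bar>"] by (simp add: power2_diff abs_mult)
    qed (rule integrable_abs[OF iSv])
    also have "\<dots> = (expectation (\<lambda>\<omega>. \<bar>S \<omega>\<bar>\<^sup>2) + v) / 2" using iS2 i1T by (simp add: v_def)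
    finally have "2 * (2 * B) * expectation (\<lambda>\<omega>. \<bar>S \<omega> * (1 - T \<omega>)\<bar>) \<le> 2 * (2 * B) * ((expectation (\<lambda>\<omega>. \<bar>S \<omega>\<bar>\<^sup>2) + v) / 2)"
      by (rule mult_left_mono) (simp add: B_def)
    from order_trans[OF m[OF k(2,5) iSv] this]
    have "\<bar>expectation (\<lambda>\<omega>. k' (F \<omega>) * (S \<omega> * (1 - T \<omega>)))\<bar> \<le> (2 * B) * (expectation (\<lambda>\<omega>. \<bar>S \<omega>\<bar>\<^sup>2) + v)"
      by simp
    moreover have "2 * B = sqrt (32 * pi)"
      using real_sqrt_mult[of 64 "pi / 2"] by (simp add: B_def)
    ultimately show ?thesis by (simp only:)
  qed
  have D: "\<bar>expectation (\<lambda>\<omega>. k (F \<omega>) * R \<omega>)\<bar> \<le> 4 * pi * expectation (\<lambda>\<omega>. \<bar>R \<omega>\<bar>)"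
  proof -
    have "sqrt (pi / 2) * (2 * B) = 8 * (sqrt (pi / 2) * sqrt (pi / 2))" by (simp add: B_def)
    also have "\<dots> = 4 * pi" by (simp del: real_sqrt_divide)
    finally show ?thesis using m[OF ck k(4) iR] by (simp only:)
  qed
  have "sqrt (32 * pi) * v \<le> sqrt (32 * pi) * expectation (\<lambda>\<omega>. (norm (V \<omega>))\<^sup>2)"
    by (intro mult_left_mono v) simp
  then show ?thesis
    using A B C D v unfolding c_def[symmetric] step1 step2 step3 abs_le_iff distrib_right distrib_left
    by linarith
qed

end

text \<open>
Regularity gives a compact set inside \<open>A\<close> and an open set around \<open>A\<close> that are close to \<open>A\<close> for both
measures, and Urysohn's lemma a continuous function between their indicators.
\<close>

lemma borel_continuous_approximation:
  assumes "finite_measure \<mu>" "finite_measure \<nu>" and s: "sets \<mu> = sets borel" "sets \<nu> = sets (borel :: real measure)"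
    and A: "A \<in> sets borel" and \<epsilon>: "\<epsilon> > 0"
  obtains h :: "real \<Rightarrow> real" where "continuous_on UNIV h" "\<And>x. 0 \<le> h x" "\<And>x. h x \<le> 1"
    "\<bar>(\<integral>x. h x \<partial>\<mu>) - measure \<mu> A\<bar> \<le> \<epsilon>" "\<bar>(\<integral>x. h x \<partial>\<nu>) - measure \<nu> A\<bar> \<le> \<epsilon>"
proof -
  interpret \<mu>: finite_measure \<mu> by fact
  interpret \<nu>: finite_measure \<nu> by fact
  have inner: "\<exists>K. compact K \<and> K \<subseteq> A \<and> measure \<rho> A - measure \<rho> K < \<epsilon> / 2"
    and outer: "\<exists>W. open W \<and> A \<subseteq> W \<and> measure \<rho> W - measure \<rho> A < \<epsilon> / 2"
    if "finite_measure \<rho>" and sr: "sets \<rho> = sets borel" for \<rho> :: "real measure"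
  proof -
    interpret \<rho>: finite_measure \<rho> by fact
    have fin: "emeasure \<rho> (space \<rho>) \<noteq> \<infinity>" by simp
    have m0: "0 < ennreal (\<epsilon> / 2)" using \<epsilon> by simp
    show "\<exists>K. compact K \<and> K \<subseteq> A \<and> measure \<rho> A - measure \<rho> K < \<epsilon> / 2"
    proof (cases "measure \<rho> A < \<epsilon> / 2")
      case True then show ?thesis by (intro exI[of _ "{}"]) simp
    next
      case False
      have "ennreal (measure \<rho> A - \<epsilon> / 2) < emeasure \<rho> A"
        unfolding \<rho>.emeasure_eq_measure using False \<epsilon> by (intro ennreal_lessI) auto
      also have "emeasure \<rho> A = (SUP K\<in>{K. K \<subseteq> A \<and> compact K}. emeasure \<rho> K)"
        by (rule inner_regular[OF sr fin]) (simp add: sr A)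
      finally obtain K where K: "K \<subseteq> A" "compact K" "ennreal (measure \<rho> A - \<epsilon> / 2) < emeasure \<rho> K"
        unfolding less_SUP_iff by auto
      then have "measure \<rho> A - \<epsilon> / 2 < measure \<rho> K"
        using False unfolding \<rho>.emeasure_eq_measure by (simp add: ennreal_less_iff)
      then show ?thesis using K by (intro exI[of _ K]) simp
    qed
    have "(INF W\<in>{W. A \<subseteq> W \<and> open W}. emeasure \<rho> W) = emeasure \<rho> A"
      by (rule outer_regular[OF sr fin, symmetric]) (simp add: sr A)
    also have "\<dots> < ennreal (measure \<rho> A + \<epsilon> / 2)"
      unfolding \<rho>.emeasure_eq_measure using \<epsilon> by (intro ennreal_lessI) (auto simp: add_nonneg_pos)
    finally obtain W where W: "A \<subseteq> W" "open W" "emeasure \<rho> W < ennreal (measure \<rho> A + \<epsilon> / 2)"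
      unfolding INF_less_iff by auto
    then have "measure \<rho> W < measure \<rho> A + \<epsilon> / 2"
      unfolding \<rho>.emeasure_eq_measure by (simp add: ennreal_less_iff)
    then show "\<exists>W. open W \<and> A \<subseteq> W \<and> measure \<rho> W - measure \<rho> A < \<epsilon> / 2" using W by (intro exI[of _ W]) simp
  qed
  obtain K1 where K1: "compact K1" "K1 \<subseteq> A" "measure \<mu> A - measure \<mu> K1 < \<epsilon> / 2" using inner[OF assms(1) s(1)] by blast
  obtain K2 where K2: "compact K2" "K2 \<subseteq> A" "measure \<nu> A - measure \<nu> K2 < \<epsilon> / 2" using inner[OF assms(2) s(2)] by blast
  obtain W1 where W1: "open W1" "A \<subseteq> W1" "measure \<mu> W1 - measure \<mu> A < \<epsilon> / 2" using outer[OF assms(1) s(1)] by blast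
  obtain W2 where W2: "open W2" "A \<subseteq> W2" "measure \<nu> W2 - measure \<nu> A < \<epsilon> / 2" using outer[OF assms(2) s(2)] by blast
  define K where "K = K1 \<union> K2"
  define W where "W = W1 \<inter> W2"
  have K: "closed K" "K \<subseteq> A" and W: "closed (- W)" "A \<subseteq> W"
    using K1 K2 W1 W2 by (auto simp: K_def W_def compact_imp_closed)
  have disj: "- W \<inter> K = {}" using K W by auto
  obtain h :: "real \<Rightarrow> real" where h: "continuous_on UNIV h" "\<And>x. h x \<in> closed_segment 0 1"
    "\<And>x. x \<in> - W \<Longrightarrow> h x = 0" "\<And>x. x \<in> K \<Longrightarrow> h x = 1"
    by (rule Urysohn[OF W(1) K(1) disj, of "0::real" 1]) (rule that)
  have h01: "0 \<le> h x" "h x \<le> 1" for x using h(2)[of x] by (auto simp: closed_segment_eq_real_ivl)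
  have close: "\<bar>(\<integral>x. h x \<partial>\<rho>) - measure \<rho> A\<bar> \<le> \<epsilon>"
    if "finite_measure \<rho>" and sr: "sets \<rho> = sets borel" and "measure \<rho> A - measure \<rho> K' < \<epsilon> / 2" "measure \<rho> W' - measure \<rho> A < \<epsilon> / 2"
      "K' \<subseteq> K" "W \<subseteq> W'" "K' \<in> sets borel" "W' \<in> sets borel" for \<rho> K' W'
  proof -
    interpret \<rho>: finite_measure \<rho> by fact
    have sp: "space \<rho> = UNIV" using sets_eq_imp_space_eq[OF sr] by simp
    have meas: "h \<in> borel_measurable \<rho>"
      by (subst measurable_cong_sets[OF sr refl], rule borel_measurable_continuous_onI[OF h(1)])
    have ih: "integrable \<rho> h" by (rule \<rho>.integrable_const_bound[where B = 1]) (use h01 meas in auto)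
    have ii: "integrable \<rho> (indicator E :: real \<Rightarrow> real)" "(\<integral>x. indicator E x \<partial>\<rho>) = measure \<rho> E" if "E \<in> sets borel" for E
      using that by (auto simp: sr sp \<rho>.emeasure_eq_measure)
    have "(\<integral>x. indicator K' x \<partial>\<rho>) \<le> (\<integral>x. h x \<partial>\<rho>)"
      by (rule integral_mono[OF ii(1) ih]) (use that h h01 in \<open>auto simp: indicator_def\<close>)
    moreover have "(\<integral>x. h x \<partial>\<rho>) \<le> (\<integral>x. indicator W' x \<partial>\<rho>)"
    proof (rule integral_mono[OF ih ii(1)])
      show "h x \<le> indicator W' x" for x
      proof (cases "x \<in> W'")
        case False
        then have "x \<in> - W" using \<open>W \<subseteq> W'\<close> by auto
        from h(3)[OF this] show ?thesis by simp
      qed (simp add: h01)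
    qed fact
    ultimately show ?thesis using that ii(2)[of K'] ii(2)[of W'] \<epsilon> by (simp add: abs_le_iff)
  qed
  show ?thesis
  proof (rule that[OF h(1) h01])
    show "\<bar>(\<integral>x. h x \<partial>\<mu>) - measure \<mu> A\<bar> \<le> \<epsilon>"
      by (rule close[OF assms(1) s(1) K1(3) W1(3)])
        (use K1 W1 in \<open>auto simp: K_def W_def compact_imp_closed\<close>)
    show "\<bar>(\<integral>x. h x \<partial>\<nu>) - measure \<nu> A\<bar> \<le> \<epsilon>"
      by (rule close[OF assms(2) s(2) K2(3) W2(3)])
        (use K2 W2 in \<open>auto simp: K_def W_def compact_imp_closed\<close>)
  qed
qed

lemma tv_dist_le_of_continuous:
  assumes "prob_space M" "prob_space N" and F: "F \<in> borel_measurable M"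
    and Z: "distributed N lborel Z (\<lambda>x. ennreal (std_normal_density x))"
    and bound: "\<And>h. continuous_on UNIV h \<Longrightarrow> (\<And>x. 0 \<le> h x) \<Longrightarrow> (\<And>x. h x \<le> 1) \<Longrightarrow>
      \<bar>(\<integral>\<omega>. h (F \<omega>) \<partial>M) - (\<integral>x. h x * gauss x \<partial>lborel)\<bar> \<le> r"
  shows "tv_dist M F N Z \<le> r"
  unfolding tv_dist_def
proof (rule cSUP_least)
  show "sets borel \<noteq> ({} :: real set set)" by (metis empty_iff sets.empty_sets)
next
  fix A :: "real set" assume A: "A \<in> sets borel"
  interpret M: prob_space M by fact
  interpret N: prob_space N by fact
  have Zm: "Z \<in> borel_measurable N" using distributed_measurable[OF Z] by simp
  note [measurable] = F Zm
  let ?\<mu> = "distr M borel F" and ?\<nu> = "distr N borel Z"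
  have fin: "finite_measure ?\<mu>" "finite_measure ?\<nu>"
    using M.prob_space_distr[OF F] N.prob_space_distr[OF Zm] by (auto simp: prob_space_def)
  have \<mu>A: "measure ?\<mu> A = measure M (F -` A \<inter> space M)" and \<nu>A: "measure ?\<nu> A = measure N (Z -` A \<inter> space N)"
    using A by (simp_all add: measure_distr)
  have "\<bar>measure ?\<mu> A - measure ?\<nu> A\<bar> \<le> r + \<epsilon>" if \<epsilon>: "\<epsilon> > 0" for \<epsilon>
  proof -
    obtain h :: "real \<Rightarrow> real" where h: "continuous_on UNIV h" "\<And>x. 0 \<le> h x" "\<And>x. h x \<le> 1"
      "\<bar>(\<integral>x. h x \<partial>?\<mu>) - measure ?\<mu> A\<bar> \<le> \<epsilon> / 2" "\<bar>(\<integral>x. h x \<partial>?\<nu>) - measure ?\<nu> A\<bar> \<le> \<epsilon> / 2"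
      by (rule borel_continuous_approximation[OF fin _ _ A, of "\<epsilon> / 2"]) (use \<epsilon> that in auto)
    note [measurable] = borel_measurable_continuous_onI[OF h(1)]
    have "(\<integral>x. h x \<partial>?\<mu>) = (\<integral>\<omega>. h (F \<omega>) \<partial>M)" by (rule integral_distr) simp_all
    moreover have "(\<integral>x. h x \<partial>?\<nu>) = (\<integral>\<omega>. h (Z \<omega>) \<partial>N)" by (rule integral_distr) simp_all
    moreover have "(\<integral>\<omega>. h (Z \<omega>) \<partial>N) = (\<integral>x. h x * gauss x \<partial>lborel)"
      using distributed_integral[OF Z, of h] by (simp add: mult.commute)
    ultimately show ?thesis using bound[OF h(1,2,3)] h(4,5) unfolding abs_le_iff by linarith
  qed
  then have "\<bar>measure ?\<mu> A - measure ?\<nu> A\<bar> \<le> r" by (rule field_le_epsilon)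
  then show "\<bar>measure M (F -` A \<inter> space M) - measure N (Z -` A \<inter> space N)\<bar> \<le> r" unfolding \<mu>A \<nu>A .
qed

theorem proposition3p2:
  fixes M :: "'a measure"
    and X :: "'h::{real_inner, complete_space, second_countable_topology} \<Rightarrow> 'a \<Rightarrow> real"
    and u :: "'a \<Rightarrow> 'h"
    and F :: "'a \<Rightarrow> real"
    and N :: "'b measure"
    and Z :: "'b \<Rightarrow> real"
  assumes "isonormal_process M X"
    and "u \<in> dom_divergence M X"
    and "AE \<omega> in M. F \<omega> = divergence M X u \<omega>"
    and "F \<in> sobolev_space M X 3 2"
    and "(\<integral>\<omega>. (F \<omega>)\<^sup>2 \<partial>M) = 1"
    and "directional_D M X u F \<in> sobolev_space M X 1 2"
    and "(directional_D M X u ^^ 2) F \<in> sobolev_space M X 1 2"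
    and "prob_space N"
    and "distributed N lborel Z (\<lambda>x. ennreal (std_normal_density x))"
  shows "tv_dist M F N Z \<le>
      (8 + sqrt (32 * pi)) * (\<integral>\<omega>. (norm (malliavin_D M X (directional_D M X u F) \<omega>))\<^sup>2 \<partial>M)
      + sqrt (2 * pi) * \<bar>\<integral>\<omega>. (F \<omega>) ^ 3 \<partial>M\<bar>
      + sqrt (32 * pi) * (\<integral>\<omega>. \<bar>(directional_D M X u ^^ 2) F \<omega>\<bar>\<^sup>2 \<partial>M)
      + 4 * pi * (\<integral>\<omega>. \<bar>(directional_D M X u ^^ 3) F \<omega>\<bar> \<partial>M)"
proof -
  interpret isonormal_process M X by fact
  let ?D = "directional_D M X u"
  let ?T = "?D F"
  let ?S = "?D ?T"
  have pow: "(?D ^^ 2) F = ?S" "(?D ^^ 3) F = ?D ?S"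
    by (simp_all add: numeral_2_eq_2 numeral_3_eq_3)
  note DF = malliavin_D_graph[OF sobolev_space_mono[OF assms(4)]]
  note DT = malliavin_D_graph[OF assms(6)]
  have DS: "malliavin_graph ?S (malliavin_D M X ?S)" using malliavin_D_graph[OF assms(7)] unfolding pow .
  have u: "L2 M u" using assms(2) by (simp add: dom_divergence_def L2_def)
  note dv = divergence_duality[OF assms(2)]
  interpret divergence_pair M X u F ?T "malliavin_D M X F"
  proof unfold_locales
    fix G W assume G: "malliavin_graph G W"
    note [measurable] = L2_measurable[OF dv(1)] L2_measurable[OF malliavin_graph_L2(1)[OF G]]
      L2_measurable[OF malliavin_graph_L2(1)[OF DF]]
    have "expectation (\<lambda>\<omega>. G \<omega> * F \<omega>) = expectation (\<lambda>\<omega>. G \<omega> * divergence M X u \<omega>)"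
    proof (rule integral_cong_AE)
      show "AE \<omega> in M. G \<omega> * F \<omega> = G \<omega> * divergence M X u \<omega>"
        using assms(3) by eventually_elim simp
    qed measurable
    then show "expectation (\<lambda>\<omega>. G \<omega> * F \<omega>) = expectation (\<lambda>\<omega>. W \<omega> \<bullet> u \<omega>)"
      using dv(2)[OF G] by simp
  qed (use u DF malliavin_graph_L2(1)[OF DT] in \<open>simp_all add: directional_D_def\<close>)
  show ?thesis
    unfolding pow
  proof (rule tv_dist_le_of_continuous[OF prob_space_axioms assms(8) L2_measurable[OF F_L2] assms(9)])
    fix h :: "real \<Rightarrow> real"
    assume h: "continuous_on UNIV h" "\<And>x. 0 \<le> h x" "\<And>x. h x \<le> 1"
    show "\<bar>expectation (\<lambda>\<omega>. h (F \<omega>)) - (\<integral>x. h x * gauss x \<partial>lborel)\<bar> \<le>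
      (8 + sqrt (32 * pi)) * expectation (\<lambda>\<omega>. (norm (malliavin_D M X ?T \<omega>))\<^sup>2)
      + sqrt (2 * pi) * \<bar>expectation (\<lambda>\<omega>. (F \<omega>) ^ 3)\<bar>
      + sqrt (32 * pi) * expectation (\<lambda>\<omega>. \<bar>?S \<omega>\<bar>\<^sup>2)
      + 4 * pi * expectation (\<lambda>\<omega>. \<bar>?D ?S \<omega>\<bar>)"
      by (rule second_order_stein_bound[OF DT _ DS _ assms(5) h]) (simp_all add: directional_D_def[abs_def] fun_eq_iff)
  qed
qed

end
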